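(* Let $k$ be a field of characteristic zero and let $H:\ 1, h_1=r, h_2, \dots, h_e, h_{e+1}=0$ be an $O$-sequence (the Hilbert function of some standard graded artinian $k$-algebra in $r$ variables). Let $t$ be the smallest integer such that $h_t \le t$. Then all standard graded artinian $k$-algebras $A=k[x_1,\dots,x_r]/I$ having Hilbert function $H$ enjoy the Strong Lefschetz Property if and only if either (i) $r=2$; or (ii) $r>2$, $h_t\le 2$, and for all indices $i=1,2,\dots,t-1$ we have $h_{i-1}=((h_i)_{(i)})^{-1}_{-1}$.
   Context: $R=k[x_1,\dots,x_r]$ is the standard graded polynomial ring ($\deg x_i=1$) over a field $k$ of characteristic zero; a standard graded algebra is $A=R/I$ with $I$ a homogeneous ideal, and its Hilbert function is $H(A,d)=\dim_k A_d$; $A$ is artinian if its Hilbert function is eventually $0$. An $O$-sequence is a sequence that occurs as the Hilbert function of a standard graded $k$-algebra (characterized by Macaulay's theorem). A "general" linear form is one whose coefficients lie in a suitable nonempty Zariski-open subset of $k^r$. $A$ has the Strong Lefschetz Property (SLP) if for every $d\ge 1$ and a general linear form $L$, the multiplication map $\times L^d: A_i\to A_{i+d}$ has maximal rank (is injective or surjective) for all $i\ge 0$. Notation: for positive integers $n,d$, the $d$-binomial expansion of $n$ is the unique expression $n=\binom{n_d}{d}+\binom{n_{d-1}}{d-1}+\cdots+\binom{n_j}{j}$ with $n_d>n_{d-1}>\dots>n_j\ge j\ge 1$; then $(n_{(d)})^{-1}_{-1}=\binom{n_d-1}{d-1}+\binom{n_{d-1}-1}{d-2}+\cdots+\binom{n_j-1}{j-1}$,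 with the convention $\binom{m}{n}=0$ if $m<n$ or $n<0$.
   Formalization: The formal theorem assumes r ≥ 2; for r ≤ 1 the equivalence as stated fails, since for example k[x]/(x^2) (H: 1, 1, 0) is the only algebra with its Hilbert function and has the SLP, but neither (i) nor (ii) holds. *)

theory Defs
  imports Complex_Main "HOL-Library.Poly_Mapping"
begin

(* Polynomials in countably many variables x_0, x_1, ... over a field 'k:
   a monomial is a finitely supported exponent vector  nat \<Rightarrow>\<^sub>0 nat,
   a polynomial is a finitely supported coefficient function on monomials.
   The polynomial ring R = k[x_1,...,x_r] is the subring of polynomials
   only involving the variables x_0,...,x_(r-1). *)
type_synonym 'k mpoly = "(nat \<Rightarrow>\<^sub>0 nat) \<Rightarrow>\<^sub>0 'k"

definition mon_deg :: "(nat \<Rightarrow>\<^sub>0 nat) \<Rightarrow> nat" where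
  "mon_deg m = (\<Sum>j\<in>Poly_Mapping.keys m. Poly_Mapping.lookup m j)"

definition var :: "nat \<Rightarrow> 'k::comm_semiring_1 mpoly" where
  "var j = Poly_Mapping.single (Poly_Mapping.single j 1) 1"

definition const :: "'k::comm_semiring_1 \<Rightarrow> 'k mpoly" where
  "const c = Poly_Mapping.single 0 c"

definition kscale :: "'k::field \<Rightarrow> 'k mpoly \<Rightarrow> 'k mpoly" where
  "kscale c p = const c * p"

definition polyring :: "nat \<Rightarrow> 'k::comm_semiring_1 mpoly set" where
  "polyring r = {p. \<forall>m\<in>Poly_Mapping.keys p. Poly_Mapping.keys m \<subseteq> {..<r}}"

definition homog :: "nat \<Rightarrow> nat \<Rightarrow> 'k::comm_semiring_1 mpoly set" where
  "homog r d = {p \<in> polyring r. \<forall>m\<in>Poly_Mapping.keys p. mon_deg m = d}"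

definition hcomp :: "nat \<Rightarrow> 'k::comm_semiring_1 mpoly \<Rightarrow> 'k mpoly" where
  "hcomp d p = Abs_poly_mapping (\<lambda>m. if mon_deg m = d then Poly_Mapping.lookup p m else 0)"

definition homog_ideal :: "nat \<Rightarrow> 'k::comm_ring_1 mpoly set \<Rightarrow> bool" where
  "homog_ideal r I \<longleftrightarrow>
     I \<subseteq> polyring r \<and> 0 \<in> I \<and>
     (\<forall>p\<in>I. \<forall>q\<in>I. p + q \<in> I) \<and>
     (\<forall>p\<in>I. \<forall>q\<in>polyring r. q * p \<in> I) \<and>
     (\<forall>p\<in>I. \<forall>d. hcomp d p \<in> I)"

(* Hilbert function of A = R/I:  H(A,d) = dim_k A_d = dim_k R_d - dim_k I_d *)
definition hilb :: "nat \<Rightarrow> ('k::field) mpoly set \<Rightarrow> nat \<Rightarrow> nat" where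
  "hilb r I d = vector_space.dim kscale (homog r d :: 'k mpoly set) - vector_space.dim kscale (I \<inter> homog r d)"

definition artinian :: "nat \<Rightarrow> 'k::field mpoly set \<Rightarrow> bool" where
  "artinian r I \<longleftrightarrow> (\<exists>D. \<forall>d\<ge>D. hilb r I d = 0)"

definition O_sequence :: "'k::field itself \<Rightarrow> nat \<Rightarrow> (nat \<Rightarrow> nat) \<Rightarrow> bool" where
  "O_sequence TYPE('k) r h \<longleftrightarrow>
     (\<exists>I :: 'k mpoly set. homog_ideal r I \<and> hilb r I = h)"

definition eval :: "'k::comm_semiring_1 mpoly \<Rightarrow> (nat \<Rightarrow> 'k) \<Rightarrow> 'k" where
  "eval p c = (\<Sum>m\<in>Poly_Mapping.keys p. Poly_Mapping.lookup p m * (\<Prod>j\<in>Poly_Mapping.keys m. c j ^ Poly_Mapping.lookup m j))"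

definition linform :: "nat \<Rightarrow> (nat \<Rightarrow> 'k::comm_semiring_1) \<Rightarrow> 'k mpoly" where
  "linform r c = (\<Sum>j<r. const (c j) * var j)"

(* P holds for a general linear form of R: there is a nonempty Zariski-open subset
   U of k^r (the complement of the zero locus V(S) of a set S of polynomials of R)
   such that P holds for every linear form whose coefficient vector lies in U. *)
definition general_linform :: "nat \<Rightarrow> ('k::comm_semiring_1 mpoly \<Rightarrow> bool) \<Rightarrow> bool" where
  "general_linform r P \<longleftrightarrow>
     (\<exists>S \<subseteq> polyring r.
        (\<exists>c. \<not> (\<forall>f\<in>S. eval f c = 0)) \<and>
        (\<forall>c. \<not> (\<forall>f\<in>S. eval f c = 0) \<longrightarrow> P (linform r c)))"

(* the multiplication map  \<times>F : A_i \<rightarrow> A_(i+d)  (F homogeneous of degree d)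
   is injective, resp. surjective *)
definition mult_injective :: "nat \<Rightarrow> 'k::comm_ring_1 mpoly set \<Rightarrow> 'k mpoly \<Rightarrow> nat \<Rightarrow> bool" where
  "mult_injective r I F i \<longleftrightarrow> (\<forall>f\<in>homog r i. F * f \<in> I \<longrightarrow> f \<in> I)"

definition mult_surjective :: "nat \<Rightarrow> 'k::comm_ring_1 mpoly set \<Rightarrow> 'k mpoly \<Rightarrow> nat \<Rightarrow> nat \<Rightarrow> bool" where
  "mult_surjective r I F d i \<longleftrightarrow>
     (\<forall>g\<in>homog r (i + d). \<exists>f\<in>homog r i. g - F * f \<in> I)"

definition SLP :: "nat \<Rightarrow> 'k::comm_ring_1 mpoly set \<Rightarrow> bool" where
  "SLP r I \<longleftrightarrow>
     (\<forall>d\<ge>1. general_linform r (\<lambda>L. \<forall>i.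
        mult_injective r I (L ^ d) i \<or> mult_surjective r I (L ^ d) d i))"

(* d-binomial expansion of n: the unique list [n_d, n_(d-1), ..., n_j] with
   n = C(n_d,d) + ... + C(n_j,j), n_d > ... > n_j \<ge> j \<ge> 1;
   the list entry at position k is n_(d-k). *)
definition binom_expansion :: "nat \<Rightarrow> nat \<Rightarrow> nat list" where
  "binom_expansion d n = (THE ns. ns \<noteq> [] \<and> length ns \<le> d \<and> sorted_wrt (>) ns \<and>
      last ns \<ge> d + 1 - length ns \<and>
      n = (\<Sum>k<length ns. (ns ! k) choose (d - k)))"

definition binom_down :: "nat \<Rightarrow> nat \<Rightarrow> nat" where
  "binom_down d n = (let ns = binom_expansion d n in
      (\<Sum>k<length ns. (ns ! k - 1) choose (d - k - 1)))"

end

theory Submission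
  imports Defs "HOL-Computational_Algebra.Polynomial"
begin

text \<open>
  Order the monomials of degree d so that the variable of index 0 is the smallest one, and let D(d, n)
  and G(d, n) be the numbers of monomials divisible, respectively not divisible, by that variable
  among the first n ones; then D(d, n) is the number written with two indices -1 in the paper.
  Green's hyperplane restriction theorem says that multiplication by a general linear form has rank
  at least D(d, h d) into degree d. It implies Macaulay's bound D(d, h d) \<le> h (d - 1), so the
  lexicographic ideal with Hilbert function h exists.

  If D(d, h d) = h (d - 1) for all d < t, then multiplication by a general L is injective below
  degree t, and only degrees s \<ge> t with h s \<le> 2 remain. They are settled by the fact that the
  powers of linear forms span in characteristic zero (h s = 1), and by the fact that two forms of the
  same degree with proportional gradients are proportional (h s = 2). In two variables everything
  follows from the vanishing orders of a space of polynomials at a general point.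

  Conversely the lexicographic ideal fails the property. If D(d, h d) < h (d - 1) with d < t, then
  every linear form kills the monomials of degree d - 1 in positions from D(d, h d) on. If h t \<ge> 3
  and r \<ge> 3, then multiplication by the (t - 1)-st power of a linear form has rank at most 2 from
  degree 1 to degree t.
\<close>

section \<open>Monomials\<close>

text \<open>The property asks for open sets of linear forms, but the rank of multiplication by
  \<open>L ^ d\<close> is lower semicontinuous in the coefficients of L. It therefore suffices to
  exhibit one form for each pair (d, i), possibly a different one each time; only finitely many i
  matter because the algebra is artinian, and nonempty open sets meet because they can be compared
  along a line, where each loses finitely many points. Green's theorem is proved for an arbitrary
  subspace W of one degree, not for an ideal, since its induction replaces W by
  \<open>W + L R\<close> and by \<open>W : L\<close>. Counting monomials in initial segments turns
  the numerical step of that induction into a comparison of monomials; binomial expansions enter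
  only to identify D with \<open>binom_down\<close>. The minimality of t acts through h i > i for 0
  < i < t. This is what makes G(i, h i) positive, so that a rank of D(i, h i) misses surjectivity as
  well as injectivity.\<close>

abbreviation keys where "keys \<equiv> Poly_Mapping.keys"
abbreviation lookup where "lookup \<equiv> Poly_Mapping.lookup"

abbreviation unit_mon :: "nat \<Rightarrow> (nat \<Rightarrow>\<^sub>0 nat)" where
  "unit_mon j \<equiv> Poly_Mapping.single j (Suc 0)"

lemma lookup_unit_mon: "lookup (unit_mon j) i = (if i = j then 1 else 0)"
  by (simp add: lookup_single when_def)

lemma mon_deg_superset:
  assumes "finite A" "keys m \<subseteq> A"
  shows "mon_deg m = (\<Sum>j\<in>A. lookup m j)"
  unfolding mon_deg_def
  by (rule sum.mono_neutral_left) (use assms in \<open>auto simp: in_keys_iff\<close>)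

lemma mon_deg_add [simp]: "mon_deg (m + n) = mon_deg m + mon_deg n"
proof -
  have *: "keys (m + n) \<subseteq> keys m \<union> keys n"
    using Poly_Mapping.keys_add[of m n] by auto
  show ?thesis
    by (simp add: mon_deg_superset[of "keys m \<union> keys n", OF _ *] lookup_add sum.distrib
        mon_deg_superset[of "keys m \<union> keys n" m] mon_deg_superset[of "keys m \<union> keys n" n])
qed

lemma mon_deg_zero [simp]: "mon_deg 0 = 0"
  by (simp add: mon_deg_def)

lemma mon_deg_unit [simp]: "mon_deg (unit_mon j) = 1"
  by (simp add: mon_deg_def)

lemma mon_deg_eq_0_iff [simp]: "mon_deg m = 0 \<longleftrightarrow> m = 0"
proof
  assume "mon_deg m = 0"
  then have "\<forall>j\<in>keys m. lookup m j = 0" by (simp add: mon_deg_def)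
  then show "m = 0" by (auto intro!: poly_mapping_eqI simp: in_keys_iff)
qed simp

lemma keys_add_nat: "keys (m + n :: nat \<Rightarrow>\<^sub>0 nat) = keys m \<union> keys n"
  by (auto simp: in_keys_iff lookup_add)

lemma remove_unit:
  assumes "j \<in> keys m"
  obtains m' where "m = unit_mon j + m'"
proof
  show "m = unit_mon j + (m - unit_mon j)"
    using assms
    by (intro poly_mapping_eqI) (auto simp: lookup_add lookup_minus lookup_unit_mon in_keys_iff)
qed

definition mons :: "nat \<Rightarrow> nat \<Rightarrow> (nat \<Rightarrow>\<^sub>0 nat) set" where
  "mons v d = {m. keys m \<subseteq> {..<v} \<and> mon_deg m = d}"

lemma mons_0: "mons v 0 = {0}"
  by (auto simp: mons_def)

lemma mons_no_vars: "mons 0 (Suc d) = {}"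
  by (auto simp: mons_def)

text \<open>Pascal's rule on monomials, splitting by divisibility by the largest variable. Binomial
  expansions are later read off by the same splitting.\<close>

lemma mons_Suc_Suc: "mons (Suc v) (Suc d) = mons v (Suc d) \<union> (+) (unit_mon v) ` mons (Suc v) d"
proof -
  have "m \<in> (+) (unit_mon v) ` mons (Suc v) d"
    if "m \<in> mons (Suc v) (Suc d)" "m \<notin> mons v (Suc d)" for m
  proof -
    have "v \<in> keys m"
      using that by (auto simp: mons_def subset_iff less_Suc_eq)
    then obtain m' where m': "m = unit_mon v + m'" by (rule remove_unit)
    then have "m' \<in> mons (Suc v) d"
      using that by (auto simp: mons_def keys_add_nat)
    then show ?thesis using m' by blast
  qed
  moreover have "mons v (Suc d) \<subseteq> mons (Suc v) (Suc d)"
    by (auto simp: mons_def)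
  moreover have "(+) (unit_mon v) ` mons (Suc v) d \<subseteq> mons (Suc v) (Suc d)"
    by (auto simp: mons_def keys_add_nat)
  ultimately show ?thesis by blast
qed

lemma finite_mons [simp]: "finite (mons v d)"
proof (induction d arbitrary: v)
  case 0
  then show ?case by (simp add: mons_0)
next
  case (Suc d)
  show ?case
    by (induction v) (simp_all add: mons_no_vars mons_Suc_Suc Suc)
qed

lemma card_mons_Suc_Suc:
  "card (mons (Suc v) (Suc d)) = card (mons v (Suc d)) + card (mons (Suc v) d)"
proof -
  have "v \<notin> keys m" if "m \<in> mons v (Suc d)" for m
    using that by (auto simp: mons_def)
  then have "mons v (Suc d) \<inter> (+) (unit_mon v) ` mons (Suc v) d = {}"
    by (fastforce simp: keys_add_nat)
  then show ?thesis
    by (simp add: mons_Suc_Suc card_Un_disjoint card_image)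
qed

lemma card_mons: "card (mons v d) = (v + d - 1) choose d"
proof (induction d arbitrary: v)
  case 0
  then show ?case by (simp add: mons_0)
next
  case (Suc d)
  show ?case
  proof (induction v)
    case 0
    then show ?case by (simp add: mons_no_vars)
  next
    case (Suc v)
    then show ?case
      by (simp add: card_mons_Suc_Suc \<open>\<And>v. card (mons v d) = _\<close>)
  qed
qed

section \<open>The lexicographic order within a degree\<close>

text \<open>The variable with index 0 is the smallest one, so that the order restricted to monomials
  in the first variables is an initial segment and the number of variables is irrelevant.\<close>

definition mless :: "(nat \<Rightarrow>\<^sub>0 nat) \<Rightarrow> (nat \<Rightarrow>\<^sub>0 nat) \<Rightarrow> bool" where
  "mless m n \<longleftrightarrow> (\<exists>j. lookup m j < lookup n j \<and> (\<forall>i>j. lookup m i = lookup n i))"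

lemma mless_irrefl [simp]: "\<not> mless m m"
  by (simp add: mless_def)

lemma mless_trans:
  assumes "mless a b" "mless b c"
  shows "mless a c"
proof -
  obtain j k where j: "lookup a j < lookup b j" "\<forall>i>j. lookup a i = lookup b i"
    and k: "lookup b k < lookup c k" "\<forall>i>k. lookup b i = lookup c i"
    using assms unfolding mless_def by blast
  show ?thesis unfolding mless_def
  proof (intro exI[of _ "max j k"] conjI allI impI)
    show "lookup a (max j k) < lookup c (max j k)"
      using j k by (cases j k rule: linorder_cases) (auto simp: max_def)
  qed (use j k in auto)
qed

lemma mless_total:
  assumes "m \<noteq> n"
  shows "mless m n \<or> mless n m"
proof -
  define S where "S = {j. lookup m j \<noteq> lookup n j}"
  have "S \<subseteq> keys m \<union> keys n"
    by (auto simp: S_def in_keys_iff)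
  then have fin: "finite S"
    by (rule finite_subset) simp
  have ne: "S \<noteq> {}"
    using assms poly_mapping_eqI[of m n] unfolding S_def by blast
  obtain k where "k \<in> S" and k: "\<And>i. i \<in> S \<Longrightarrow> i \<le> k"
    using Max_in[OF fin ne] Max_ge[OF fin] by blast
  have "lookup m k < lookup n k \<or> lookup n k < lookup m k"
    using \<open>k \<in> S\<close> unfolding S_def by (simp add: nat_neq_iff)
  moreover have "lookup m i = lookup n i" if "k < i" for i
    using k[of i] that unfolding S_def by auto
  ultimately show ?thesis
    unfolding mless_def by metis
qed

lemma mless_asym: "mless m n \<Longrightarrow> \<not> mless n m"
  using mless_trans[of m n m] by auto

lemma mless_add_iff [simp]: "mless (u + m) (u + n) \<longleftrightarrow> mless m n"
  by (simp add: mless_def lookup_add)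

lemma mless_unit: "i < j \<Longrightarrow> mless (unit_mon i) (unit_mon j)"
  unfolding mless_def by (rule exI[of _ j]) (auto simp: lookup_unit_mon)

text \<open>The variable of highest index is compared first, so a smaller monomial cannot involve a
  larger variable. Hence a monomial has only finitely many predecessors in its degree, although
  there are infinitely many variables.\<close>

lemma mless_mons:
  assumes "mless m' m" "m \<in> mons v d" "mon_deg m' = d"
  shows "m' \<in> mons v d"
proof -
  obtain j where j: "lookup m' j < lookup m j" "\<forall>i>j. lookup m' i = lookup m i"
    using assms(1) unfolding mless_def by blast
  have m0: "lookup m i = 0" if "i \<ge> v" for i
    using that assms(2) by (auto simp: mons_def in_keys_iff subset_iff)
  then have "j < v"
    using j(1) by (metis not_less_zero not_le)
  then have "lookup m' i = 0" if "i \<ge> v" for i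
    using that j(2) m0[OF that] by auto
  then have "keys m' \<subseteq> {..<v}"
    by (meson in_keys_iff lessThan_iff not_le subsetI)
  then show ?thesis
    using assms(3) by (simp add: mons_def)
qed

section \<open>Positions of monomials within their degree\<close>

definition mrank :: "(nat \<Rightarrow>\<^sub>0 nat) \<Rightarrow> nat" where
  "mrank m = card {m'. mon_deg m' = mon_deg m \<and> mless m' m}"

lemma in_some_mons: obtains v where "v \<ge> n" "m \<in> mons v (mon_deg m)"
proof -
  define v where "v = max n (Suc (Max (keys m)))"
  have "keys m \<subseteq> {..<v}"
    by (auto simp: v_def less_Suc_eq_le less_max_iff_disj)
  then show ?thesis
    using that[of v] by (simp add: mons_def v_def)
qed

lemma finite_preds [simp]: "finite {m'. mon_deg m' = mon_deg m \<and> mless m' m}"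
proof -
  obtain v where "m \<in> mons v (mon_deg m)" by (rule in_some_mons)
  then have "{m'. mon_deg m' = mon_deg m \<and> mless m' m} \<subseteq> mons v (mon_deg m)"
    using mless_mons by blast
  then show ?thesis
    by (rule finite_subset) simp
qed

lemma mrank_less_iff:
  assumes "mon_deg m = mon_deg n"
  shows "mrank m < mrank n \<longleftrightarrow> mless m n"
proof -
  have *: "mrank a < mrank b" if "mon_deg a = mon_deg b" "mless a b" for a b
    unfolding mrank_def
  proof (rule psubset_card_mono)
    have "a \<in> {m'. mon_deg m' = mon_deg b \<and> mless m' b}"
      "a \<notin> {m'. mon_deg m' = mon_deg a \<and> mless m' a}"
      using that by auto
    moreover have "{m'. mon_deg m' = mon_deg a \<and> mless m' a} \<subseteq> {m'. mon_deg m' = mon_deg b \<and> mless m' b}"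
      using that(1) mless_trans[OF _ that(2)] by auto
    ultimately show "{m'. mon_deg m' = mon_deg a \<and> mless m' a} \<subset> {m'. mon_deg m' = mon_deg b \<and> mless m' b}"
      by blast
  qed simp
  show ?thesis
  proof (cases "m = n")
    case False
    then show ?thesis
      using *[of m n] *[of n m] assms mless_total[of m n] by linarith
  qed simp
qed

lemma mrank_inj:
  assumes "mon_deg m = mon_deg n" "mrank m = mrank n"
  shows "m = n"
  using mless_total[of m n] mrank_less_iff[of m n] mrank_less_iff[of n m] assms by auto

text \<open>The monomials in v variables form an initial segment by \<open>mless_mons\<close>. An
  injective map into a finite set of the same size is onto, so no monomial has to be constructed for
  a given position.\<close>

lemma mrank_image_mons: "mrank ` mons v d = {..<card (mons v d)}"
proof (rule card_subset_eq)
  show "mrank ` mons v d \<subseteq> {..<card (mons v d)}"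
  proof clarify
    fix m assume m: "m \<in> mons v d"
    have "{m'. mon_deg m' = mon_deg m \<and> mless m' m} \<subseteq> mons v d - {m}"
      using m mless_mons[OF _ m] by (auto simp: mons_def)
    then have "{m'. mon_deg m' = mon_deg m \<and> mless m' m} \<subset> mons v d"
      using m by blast
    then show "mrank m < card (mons v d)"
      unfolding mrank_def by (rule psubset_card_mono[rotated]) simp
  qed
  have "inj_on mrank (mons v d)"
    by (rule inj_onI, rule mrank_inj) (auto simp: mons_def)
  then show "card (mrank ` mons v d) = card {..<card (mons v d)}"
    by (simp add: card_image)
qed simp

lemma mrank_less_card_mons_iff:
  assumes "mon_deg m = d"
  shows "mrank m < card (mons v d) \<longleftrightarrow> m \<in> mons v d"
proof
  assume "mrank m < card (mons v d)"
  then have "mrank m \<in> mrank ` mons v d"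
    by (simp add: mrank_image_mons)
  then obtain m' where "m' \<in> mons v d" "mrank m = mrank m'" by blast
  then show "m \<in> mons v d"
    using mrank_inj[of m m'] assms by (auto simp: mons_def)
next
  assume "m \<in> mons v d"
  then have "mrank m \<in> mrank ` mons v d" by blast
  then show "mrank m < card (mons v d)" by (simp add: mrank_image_mons)
qed

lemma card_mons_ge:
  assumes "d \<ge> 1"
  shows "v \<le> card (mons v d)"
proof -
  obtain d' where d: "d = Suc d'" using assms by (cases d) auto
  have "mons v' d' \<noteq> {}" if "v' > 0" for v'
  proof -
    have "Poly_Mapping.single 0 d' \<in> mons v' d'"
      using that by (auto simp: mons_def mon_deg_def)
    then show ?thesis by blast
  qed
  then have pos: "card (mons v' d') > 0" if "v' > 0" for v'
    using that by (simp add: card_gt_0_iff)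
  show ?thesis unfolding d
  proof (induction v)
    case (Suc v)
    then show ?case using pos[of "Suc v"] by (simp add: card_mons_Suc_Suc)
  qed simp
qed

text \<open>Further variables supply monomials of every position as long as the degree is positive;
  in degree 0 only position 0 occurs.\<close>

lemma mrank_surj:
  assumes "d \<ge> 1"
  obtains m where "mon_deg m = d" "mrank m = n"
proof -
  have "n \<in> mrank ` mons (Suc n) d"
    using card_mons_ge[OF assms, of "Suc n"] by (simp add: mrank_image_mons)
  then show ?thesis using that by (auto simp: mons_def)
qed

section \<open>Initial segments, split by divisibility by the smallest variable\<close>

definition seg :: "nat \<Rightarrow> nat \<Rightarrow> (nat \<Rightarrow>\<^sub>0 nat) set" where
  "seg d n = {m. mon_deg m = d \<and> mrank m < n}"

lemma seg_card_mons: "seg d (card (mons v d)) = mons v d"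
  using mrank_less_card_mons_iff[of _ d v] by (auto simp: seg_def) (auto simp: mons_def)

lemma card_mons_inter_seg:
  assumes "n \<le> card (mons v d)"
  shows "mons v d \<inter> seg d n = seg d n" "finite (seg d n)" "card (seg d n) = n"
proof -
  have sub: "seg d n \<subseteq> mons v d"
    using assms mrank_less_card_mons_iff[of _ d v] by (force simp: seg_def)
  then show "mons v d \<inter> seg d n = seg d n" by blast
  show fin: "finite (seg d n)" using sub finite_subset finite_mons by blast
  have "mrank ` seg d n = {..<n}"
  proof
    show "{..<n} \<subseteq> mrank ` seg d n"
    proof
      fix k assume "k \<in> {..<n}"
      then have "k \<in> mrank ` mons v d" using assms by (simp add: mrank_image_mons)
      then show "k \<in> mrank ` seg d n"
        using \<open>k \<in> {..<n}\<close> by (auto simp: seg_def mons_def)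
    qed
  qed (auto simp: seg_def)
  moreover have "inj_on mrank (seg d n)"
    by (rule inj_onI, rule mrank_inj) (auto simp: seg_def)
  ultimately show "card (seg d n) = n"
    by (metis card_image card_lessThan)
qed

lemma finite_seg [simp]: "finite (seg d n)"
proof (cases d)
  case 0
  then have "seg d n \<subseteq> {0}" by (auto simp: seg_def)
  then show ?thesis by (rule finite_subset) simp
next
  case (Suc d')
  then show ?thesis by (intro card_mons_inter_seg(2)[OF card_mons_ge]) simp
qed

lemma card_seg: "d \<ge> 1 \<Longrightarrow> card (seg d n) = n"
  by (rule card_mons_inter_seg(3)[OF card_mons_ge])

lemma seg_mono: "n \<le> n' \<Longrightarrow> seg d n \<subseteq> seg d n'"
  by (auto simp: seg_def)

lemma seg_mrank: "seg (mon_deg m) (mrank m) = {m'. mon_deg m' = mon_deg m \<and> mless m' m}"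
  using mrank_less_iff[of _ m] by (auto simp: seg_def)

lemma card_seg_mrank: "card (seg (mon_deg m) (mrank m)) = mrank m"
  unfolding seg_mrank by (simp add: mrank_def)

text \<open>In terms of the binomial expansion of n, div_count is obtained by lowering the upper and the lower
  entries by one, and free_count (Green's restriction number) by lowering the upper entries only.\<close>

definition div_count :: "nat \<Rightarrow> nat \<Rightarrow> nat" where
  "div_count d n = card {m \<in> seg d n. lookup m 0 > 0}"

definition free_count :: "nat \<Rightarrow> nat \<Rightarrow> nat" where
  "free_count d n = card {m \<in> seg d n. lookup m 0 = 0}"

lemma div_count_add_free_count:
  assumes "d \<ge> 1"
  shows "div_count d n + free_count d n = n"
proof -
  have "card (seg d n) = div_count d n + free_count d n"
    unfolding div_count_def free_count_def
    by (subst card_Un_disjoint[symmetric]) (auto intro!: arg_cong[of _ _ card])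
  then show ?thesis using card_seg[OF assms] by simp
qed

lemma div_count_mono: "n \<le> n' \<Longrightarrow> div_count d n \<le> div_count d n'"
  unfolding div_count_def by (rule card_mono) (use seg_mono[of n n' d] in auto)

lemma free_count_mono: "n \<le> n' \<Longrightarrow> free_count d n \<le> free_count d n'"
  unfolding free_count_def by (rule card_mono) (use seg_mono[of n n' d] in auto)

text \<open>Multiplying by \<open>x_0\<close> preserves the order, so below \<open>x_0 u\<close> the
  multiples of \<open>x_0\<close> are the products with the monomials below u.\<close>

lemma div_count_mrank: "div_count (Suc (mon_deg u)) (mrank (unit_mon 0 + u)) = mrank u"
proof -
  have "{m \<in> seg (Suc (mon_deg u)) (mrank (unit_mon 0 + u)). lookup m 0 > 0}
      = (+) (unit_mon 0) ` seg (mon_deg u) (mrank u)"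
  proof -
    have "m \<in> (+) (unit_mon 0) ` seg (mon_deg u) (mrank u)"
      if "mon_deg m = Suc (mon_deg u)" "mless m (unit_mon 0 + u)" and m0: "lookup m 0 > 0" for m
    proof -
      have "0 \<in> keys m" using m0 by (simp add: in_keys_iff)
      then obtain m' where m': "m = unit_mon 0 + m'" by (rule remove_unit)
      then show ?thesis using that by (auto simp: seg_mrank)
    qed
    then show ?thesis
      using seg_mrank[of "unit_mon 0 + u"] seg_mrank[of u] by (auto simp: lookup_add)
  qed
  then have "div_count (Suc (mon_deg u)) (mrank (unit_mon 0 + u)) = card (seg (mon_deg u) (mrank u))"
    unfolding div_count_def by (simp add: card_image)
  then show ?thesis by (simp only: card_seg_mrank)
qed

text \<open>The form in which \<open>div_count\<close> is used: the multiples of \<open>x_0\<close>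
  among the first n monomials are the products of \<open>x_0\<close> with an initial segment of
  degree d. By monotonicity it is enough to know the counts just before and just after
  \<open>x_0 u\<close>.\<close>

lemma div_count_gt_iff:
  assumes "mon_deg u = d"
  shows "mrank u < div_count (Suc d) n \<longleftrightarrow> mrank (unit_mon 0 + u) < n"
proof -
  let ?m = "unit_mon 0 + u"
  have eq: "div_count (Suc d) (mrank ?m) = mrank u"
    using div_count_mrank[of u] assms by simp
  have "div_count (Suc d) (Suc (mrank ?m)) = Suc (mrank u)"
  proof -
    have "seg (Suc d) (Suc (mrank ?m)) = insert ?m (seg (Suc d) (mrank ?m))"
      using assms by (auto simp: seg_def less_Suc_eq intro: mrank_inj)
    then have "{m \<in> seg (Suc d) (Suc (mrank ?m)). lookup m 0 > 0}
       = insert ?m {m \<in> seg (Suc d) (mrank ?m). lookup m 0 > 0}"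
      by (auto simp: lookup_add)
    moreover have "?m \<notin> seg (Suc d) (mrank ?m)" by (simp add: seg_def)
    ultimately show ?thesis using eq by (simp add: div_count_def)
  qed
  then show ?thesis
    using eq div_count_mono[of n "mrank ?m" "Suc d"] div_count_mono[of "Suc (mrank ?m)" n "Suc d"]
    by linarith
qed

text \<open>Each variable is renamed to the next larger one. This identifies all monomials with
  those free of \<open>x_0\<close>, compatibly with degree and order, so that
  \<open>free_count\<close> too can be computed from positions.\<close>

lift_definition shift_mon :: "(nat \<Rightarrow>\<^sub>0 nat) \<Rightarrow> (nat \<Rightarrow>\<^sub>0 nat)"
  is "\<lambda>f i. case i of 0 \<Rightarrow> 0 | Suc k \<Rightarrow> f k"
proof -
  fix f :: "nat \<Rightarrow> nat" assume "finite {x. f x \<noteq> 0}"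
  moreover have "{x. (case x of 0 \<Rightarrow> 0 | Suc k \<Rightarrow> f k) \<noteq> 0} \<subseteq> Suc ` {x. f x \<noteq> 0}"
    by (auto split: nat.splits simp: image_iff gr0_conv_Suc)
  ultimately show "finite {x. (case x of 0 \<Rightarrow> 0 | Suc k \<Rightarrow> f k) \<noteq> 0}"
    by (rule finite_surj)
qed

lemma lookup_shift_mon_0 [simp]: "lookup (shift_mon m) 0 = 0"
  by transfer simp

lemma lookup_shift_mon_Suc [simp]: "lookup (shift_mon m) (Suc i) = lookup m i"
  by transfer simp

lemma mon_deg_shift [simp]: "mon_deg (shift_mon m) = mon_deg m"
proof -
  have "keys (shift_mon m) = Suc ` keys m"
  proof (rule set_eqI)
    fix i show "i \<in> keys (shift_mon m) \<longleftrightarrow> i \<in> Suc ` keys m"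
      by (cases i) (auto simp: in_keys_iff)
  qed
  then show ?thesis
    by (simp add: mon_deg_def sum.reindex)
qed

lemma shift_mon_inj: "shift_mon m = shift_mon n \<longleftrightarrow> m = n"
proof
  assume eq: "shift_mon m = shift_mon n"
  show "m = n"
  proof (rule poly_mapping_eqI)
    fix k
    show "lookup m k = lookup n k"
      using lookup_shift_mon_Suc[of m k] lookup_shift_mon_Suc[of n k] eq by simp
  qed
qed simp

lemma unshift_mon:
  assumes "lookup m 0 = 0"
  obtains m' where "m = shift_mon m'"
proof
  have [simp]: "inj Suc" by simp
  show "m = shift_mon (Poly_Mapping.map_key Suc m)"
  proof (rule poly_mapping_eqI)
    fix k show "lookup m k = lookup (shift_mon (Poly_Mapping.map_key Suc m)) k"
      using assms by (cases k) (auto simp: map_key.rep_eq)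
  qed
qed

lemma mless_shift [simp]: "mless (shift_mon m) (shift_mon n) \<longleftrightarrow> mless m n"
proof
  assume "mless (shift_mon m) (shift_mon n)"
  then obtain j where j: "lookup (shift_mon m) j < lookup (shift_mon n) j"
    "\<forall>i>j. lookup (shift_mon m) i = lookup (shift_mon n) i"
    unfolding mless_def by blast
  then obtain k where "j = Suc k" by (cases j) auto
  then show "mless m n"
    using j unfolding mless_def by (metis Suc_less_eq lookup_shift_mon_Suc)
next
  assume "mless m n"
  then obtain j where j: "lookup m j < lookup n j" "\<forall>i>j. lookup m i = lookup n i"
    unfolding mless_def by blast
  show "mless (shift_mon m) (shift_mon n)"
    unfolding mless_def
    by (rule exI[of _ "Suc j"]) (use j in \<open>auto simp: Suc_less_eq2\<close>)
qed

lemma free_count_mrank: "free_count (mon_deg v) (mrank (shift_mon v)) = mrank v"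
proof -
  have "{m \<in> seg (mon_deg v) (mrank (shift_mon v)). lookup m 0 = 0}
      = shift_mon ` seg (mon_deg v) (mrank v)"
  proof -
    have "m \<in> shift_mon ` seg (mon_deg v) (mrank v)"
      if "mon_deg m = mon_deg v" "mless m (shift_mon v)" and m0: "lookup m 0 = 0" for m
    proof -
      obtain m' where m': "m = shift_mon m'"
        using m0 by (rule unshift_mon)
      then show ?thesis using that by (auto simp: seg_mrank)
    qed
    then show ?thesis
      using seg_mrank[of "shift_mon v"] seg_mrank[of v] by auto
  qed
  then have "free_count (mon_deg v) (mrank (shift_mon v)) = card (seg (mon_deg v) (mrank v))"
    unfolding free_count_def
    by (simp add: card_image inj_on_def shift_mon_inj)
  then show ?thesis by (simp only: card_seg_mrank)
qed

text \<open>If \<open>shift_mon v\<close> were among the first n monomials, it would add one to the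
  \<open>mrank v\<close> free monomials below it.\<close>

lemma free_count_le_imp:
  assumes "free_count (mon_deg v) n \<le> mrank v"
  shows "n \<le> mrank (shift_mon v)"
proof (rule ccontr)
  assume "\<not> n \<le> mrank (shift_mon v)"
  then have "shift_mon v \<in> {m \<in> seg (mon_deg v) n. lookup m 0 = 0}" by (simp add: seg_def)
  moreover have "{m \<in> seg (mon_deg v) (mrank (shift_mon v)). lookup m 0 = 0} 
     \<subseteq> {m \<in> seg (mon_deg v) n. lookup m 0 = 0} - {shift_mon v}"
    using \<open>\<not> n \<le> mrank (shift_mon v)\<close> by (auto simp: seg_def)
  ultimately have "{m \<in> seg (mon_deg v) (mrank (shift_mon v)). lookup m 0 = 0} 
     \<subset> {m \<in> seg (mon_deg v) n. lookup m 0 = 0}" by blast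
  then have "free_count (mon_deg v) (mrank (shift_mon v)) < free_count (mon_deg v) n"
    unfolding free_count_def by (intro psubset_card_mono) auto
  then show False using assms free_count_mrank by simp
qed


section \<open>The numerical inequality behind Green's theorem\<close>

text \<open>Passing from \<open>x_0 u\<close> to \<open>x_1 u\<close> raises, apart from
  \<open>x_0\<close>, only the exponent of \<open>x_1\<close>, and only by one. So a monomial w free
  of \<open>x_0\<close> that exceeds \<open>x_0 u\<close> either exceeds \<open>x_1 u\<close> or
  ties with it at \<open>x_1\<close> and is then equal to it.\<close>

lemma mless_unit_1:
  assumes "mless (unit_mon 0 + u) w" "lookup u 0 = 0" "lookup w 0 = 0" "mon_deg w = Suc (mon_deg u)"
  shows "\<not> mless w (unit_mon 1 + u)"
proof -
  obtain j where j: "lookup (unit_mon 0 + u) j < lookup w j"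
    "\<And>i. i > j \<Longrightarrow> lookup (unit_mon 0 + u) i = lookup w i"
    using assms(1) unfolding mless_def by blast
  have "j \<noteq> 0" using j(1) assms(3) by (metis not_less_zero)
  have up: "lookup (unit_mon 1 + u) i = lookup w i" if "i > j" for i
    using j(2)[OF that] that \<open>j \<noteq> 0\<close> by (simp add: lookup_add lookup_unit_mon)
  show ?thesis
  proof (cases "lookup (unit_mon 1 + u) j < lookup w j")
    case True
    then have "mless (unit_mon 1 + u) w"
      unfolding mless_def using up by blast
    then show ?thesis by (rule mless_asym)
  next
    case False
    then have "j = 1" "lookup (unit_mon 1 + u) j = lookup w j"
      using j(1) \<open>j \<noteq> 0\<close> by (auto simp: lookup_add lookup_unit_mon split: if_splits)
    then have eq: "lookup (unit_mon 1 + u) i = lookup w i" for i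
      using up[of i] assms(2,3) by (cases i j rule: linorder_cases) (auto simp: lookup_add lookup_unit_mon)
    have "unit_mon 1 + u = w"
      by (rule poly_mapping_eqI) (rule eq)
    then show ?thesis by simp
  qed
qed

lemma mon_deg_le_of_lookup_ge:
  assumes "\<And>i. lookup m i \<le> lookup n i"
  shows "mon_deg m \<le> mon_deg n"
proof -
  have "mon_deg m = (\<Sum>j\<in>keys m \<union> keys n. lookup m j)" "mon_deg n = (\<Sum>j\<in>keys m \<union> keys n. lookup n j)"
    by (auto intro!: mon_deg_superset)
  then show ?thesis
    using assms by (simp add: sum_mono)
qed

text \<open>If m were below u, let j be the largest index where they differ. As m has no variable
  below a, either \<open>x_j m\<close> (when j < a) or w itself (when j = a) would divide u, which
  is impossible by degree.\<close>

lemma not_mless_remove_min: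
  assumes "mless (unit_mon 0 + u) w" "mon_deg w = Suc (mon_deg u)"
    and w: "w = unit_mon a + m" and min: "\<And>i. i < a \<Longrightarrow> lookup m i = 0"
  shows "\<not> mless m u"
proof
  assume "mless m u"
  then obtain j where j: "lookup m j < lookup u j" "\<And>i. i > j \<Longrightarrow> lookup m i = lookup u i"
    unfolding mless_def by blast
  have nw: "\<not> mless w (unit_mon 0 + u)"
    using assms(1) by (rule mless_asym)
  have deg: "mon_deg m = mon_deg u" using assms(2) w by simp
  show False
  proof (cases "j < a")
    case True
    have le: "lookup (unit_mon j + m) i \<le> lookup u i" for i
      using j min True by (cases i j rule: linorder_cases) (auto simp: lookup_add lookup_unit_mon)
    have "mon_deg (unit_mon j + m) \<le> mon_deg u"
      by (rule mon_deg_le_of_lookup_ge) (rule le)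
    then show False using deg by simp
  next
    case False
    have up: "lookup w i = lookup u i" if "i > j" for i
      using j(2)[OF that] that False by (simp add: w lookup_add lookup_unit_mon)
    have up0: "lookup w i = lookup (unit_mon 0 + u) i" if "i > j" for i
      using up[OF that] that by (simp add: lookup_add lookup_unit_mon)
    have "lookup w j \<le> lookup u j"
      using j(1) by (auto simp: w lookup_add lookup_unit_mon)
    moreover have "\<not> lookup w j < lookup (unit_mon 0 + u) j"
      using nw up0 unfolding mless_def by blast
    ultimately have eq: "lookup w j = lookup u j"
      by (auto simp: lookup_add lookup_unit_mon split: if_splits)
    then have "j = a" using j(1) by (auto simp: w lookup_add lookup_unit_mon split: if_splits)
    have le: "lookup w i \<le> lookup u i" for i
      using eq up min \<open>j = a\<close>
      by (cases i j rule: linorder_cases) (auto simp: w lookup_add lookup_unit_mon)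
    have "mon_deg w \<le> mon_deg u"
      by (rule mon_deg_le_of_lookup_ge) (rule le)
    then show False using assms(2) by simp
  qed
qed

text \<open>Suppose the conclusion fails for c = x + y. Let z u be the last monomial divisible by the smallest
  variable z among the first c ones, w the first later monomial not divisible by z, and m the
  quotient of w by its smallest variable. Multiplying by the second smallest variable maps m and the
  monomials below u free of z to monomials up to w, which contradicts the hypothesis.\<close>

lemma green_inequality:
  assumes d: "d \<ge> 1" and le: "div_count (Suc d) x \<le> free_count d y"
  shows "x \<le> free_count (Suc d) (x + y)"
proof (rule ccontr)
  define c where "c = x + y"
  assume "\<not> x \<le> free_count (Suc d) (x + y)"
  then have x: "free_count (Suc d) c < x" by (simp add: c_def)
  then have y: "y < div_count (Suc d) c"
    using div_count_add_free_count[of "Suc d" c] by (simp add: c_def)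
  obtain u where u: "mon_deg u = d" "mrank u = div_count (Suc d) c - 1"
    using mrank_surj[OF d] by blast
  obtain v where v: "mon_deg v = Suc d" "mrank v = free_count (Suc d) c"
    using mrank_surj[of "Suc d"] by auto
  define w where "w = shift_mon v"
  have w: "mon_deg w = Suc d" "lookup w 0 = 0" by (auto simp: w_def v)
  have "mrank (unit_mon 0 + u) < c"
    using div_count_gt_iff[OF u(1), of c] u(2) y by linarith
  also have "c \<le> mrank w"
    using free_count_le_imp[of v c] v by (simp add: w_def)
  finally have uw: "mless (unit_mon 0 + u) w"
    using mrank_less_iff[of "unit_mon 0 + u" w] u w by simp
  define a where "a = (LEAST i. i \<in> keys w)"
  have "w \<noteq> 0" using w(1) by auto
  then have ex: "\<exists>i. i \<in> keys w" by (meson ex_in_conv keys_eq_empty)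
  have aw: "a \<in> keys w" unfolding a_def using ex by (rule LeastI_ex)
  have amin: "lookup w i = 0" if "i < a" for i
    using not_less_Least[OF that[unfolded a_def]] by (simp add: in_keys_iff)
  obtain m where m: "w = unit_mon a + m" using remove_unit[OF aw] by blast
  have "a \<noteq> 0" using aw w(2) by (metis in_keys_iff)
  have degm: "mon_deg m = d" using w(1) m by simp
  have minm: "lookup m i = 0" if "i < a" for i
    using amin[OF that] that by (simp add: m lookup_add lookup_unit_mon)
  have mu: "\<not> mless m u"
    using not_mless_remove_min[OF uw _ m minm] w u by simp
  have m0: "lookup m 0 = 0" using minm \<open>a \<noteq> 0\<close> by blast
  have m1: "\<not> mless w (unit_mon 1 + m)"
  proof (cases "a = 1")
    case False
    then have "mless (unit_mon 1) (unit_mon a)" using \<open>a \<noteq> 0\<close> by (intro mless_unit) simp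
    then have "mless (unit_mon 1 + m) w" unfolding m using mless_add_iff[of m] by (simp add: add.commute)
    then show ?thesis by (rule mless_asym)
  qed (simp add: m)
  \<comment> \<open>The element m is extra, because it is not below u. So \<open>card S\<close>
    exceeds \<open>free_count d (mrank u)\<close> with \<open>mrank u \<ge> y\<close>, while S will
    be covered by an image of the multiples of \<open>x_0\<close> up to v, of which there are at
    most \<open>div_count (Suc d) x\<close> because \<open>mrank v < x\<close>.\<close>
  define S where "S = insert m {u' \<in> seg d (mrank u). lookup u' 0 = 0}"
  have Sprop: "mon_deg s = d \<and> lookup s 0 = 0 \<and> \<not> mless w (unit_mon 1 + s)" if "s \<in> S" for s
  proof (cases "s = m")
    case False
    with that have s: "mon_deg s = d" "lookup s 0 = 0" "mless s u"
      using mrank_less_iff[of s u] u by (auto simp: S_def seg_def)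
    have "mless (unit_mon 0 + s) w"
      by (rule mless_trans[OF _ uw]) (use s in simp)
    then show ?thesis
      using mless_unit_1[of s w] s w by simp
  qed (use degm m0 m1 in auto)
  define T where "T = {v' \<in> seg (Suc d) (Suc (mrank v)). lookup v' 0 > 0}"
  have "m \<notin> seg d (mrank u)"
    using mu mrank_less_iff[of m u] degm u(1) by (simp add: seg_def)
  then have "card S = Suc (free_count d (mrank u))"
    unfolding S_def free_count_def by (subst card_insert_disjoint) auto
  \<comment> \<open>For s in S the monomial \<open>x_1 s\<close> is free of \<open>x_0\<close> and
    does not exceed w, so it is the shift of some \<open>x_0 s'\<close> that does not exceed v; s is
    recovered by cancelling \<open>x_0\<close> and shifting.\<close>
  moreover have "S \<subseteq> (\<lambda>t. shift_mon (t - unit_mon 0)) ` T"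
  proof
    fix s assume s: "s \<in> S"
    then obtain s' where s': "s = shift_mon s'"
      using Sprop unshift_mon by blast
    have shift: "shift_mon (unit_mon 0 + s') = unit_mon 1 + s"
    proof (rule poly_mapping_eqI)
      fix k show "lookup (shift_mon (unit_mon 0 + s')) k = lookup (unit_mon 1 + s) k"
        by (cases k) (auto simp: s' lookup_add lookup_unit_mon)
    qed
    have "\<not> mless v (unit_mon 0 + s')"
      using Sprop[OF s] mless_shift[of v "unit_mon 0 + s'"] shift by (simp add: w_def)
    moreover have "mon_deg s' = d" using Sprop[OF s] s' by simp
    ultimately have "unit_mon 0 + s' \<in> T"
      unfolding T_def seg_def using mrank_less_iff[of v "unit_mon 0 + s'"] v
      by (auto simp: lookup_add)
    moreover have "s = shift_mon (unit_mon 0 + s' - unit_mon 0)" by (simp add: s')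
    ultimately show "s \<in> (\<lambda>t. shift_mon (t - unit_mon 0)) ` T" by blast
  qed
  then have "card S \<le> card T"
    by (rule surj_card_le[rotated]) (simp add: T_def)
  moreover have "card T \<le> div_count (Suc d) x"
    using div_count_mono[of "Suc (mrank v)" x "Suc d"] v x by (simp add: T_def div_count_def)
  moreover have "free_count d y \<le> free_count d (mrank u)"
    using y u by (intro free_count_mono) simp
  ultimately show False using le by linarith
qed

text \<open>The first monomial free of \<open>x_0\<close> is \<open>x_1 ^ d\<close>, and it is
  preceded by the d multiples of \<open>x_0\<close> in \<open>x_0\<close> and \<open>x_1\<close>.
  This is where the threshold \<open>h t \<le> t\<close> comes from.\<close>

lemma free_count_eq_0:
  assumes "n \<le> d"
  shows "free_count d n = 0"
proof (cases "d = 0")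
  case True
  then show ?thesis using assms by (simp add: free_count_def seg_def)
next
  case False
  have "lookup m 0 > 0" if m: "m \<in> seg d n" for m
  proof (rule ccontr)
    assume "\<not> lookup m 0 > 0"
    then have m0: "lookup m 0 = 0" by simp
    have degm: "mon_deg m = d" using m by (simp add: seg_def)
    have "mons 2 d - {Poly_Mapping.single 1 d} \<subseteq> {m'. mon_deg m' = mon_deg m \<and> mless m' m}"
    proof
      fix m' assume m': "m' \<in> mons 2 d - {Poly_Mapping.single 1 d}"
      have k: "keys m' \<subseteq> {0,1}" using m' by (auto simp: mons_def)
      have d': "mon_deg m' = d" using m' by (simp add: mons_def)
      have two: "lookup m' i = 0" if "i > 1" for i
        using k that by (auto simp: in_keys_iff)
      have sum: "lookup m' 0 + lookup m' 1 = d"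
        using d' mon_deg_superset[of "{0,1}" m'] k by simp
      have "lookup m' 0 \<noteq> 0"
      proof
        assume z: "lookup m' 0 = 0"
        have e: "lookup m' i = lookup (Poly_Mapping.single 1 d) i" for i
          using two[of i] z sum by (cases i "1::nat" rule: linorder_cases) (auto simp: lookup_single when_def)
        have "m' = Poly_Mapping.single 1 d"
          by (rule poly_mapping_eqI) (rule e)
        then show False using m' by simp
      qed
      then have less: "lookup m' 1 < d" using sum by simp
      have "mless m' m"
      proof (cases "keys m \<subseteq> {1}")
        case True
        then have "lookup m 1 = d" "\<And>i. i > 1 \<Longrightarrow> lookup m i = 0"
          using mon_deg_superset[of "{1}" m] degm by (auto simp: in_keys_iff)
        then show ?thesis unfolding mless_def
          by (intro exI[of _ 1]) (use less two in auto)
      next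
        case False
        show ?thesis
        proof (rule ccontr)
          assume "\<not> mless m' m"
          then have "m = m' \<or> mless m m'" using mless_total by blast
          then have "m \<in> mons 2 d" using mless_mons[of m m' 2 d] m' degm by auto
          then have "keys m \<subseteq> {0,1}" by (auto simp: mons_def)
          then show False using False m0 by (auto simp: in_keys_iff)
        qed
      qed
      then show "m' \<in> {m'. mon_deg m' = mon_deg m \<and> mless m' m}" using degm d' by simp
    qed
    then have "card (mons 2 d - {Poly_Mapping.single 1 d}) \<le> mrank m"
      unfolding mrank_def by (rule card_mono[rotated]) simp
    moreover have "card (mons 2 d) \<le> Suc (card (mons 2 d - {Poly_Mapping.single 1 d}))"
      by (metis card_Suc_Diff1 finite_mons insert_Diff_single card_insert_le_m1 card_Diff_singleton_if diff_Suc_1 le_SucI le_refl Suc_pred card_gt_0_iff empty_iff)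
    moreover have "card (mons 2 d) = Suc d" by (simp add: card_mons)
    ultimately have "d \<le> mrank m" by linarith
    then show False using m assms by (simp add: seg_def)
  qed
  then have "{m \<in> seg d n. lookup m 0 = 0} = {}" by fastforce
  then show ?thesis by (simp add: free_count_def)
qed

lemma free_count_pos:
  assumes "d < n" "d \<ge> 1"
  shows "free_count d n > 0"
proof -
  have "Poly_Mapping.single 1 d \<in> mons 2 d" by (auto simp: mons_def mon_deg_def)
  then have "mrank (Poly_Mapping.single 1 d) < card (mons 2 d)"
    using mrank_less_card_mons_iff[of "Poly_Mapping.single 1 d" d 2] by (simp add: mons_def)
  then have "mrank (Poly_Mapping.single 1 d) < n"
    using assms by (simp add: card_mons)
  then have "Poly_Mapping.single 1 d \<in> {m \<in> seg d n. lookup m 0 = 0}"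
    using \<open>Poly_Mapping.single 1 d \<in> mons 2 d\<close> by (simp add: seg_def mons_def lookup_single when_def)
  then show ?thesis unfolding free_count_def by (subst card_gt_0_iff) auto
qed

section \<open>Binomial expansions\<close>

text \<open>All monomials in the smaller variables come first, then the multiples of
  \<open>x_v\<close> in the order of their quotients. The size of the first block is the leading
  term of a binomial expansion.\<close>

lemma mrank_unit_add:
  assumes "mon_deg m = d" "m \<in> mons (Suc v) d"
  shows "mrank (unit_mon v + m) = card (mons v (Suc d)) + mrank m"
proof -
  have "{m'. mon_deg m' = Suc d \<and> mless m' (unit_mon v + m)}
      = mons v (Suc d) \<union> (+) (unit_mon v) ` {m'. mon_deg m' = d \<and> mless m' m}" (is "?L = ?R")
  proof
    show "?L \<subseteq> ?R"
    proof
      fix x assume x: "x \<in> ?L"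
      have "unit_mon v + m \<in> mons (Suc v) (Suc d)" using assms by (simp add: mons_Suc_Suc)
      then have "x \<in> mons (Suc v) (Suc d)" using x mless_mons by blast
      then show "x \<in> ?R"
      proof (cases "x \<in> mons v (Suc d)")
        case False
        then obtain m' where "x = unit_mon v + m'" "m' \<in> mons (Suc v) d"
          using \<open>x \<in> mons (Suc v) (Suc d)\<close> by (auto simp: mons_Suc_Suc)
        then show ?thesis using x by (auto simp: mons_def)
      qed simp
    qed
    have "mless x (unit_mon v + m)" if x: "x \<in> mons v (Suc d)" for x
    proof (rule ccontr)
      assume "\<not> mless x (unit_mon v + m)"
      then have "unit_mon v + m = x \<or> mless (unit_mon v + m) x" using mless_total by metis
      then have "unit_mon v + m \<in> mons v (Suc d)"
        using mless_mons[OF _ x, of "unit_mon v + m"] assms x by auto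
      then show False by (auto simp: mons_def keys_add_nat)
    qed
    then show "?R \<subseteq> ?L" by (auto simp: mons_def)
  qed
  moreover have "mons v (Suc d) \<inter> (+) (unit_mon v) ` {m'. mon_deg m' = d \<and> mless m' m} = {}"
    by (auto simp: mons_def keys_add_nat)
  moreover have "finite {m'. mon_deg m' = d \<and> mless m' m}" using finite_preds[of m] assms by simp
  ultimately show ?thesis
    using assms by (simp add: mrank_def card_Un_disjoint card_image)
qed

lemma div_count_card_mons: "v \<ge> 1 \<Longrightarrow> div_count (Suc d) (card (mons v (Suc d))) = card (mons v d)"
proof -
  assume "v \<ge> 1"
  have "{m \<in> mons v (Suc d). lookup m 0 > 0} = (+) (unit_mon 0) ` mons v d"
  proof
    show "{m \<in> mons v (Suc d). lookup m 0 > 0} \<subseteq> (+) (unit_mon 0) ` mons v d"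
    proof
      fix m assume m: "m \<in> {m \<in> mons v (Suc d). lookup m 0 > 0}"
      then have "0 \<in> keys m" by (simp add: in_keys_iff)
      then obtain m' where "m = unit_mon 0 + m'" by (rule remove_unit)
      then show "m \<in> (+) (unit_mon 0) ` mons v d" using m by (auto simp: mons_def keys_add_nat)
    qed
    show "(+) (unit_mon 0) ` mons v d \<subseteq> {m \<in> mons v (Suc d). lookup m 0 > 0}"
      using \<open>v \<ge> 1\<close> by (auto simp: mons_def keys_add_nat lookup_add)
  qed
  then show ?thesis by (simp add: div_count_def seg_card_mons card_image)
qed

text \<open>The segment consists of all monomials in v variables and of a segment of degree d
  multiplied by \<open>x_v\<close>. Since v is positive, this factor is not \<open>x_0\<close> and
  leaves divisibility by \<open>x_0\<close> unchanged.\<close>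

lemma div_count_rec:
  assumes "v \<ge> 1" "n \<le> card (mons (Suc v) d)"
  shows "div_count (Suc d) (card (mons v (Suc d)) + n) = card (mons v d) + div_count d n"
proof -
  let ?c = "card (mons v (Suc d))"
  have "seg (Suc d) (?c + n) = mons v (Suc d) \<union> (+) (unit_mon v) ` seg d n" (is "?L = ?R")
  proof
    show "?L \<subseteq> ?R"
    proof
      fix x assume x: "x \<in> ?L"
      then have dx: "mon_deg x = Suc d" and rx: "mrank x < ?c + n" by (auto simp: seg_def)
      then have "x \<in> mons (Suc v) (Suc d)"
        using assms(2) mrank_less_card_mons_iff[OF dx, of "Suc v"] by (simp add: card_mons_Suc_Suc)
      then show "x \<in> ?R"
      proof (cases "x \<in> mons v (Suc d)")
        case False
        then obtain m where m: "m \<in> mons (Suc v) d" "x = unit_mon v + m"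
          using \<open>x \<in> mons (Suc v) (Suc d)\<close> by (auto simp: mons_Suc_Suc)
        then have "mrank m < n" using rx mrank_unit_add[of m d v] by (simp add: mons_def)
        then show ?thesis using m by (auto simp: seg_def mons_def)
      qed simp
    qed
    have "x \<in> ?L" if x: "x \<in> mons v (Suc d)" for x
    proof -
      have "mon_deg x = Suc d" using x by (simp add: mons_def)
      then show ?thesis
        using x mrank_less_card_mons_iff[of x "Suc d" v] by (simp add: seg_def)
    qed
    moreover have "unit_mon v + m \<in> ?L" if m: "m \<in> seg d n" for m
    proof -
      have "mon_deg m = d" "mrank m < n" using m by (auto simp: seg_def)
      then have "m \<in> mons (Suc v) d"
        using mrank_less_card_mons_iff[of m d "Suc v"] assms(2) by simp
      then show ?thesis
        using mrank_unit_add[of m d v] \<open>mon_deg m = d\<close> \<open>mrank m < n\<close> by (simp add: seg_def)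
    qed
    ultimately show "?R \<subseteq> ?L" by blast
  qed
  then have "{m \<in> ?L. lookup m 0 > 0}
    = {m \<in> mons v (Suc d). lookup m 0 > 0} \<union> (+) (unit_mon v) ` {m \<in> seg d n. lookup m 0 > 0}"
    using assms(1) by (auto simp: lookup_add lookup_unit_mon)
  moreover have "{m \<in> mons v (Suc d). lookup m 0 > 0} \<inter> (+) (unit_mon v) ` {m \<in> seg d n. lookup m 0 > 0} = {}"
    by (auto simp: mons_def keys_add_nat)
  ultimately have "div_count (Suc d) (?c + n) = card {m \<in> mons v (Suc d). lookup m 0 > 0} + div_count d n"
    by (simp add: div_count_def card_Un_disjoint card_image)
  then show ?thesis
    using div_count_card_mons[OF assms(1), of d] by (simp add: div_count_def seg_card_mons)
qed

text \<open>Translation by \<open>a = v + d\<close>: the coefficient \<open>a choose Suc d\<close>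
  counts the monomials of degree \<open>Suc d\<close> in \<open>a - d\<close> variables.\<close>

lemma div_count_choose_rec:
  assumes "a \<ge> Suc d" "n \<le> a choose d"
  shows "div_count (Suc d) ((a choose Suc d) + n) = ((a - 1) choose d) + div_count d n"
  using div_count_rec[of "a - d" n d] assms by (simp add: card_mons)

definition expansion :: "nat \<Rightarrow> nat list \<Rightarrow> bool" where
  "expansion d ns \<longleftrightarrow> ns \<noteq> [] \<and> length ns \<le> d \<and> sorted_wrt (>) ns \<and> last ns \<ge> d + 1 - length ns"

definition expansion_value :: "nat \<Rightarrow> nat list \<Rightarrow> nat" where
  "expansion_value d ns = (\<Sum>k<length ns. (ns ! k) choose (d - k))"

lemma expansion_value_Cons: "expansion_value (Suc d) (a # ns) = (a choose Suc d) + expansion_value d ns"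
  by (simp add: expansion_value_def sum.lessThan_Suc_shift del: sum.lessThan_Suc binomial_Suc_Suc)

lemma expansion_singleton: "expansion (Suc d) [a] \<longleftrightarrow> a \<ge> Suc d"
  by (auto simp: expansion_def)

lemma expansion_Cons_Cons: "expansion (Suc d) (a # b # ns) \<longleftrightarrow> a > b \<and> expansion d (b # ns)"
  by (auto simp: expansion_def) 

text \<open>A tail below \<open>a choose d\<close> keeps the whole value below
  \<open>Suc a choose Suc d\<close> by Pascal's rule, so the value determines its leading entry. The
  same bound lets \<open>div_count_choose_rec\<close> peel off that entry.\<close>

lemma expansion_bounds:
  assumes "expansion (Suc d) (a # ns)"
  shows "a \<ge> Suc d" "expansion_value d ns < a choose d"
  using assms
proof (induction ns arbitrary: d a)
  case Nil
  {
    case 1 then show ?case by (simp add: expansion_singleton)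
  next
    case 2 then show ?case by (simp add: expansion_singleton expansion_value_def)
  }
next
  case (Cons b ns)
  {
    case 1
    then have "a > b" "expansion d (b # ns)" by (auto simp: expansion_Cons_Cons)
    moreover then obtain d' where "d = Suc d'" by (cases d) (auto simp: expansion_def)
    ultimately show ?case using Cons.IH(1)[of d' b] by simp
  next
    case 2
    then have ab: "a > b" and e: "expansion d (b # ns)" by (auto simp: expansion_Cons_Cons)
    then obtain d' where d': "d = Suc d'" by (cases d) (auto simp: expansion_def)
    have "expansion_value d (b # ns) < (b choose Suc d') + (b choose d')"
      using Cons.IH(2)[of d' b] e by (simp add: d' expansion_value_Cons del: binomial_Suc_Suc)
    also have "\<dots> = Suc b choose d" by (simp add: d')
    also have "\<dots> \<le> a choose d" using ab by (intro binomial_right_mono) simp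
    finally show ?case .
  }
qed

lemma expansion_value_pos:
  assumes "expansion d ns"
  shows "expansion_value d ns > 0"
proof -
  obtain a ns' d' where "ns = a # ns'" "d = Suc d'"
    using assms by (cases ns; cases d) (auto simp: expansion_def)
  then show ?thesis
    using expansion_bounds(1)[of d' a ns'] assms by (simp add: expansion_value_Cons del: binomial_Suc_Suc)
qed

lemma expansion_unique:
  assumes "expansion d ns" "expansion d ms" "expansion_value d ns = expansion_value d ms"
  shows "ns = ms"
  using assms
proof (induction ns arbitrary: d ms)
  case Nil
  then show ?case by (simp add: expansion_def)
next
  case (Cons a ns)
  obtain d' where d: "d = Suc d'" using Cons.prems(1) by (cases d) (auto simp: expansion_def)
  obtain b ms' where ms: "ms = b # ms'" using Cons.prems(2) by (cases ms) (auto simp: expansion_def)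
  have bound: "y \<le> x" 
    if "expansion d (x # xs)" "expansion d (y # ys)" "expansion_value d (x # xs) = expansion_value d (y # ys)" for x y xs ys
  proof (rule ccontr)
    assume "\<not> y \<le> x"
    have "expansion_value d (x # xs) < (x choose Suc d') + (x choose d')"
      using expansion_bounds(2)[of d' x xs] that(1) by (simp add: d expansion_value_Cons del: binomial_Suc_Suc)
    also have "\<dots> = Suc x choose Suc d'" by simp
    also have "\<dots> \<le> y choose Suc d'" using \<open>\<not> y \<le> x\<close> by (intro binomial_right_mono) simp
    also have "\<dots> \<le> expansion_value d (y # ys)" by (simp add: d expansion_value_Cons del: binomial_Suc_Suc)
    finally show False using that(3) by simp
  qed
  have "a = b"
    using bound[of a ns b ms'] bound[of b ms' a ns] Cons.prems ms by simp
  then have val: "expansion_value d' ns = expansion_value d' ms'"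
    using Cons.prems(3) by (simp add: d ms expansion_value_Cons del: binomial_Suc_Suc)
  show ?case
  proof (cases ns)
    case Nil
    then have "expansion_value d' ms' = 0" using val by (simp add: expansion_value_def)
    then have "\<not> expansion d' ms'" using expansion_value_pos[of d' ms'] by auto
    then have "ms' = []" using Cons.prems(2) ms d by (cases ms') (auto simp: expansion_Cons_Cons)
    then show ?thesis using Nil ms \<open>a = b\<close> by simp
  next
    case (Cons x xs)
    then have e: "expansion d' ns" using Cons.prems(1) d by (simp add: expansion_Cons_Cons)
    then have "expansion_value d' ms' > 0" using expansion_value_pos val by metis
    then have "ms' \<noteq> []" by (auto simp: expansion_value_def)
    then have "expansion d' ms'" using Cons.prems(2) ms d by (cases ms') (auto simp: expansion_Cons_Cons)
    then show ?thesis using Cons.IH[of d' ms'] e val ms \<open>a = b\<close> by simp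
  qed
qed

text \<open>Greedy choice of the leading entry a. Its maximality keeps the remainder below
  \<open>a choose d\<close>, which forces the next entry below a; the bound \<open>n + d\<close>
  guarantees that a greatest entry exists.\<close>

lemma expansion_exists:
  assumes "d \<ge> 1" "n \<ge> 1"
  obtains ns where "expansion d ns" "expansion_value d ns = n"
proof -
  have "\<exists>ns. expansion d ns \<and> expansion_value d ns = n"
    using assms
  proof (induction d arbitrary: n)
    case (Suc d)
    define a where "a = (GREATEST a. a choose Suc d \<le> n)"
    have bnd: "a \<le> n + d" if "a choose Suc d \<le> n" for a
    proof (rule ccontr)
      assume "\<not> a \<le> n + d"
      then have "Suc (n + d) choose Suc d \<le> a choose Suc d" by (intro binomial_right_mono) simp
      moreover have "n + 1 \<le> Suc (n + d) choose Suc d"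
        using card_mons_ge[of "Suc d" "n + 1"] by (simp add: card_mons del: binomial_Suc_Suc)
      ultimately show False using that by simp
    qed
    have "Suc d choose Suc d \<le> n" using Suc.prems by simp
    then have a: "a choose Suc d \<le> n" "Suc d \<le> a"
      unfolding a_def by (rule GreatestI_nat[where b = "n + d"], use bnd in blast)
        (rule Greatest_le_nat[where b = "n + d"], use bnd \<open>Suc d choose Suc d \<le> n\<close> in auto)
    have "\<not> Suc a choose Suc d \<le> n"
      using Greatest_le_nat[of "\<lambda>a. a choose Suc d \<le> n" "Suc a" "n + d"] bnd unfolding a_def by auto
    then have lt: "n - (a choose Suc d) < a choose d"
      using a(1) by (simp only: binomial_Suc_Suc)
    show ?case
    proof (cases "n = a choose Suc d")
      case True
      then have "expansion (Suc d) [a] \<and> expansion_value (Suc d) [a] = n"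
        using a by (simp add: expansion_singleton expansion_value_def)
      then show ?thesis by blast
    next
      case False
      then have pos: "n - (a choose Suc d) \<ge> 1" using a(1) by simp
      moreover have "d \<ge> 1" using lt pos by (cases d) auto
      ultimately obtain ns where ns: "expansion d ns" "expansion_value d ns = n - (a choose Suc d)"
        using Suc.IH by blast
      then obtain b ms d' where b: "ns = b # ms" "d = Suc d'"
        by (cases ns; cases d) (auto simp: expansion_def)
      have "b < a"
      proof (rule ccontr)
        assume "\<not> b < a"
        then have "a choose d \<le> b choose d" by (intro binomial_right_mono) simp
        also have "\<dots> \<le> expansion_value d ns" by (simp add: b expansion_value_Cons del: binomial_Suc_Suc)
        finally show False using ns lt by simp
      qed
      then have "expansion (Suc d) (a # ns)" using ns b by (simp add: expansion_Cons_Cons)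
      moreover have "expansion_value (Suc d) (a # ns) = n"
        using ns a by (simp add: expansion_value_Cons del: binomial_Suc_Suc)
      ultimately show ?thesis by blast
    qed
  qed simp
  then show ?thesis using that by blast
qed

lemma div_count_expansion:
  assumes "expansion d ns"
  shows "div_count d (expansion_value d ns) = (\<Sum>k<length ns. (ns ! k - 1) choose (d - k - 1))"
  using assms
proof (induction ns arbitrary: d)
  case Nil
  then show ?case by (simp add: expansion_def)
next
  case (Cons a ns)
  obtain d' where d: "d = Suc d'" using Cons.prems by (cases d) (auto simp: expansion_def)
  have a: "a \<ge> Suc d'" "expansion_value d' ns \<le> a choose d'"
    using expansion_bounds[of d' a ns] Cons.prems by (auto simp: d)
  have "div_count d (expansion_value d (a # ns)) = ((a - 1) choose d') + div_count d' (expansion_value d' ns)"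
    using div_count_choose_rec[OF a] by (simp add: d expansion_value_Cons del: binomial_Suc_Suc)
  also have "div_count d' (expansion_value d' ns) = (\<Sum>k<length ns. (ns ! k - 1) choose (d' - k - 1))"
  proof (cases ns)
    case Nil
    then show ?thesis by (simp add: expansion_value_def div_count_def seg_def)
  next
    case (Cons b ms)
    then show ?thesis using Cons.IH[of d'] Cons.prems by (simp add: d expansion_Cons_Cons)
  qed
  finally show ?case
    by (simp add: d sum.lessThan_Suc_shift del: sum.lessThan_Suc binomial_Suc_Suc)
qed

text \<open>Zero has no expansion, and the description operator is then unspecified; hence the lower
  bound on n.\<close>

lemma binom_down_eq_div_count:
  assumes "d \<ge> 1" "n \<ge> 1"
  shows "binom_down d n = div_count d n"
proof -
  obtain ns where ns: "expansion d ns" "expansion_value d ns = n"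
    using expansion_exists[OF assms] by blast
  have "binom_expansion d n = ns"
    unfolding binom_expansion_def
  proof (rule the_equality)
    show "ns \<noteq> [] \<and> length ns \<le> d \<and> sorted_wrt (>) ns \<and> last ns \<ge> d + 1 - length ns \<and>
      n = (\<Sum>k<length ns. (ns ! k) choose (d - k))"
      using ns by (simp add: expansion_def expansion_value_def)
  next
    fix ms
    assume "ms \<noteq> [] \<and> length ms \<le> d \<and> sorted_wrt (>) ms \<and> last ms \<ge> d + 1 - length ms \<and>
      n = (\<Sum>k<length ms. (ms ! k) choose (d - k))"
    then have "expansion d ms" "expansion_value d ms = n"
      by (auto simp: expansion_def expansion_value_def)
    then show "ms = ns" using expansion_unique[of d ms ns] ns by simp
  qed
  then show ?thesis
    using div_count_expansion[OF ns(1)] ns(2) by (simp add: binom_down_def Let_def)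
qed

section \<open>Finite-dimensional subspaces\<close>

text \<open>The ambient polynomial rings are infinite-dimensional, so finiteness is a property of
  single sets. It keeps \<open>dim\<close> away from the value 0 that an infinite basis would give.
  The same facts serve multivariate and univariate polynomials.\<close>

locale fd_subspaces = vector_space
begin

definition fin_dim :: "'b set \<Rightarrow> bool" where
  "fin_dim S \<longleftrightarrow> (\<exists>B. finite B \<and> S \<subseteq> span B)"

lemma fin_dim_subset: "fin_dim T \<Longrightarrow> S \<subseteq> span T \<Longrightarrow> fin_dim S"
  unfolding fin_dim_def by (meson order_trans span_minimal subspace_span)

lemma fin_dim_Un: "fin_dim S \<Longrightarrow> fin_dim T \<Longrightarrow> fin_dim (S \<union> T)"
  unfolding fin_dim_def
  by (metis (no_types, lifting) Un_mono Un_subset_iff finite_UnI order_trans span_mono sup_ge1 sup_ge2)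

lemma fin_dim_basis:
  assumes "fin_dim S"
  obtains B where "finite B" "B \<subseteq> S" "independent B" "span B = span S" "card B = dim S"
proof -
  obtain B where B: "B \<subseteq> S" "independent B" "S \<subseteq> span B" "card B = dim S"
    by (rule basis_exists)
  have "finite B"
    using assms B independent_span_bound unfolding fin_dim_def by (meson order_trans)
  moreover have "span B = span S"
    using B span_base by (auto simp: span_eq)
  ultimately show ?thesis using that B by blast
qed

lemma dim_mono_fin:
  assumes "fin_dim T" "S \<subseteq> span T"
  shows "dim S \<le> dim T"
proof -
  obtain B where "finite B" "B \<subseteq> T" "independent B" "span B = span T" "card B = dim T"
    by (rule fin_dim_basis[OF assms(1)])
  then show ?thesis using dim_le_card[of S B] assms(2) by simp
qed

lemma dim_insert_fin:
  assumes "fin_dim S"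
  shows "dim (insert x S) = (if x \<in> span S then dim S else Suc (dim S))"
proof (cases "x \<in> span S")
  case True
  then show ?thesis by (metis dim_span span_redundant)
next
  case False
  obtain B where B: "finite B" "B \<subseteq> S" "independent B" "span B = span S" "card B = dim S"
    by (rule fin_dim_basis[OF assms])
  have "independent (insert x B)" using False B by (simp add: independent_insertI)
  moreover have "span (insert x B) = span (insert x S)"
    using B(4) by (auto simp: span_breakdown_eq)
  ultimately have "dim (insert x S) = card (insert x B)" by (rule dim_eq_card[rotated])
  moreover have "x \<notin> B" using False B span_base by blast
  ultimately show ?thesis using B False by simp
qed

lemma span_eq_of_dim_le:
  assumes "fin_dim T" "S \<subseteq> span T" "dim T \<le> dim S"
  shows "span S = span T"
proof -
  have fS: "fin_dim S" using assms fin_dim_subset by blast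
  have "T \<subseteq> span S"
  proof
    fix x assume x: "x \<in> T"
    show "x \<in> span S"
    proof (rule ccontr)
      assume "x \<notin> span S"
      then have "dim (insert x S) = Suc (dim S)" using dim_insert_fin[OF fS] by simp
      moreover have "dim (insert x S) \<le> dim T"
        using assms x by (intro dim_mono_fin) (auto intro: span_base)
      ultimately show False using assms(3) by simp
    qed
  qed
  then show ?thesis using assms(2) by (simp add: span_eq)
qed

lemma independent_card_le_dim_fin:
  assumes "fin_dim T" "B \<subseteq> span T" "independent B"
  shows "finite B" "card B \<le> dim T"
proof -
  show "card B \<le> dim T"
    using dim_mono_fin[OF assms(1,2)] dim_eq_card_independent[OF assms(3)] by simp
  show "finite B"
    using assms independent_span_bound unfolding fin_dim_def by (meson order_trans span_minimal subspace_span)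
qed

text \<open>Add the basis vectors b one at a time. Either \<open>T b\<close> is new modulo W and the
  image, and the left dimension grows, or \<open>T b = w + T x\<close> and the vector
  \<open>z = b - x\<close> enlarges the preimage of W.\<close>

lemma dim_Un_image_aux:
  assumes lin: "Vector_Spaces.linear scale scale T" and W: "subspace W" "fin_dim W"
  shows "finite B \<Longrightarrow> independent B \<Longrightarrow>
    dim (W \<union> T ` B) + dim {x \<in> span B. T x \<in> W} = dim W + card B"
proof (induction B rule: finite_induct)
  case empty
  interpret T: Vector_Spaces.linear scale scale T by fact
  have "{x \<in> span {}. T x \<in> W} = {0}"
    using subspace_0[OF W(1)] by auto
  then show ?case using dim_span[of "{}"] dim_eq_card_independent[OF independent_empty] by simp
next
  case (insert b B)
  interpret T: Vector_Spaces.linear scale scale T by fact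
  have ind: "independent B" "b \<notin> span B"
    using insert.prems insert.hyps by (auto simp: independent_insert)
  let ?U = "span (W \<union> T ` B)"
  let ?K = "{x \<in> span B. T x \<in> W}" and ?K' = "{x \<in> span (insert b B). T x \<in> W}"
  have subK: "subspace ?K"
    by (rule subspaceI) (use W(1) in \<open>auto simp: T.zero T.add T.scale span_zero span_add span_scale
      subspace_0 subspace_add subspace_scale\<close>)
  have subK': "subspace ?K'"
    by (rule subspaceI) (use W(1) in \<open>auto simp: T.zero T.add T.scale span_zero span_add span_scale
      subspace_0 subspace_add subspace_scale\<close>)
  have fK: "fin_dim ?K" unfolding fin_dim_def using insert.hyps(1) by blast
  have TB: "T ` span B \<subseteq> ?U" 
    using span_mono[of "T ` B" "W \<union> T ` B"] by (simp add: T.span_image)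
  have fU: "fin_dim (W \<union> T ` B)"
    using W(2) insert.hyps(1) by (intro fin_dim_Un) (auto simp: fin_dim_def intro!: exI[of _ "T ` B"] span_base)
  have dU: "dim (W \<union> T ` insert b B) = (if T b \<in> ?U then dim (W \<union> T ` B) else Suc (dim (W \<union> T ` B)))"
    using dim_insert_fin[OF fU, of "T b"] by simp
  show ?case
  proof (cases "T b \<in> ?U")
    case True
    then obtain w x where wx: "w \<in> W" "x \<in> span B" "T b = w + T x"
      using W(1) by (auto simp: span_Un T.span_image span_eq_iff[THEN iffD2, OF W(1)])
    define z where "z = b - x"
    have Tz: "T z = w" using wx by (simp add: z_def T.diff)
    have z: "z \<notin> span B" 
      using ind(2) wx(2) span_add[of z B x] by (auto simp: z_def)
    have "span ?K' = span (insert z ?K)"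
      unfolding span_eq
    proof
      show "?K' \<subseteq> span (insert z ?K)"
      proof
        fix y assume y: "y \<in> ?K'"
        then obtain k where k: "y - scale k b \<in> span B" by (auto simp: span_breakdown_eq)
        have "y - scale k z = (y - scale k b) + scale k x" by (simp add: z_def scale_right_diff_distrib)
        then have "y - scale k z \<in> span B" using k wx(2) by (metis span_add span_scale)
        moreover have "T (y - scale k z) \<in> W"
          using y wx(1) W(1) by (simp add: T.diff T.scale Tz subspace_diff subspace_scale)
        ultimately show "y \<in> span (insert z ?K)"
          by (auto simp: span_breakdown_eq intro!: exI[of _ k] span_base)
      qed
      have "span B \<subseteq> span (insert b B)" by (rule span_mono) blast
      moreover have "z \<in> span (insert b B)"
        using wx(2) calculation unfolding z_def by (intro span_diff) (auto intro: span_base)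
      ultimately have "insert z ?K \<subseteq> ?K'" using Tz wx(1) by auto
      then show "insert z ?K \<subseteq> span ?K'" using span_superset by blast
    qed
    then have "dim ?K' = dim (insert z ?K)" by (rule span_eq_dim)
    moreover have "z \<notin> span ?K" using z subK by (simp add: span_eq_iff[THEN iffD2, OF subK])
    ultimately have "dim ?K' = Suc (dim ?K)" using dim_insert_fin[OF fK, of z] by simp
    then show ?thesis using insert ind dU True by simp
  next
    case False
    have "?K' = ?K"
    proof
      show "?K' \<subseteq> ?K"
      proof
        fix y assume y: "y \<in> ?K'"
        then obtain k where k: "y - scale k b \<in> span B" by (auto simp: span_breakdown_eq)
        have "T (y - scale k b) \<in> ?U" using k TB by blast
        moreover have "T y \<in> ?U" using y by (auto intro: span_base)
        ultimately have "T y - T (y - scale k b) \<in> ?U" by (rule span_diff[rotated])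
        then have "scale k (T b) \<in> ?U" by (simp add: T.diff T.scale)
        then have "k = 0" using False span_scale[of "scale k (T b)" _ "inverse k"] by (cases "k = 0") auto
        then show "y \<in> ?K" using k y by simp
      qed
      have "span B \<subseteq> span (insert b B)" by (rule span_mono) blast
      then show "?K \<subseteq> ?K'" by blast
    qed
    then show ?thesis using insert ind dU False by simp
  qed
qed

text \<open>Rank-nullity for the map that T induces from X to the quotient by W.\<close>

lemma dim_Un_image:
  assumes lin: "Vector_Spaces.linear scale scale T" and W: "subspace W" "fin_dim W" and X: "subspace X" "fin_dim X"
  shows "dim (W \<union> T ` X) + dim {x \<in> X. T x \<in> W} = dim W + dim X"
proof -
  interpret T: Vector_Spaces.linear scale scale T by fact
  obtain B where B: "finite B" "B \<subseteq> X" "independent B" "span B = span X" "card B = dim X"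
    by (rule fin_dim_basis[OF X(2)])
  have BX: "span B = X" using B(4) span_eq_iff[THEN iffD2, OF X(1)] by simp
  have "span (W \<union> T ` B) = span (W \<union> T ` X)"
    by (simp add: span_Un T.span_image BX span_eq_iff[THEN iffD2, OF X(1)])
  then have "dim (W \<union> T ` B) = dim (W \<union> T ` X)" by (rule span_eq_dim)
  then show ?thesis using dim_Un_image_aux[OF lin W B(1,3)] B(5) BX by simp
qed

lemma dim_Un_Int:
  assumes U: "subspace U" "fin_dim U" and V: "subspace V" "fin_dim V"
  shows "dim (U \<union> V) + dim (U \<inter> V) = dim U + dim V"
proof -
  have "{x \<in> V. x \<in> U} = U \<inter> V" by blast
  then show ?thesis
    using dim_Un_image[OF linear_ident U V] by simp
qed

text \<open>Reduces membership in a subspace to scalars, so that families of polynomials depending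
  on t can be studied as ordinary univariate polynomials.\<close>

lemma separating_functional:
  assumes P: "subspace P" and v: "v \<notin> P"
  obtains \<phi> where "Vector_Spaces.linear scale (*) \<phi>" "\<And>x. x \<in> P \<Longrightarrow> \<phi> x = 0" "\<phi> v = 1"
proof -
  interpret p: vector_space_pair scale "(*) :: 'a \<Rightarrow> 'a \<Rightarrow> 'a"
    by unfold_locales (auto simp: algebra_simps)
  obtain B where B: "B \<subseteq> P" "independent B" "P \<subseteq> span B"
    by (rule maximal_independent_subset)
  have "span B = P" using B P by (metis span_minimal span_eq_iff subset_antisym)
  then have ind: "independent (insert v B)" using v B by (simp add: independent_insertI)
  obtain g where g: "Vector_Spaces.linear scale (*) g" "\<forall>x\<in>insert v B. g x = (if x = v then 1 else 0)"
    using p.linear_independent_extend[OF ind, of "\<lambda>x. if x = v then 1 else 0"] by blast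
  interpret g: Vector_Spaces.linear scale "(*)" g by fact
  have "g x = 0" if "x \<in> P" for x
  proof -
    have "x \<in> span B" using that B by blast
    then show ?thesis
      by (induction rule: span_induct_alt) (use g(2) v B in \<open>auto simp: g.zero g.add g.scale\<close>)
  qed
  then show ?thesis using that g by auto
qed

end

section \<open>Graded pieces of the polynomial ring\<close>

lemma lookup_single_times:
  fixes p :: "'k::comm_semiring_1 mpoly"
  shows "lookup (Poly_Mapping.single t c * p) (t + u) = c * lookup p u"
    and "\<nexists>u. m = t + u \<Longrightarrow> lookup (Poly_Mapping.single t c * p) m = 0"
proof -
  have p: "p = (\<Sum>m\<in>keys p. Poly_Mapping.single m (lookup p m))"
  proof (rule poly_mapping_eqI)
    fix k show "lookup p k = lookup (\<Sum>m\<in>keys p. Poly_Mapping.single m (lookup p m)) k"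
      by (cases "k \<in> keys p") (auto simp: lookup_sum lookup_single when_def in_keys_iff)
  qed
  have eq: "Poly_Mapping.single t c * p = (\<Sum>m\<in>keys p. Poly_Mapping.single (t + m) (c * lookup p m))"
    by (subst p) (simp add: sum_distrib_left mult_single)
  show "lookup (Poly_Mapping.single t c * p) (t + u) = c * lookup p u"
    unfolding eq by (cases "u \<in> keys p") (auto simp: lookup_sum lookup_single when_def in_keys_iff)
  show "lookup (Poly_Mapping.single t c * p) m = 0" if "\<nexists>u. m = t + u"
    unfolding eq using that by (auto simp: lookup_sum lookup_single when_def intro!: sum.neutral)
qed

lemma lookup_const_times [simp]: "lookup (const c * p) m = c * lookup p m"
  using lookup_single_times(1)[of 0 c p m] by (simp add: const_def)

lemma lookup_kscale [simp]: "lookup (kscale c p) m = c * lookup p m"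
  by (simp add: kscale_def)

lemma const_add: "const (a + b) = const a + const b"
  by (simp add: const_def single_add)

lemma const_mult: "const (a * b) = const a * const b"
  by (simp add: const_def mult_single)

lemma const_1 [simp]: "const 1 = 1"
  by (simp add: const_def)

lemma const_0 [simp]: "const 0 = 0"
  by (simp add: const_def)

interpretation mp: fd_subspaces "kscale :: 'k::field \<Rightarrow> 'k mpoly \<Rightarrow> 'k mpoly"
  by unfold_locales (auto simp: kscale_def const_add const_mult algebra_simps)

lemma linear_times: "Vector_Spaces.linear kscale kscale ((*) (F :: 'k::field mpoly))"
  by unfold_locales (auto simp: kscale_def algebra_simps)

text \<open>One notion for the graded pieces, the polynomial ring and the lexicographic ideals, all
  of which are spanned by monomials.\<close>

definition supp_in :: "(nat \<Rightarrow>\<^sub>0 nat) set \<Rightarrow> 'k::field mpoly set" where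
  "supp_in S = {p. keys p \<subseteq> S}"

lemma subspace_supp_in: "mp.subspace (supp_in S :: 'k::field mpoly set)"
proof (rule mp.subspaceI)
  fix x y :: "'k mpoly" assume "x \<in> supp_in S" "y \<in> supp_in S"
  then show "x + y \<in> supp_in S" using Poly_Mapping.keys_add[of x y] by (auto simp: supp_in_def)
next
  fix x :: "'k mpoly" and c assume "x \<in> supp_in S"
  then show "kscale c x \<in> supp_in S" by (auto simp: supp_in_def in_keys_iff)
qed (simp add: supp_in_def)

lemma mpoly_sum_monomials: "p = (\<Sum>m\<in>keys p. kscale (lookup p m) (Poly_Mapping.single m 1))"
proof (rule poly_mapping_eqI)
  fix k show "lookup p k = lookup (\<Sum>m\<in>keys p. kscale (lookup p m) (Poly_Mapping.single m 1)) k"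
    by (cases "k \<in> keys p") (auto simp: lookup_sum lookup_single when_def in_keys_iff if_distrib cong: if_cong)
qed

lemma supp_in_span:
  fixes p :: "'k::field mpoly"
  assumes "p \<in> supp_in S"
  shows "p \<in> mp.span ((\<lambda>m. Poly_Mapping.single m 1) ` S)"
proof -
  have "(\<Sum>m\<in>keys p. kscale (lookup p m) (Poly_Mapping.single m 1)) \<in> mp.span ((\<lambda>m. Poly_Mapping.single m 1) ` S)"
    by (intro mp.span_sum mp.span_scale mp.span_base) (use assms in \<open>auto simp: supp_in_def\<close>)
  then show ?thesis using mpoly_sum_monomials[of p] by simp
qed

lemma supp_in_induct:
  fixes p :: "'k::field mpoly"
  assumes "p \<in> supp_in S" "mp.subspace P" "\<And>m. m \<in> S \<Longrightarrow> Poly_Mapping.single m 1 \<in> P"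
  shows "p \<in> P"
proof -
  have "mp.span ((\<lambda>m. Poly_Mapping.single m 1) ` S) \<subseteq> P"
    using assms by (intro mp.span_minimal) auto
  then show ?thesis using supp_in_span[OF assms(1)] by blast
qed

lemma fin_dim_supp_in [simp]: "finite S \<Longrightarrow> mp.fin_dim (supp_in S :: 'k::field mpoly set)"
  unfolding mp.fin_dim_def using supp_in_span by (metis finite_imageI subsetI)

lemma dim_supp_in:
  assumes "finite S"
  shows "mp.dim (supp_in S :: 'k::field mpoly set) = card S"
proof -
  let ?s = "\<lambda>m. Poly_Mapping.single m 1 :: 'k mpoly"
  have inj: "inj_on ?s S" by (rule inj_onI) (metis keys_single singleton_inject zero_neq_one)
  have "mp.independent (?s ` S)"
  proof (rule mp.independent_if_scalars_zero)
    fix f x assume s: "(\<Sum>x\<in>?s ` S. kscale (f x) x) = 0" and x: "x \<in> ?s ` S"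
    obtain m where m: "m \<in> S" "x = ?s m" using x by blast
    have "0 = lookup (\<Sum>x\<in>?s ` S. kscale (f x) x) m" by (simp add: s)
    also have "\<dots> = (\<Sum>m'\<in>S. f (?s m') * (if m' = m then 1 else 0))"
      by (simp add: sum.reindex[OF inj] lookup_sum lookup_single when_def)
    also have "\<dots> = f x" using m assms by (simp add: if_distrib cong: if_cong)
    finally show "f x = 0" by simp
  qed (use assms in simp)
  then have "mp.dim (supp_in S :: 'k mpoly set) = card (?s ` S)"
    by (rule mp.dim_unique[rotated 2, OF _ refl]) (use supp_in_span in \<open>auto simp: supp_in_def\<close>)
  then show ?thesis using inj by (simp add: card_image)
qed

lemma homog_eq_supp_in: "homog r d = (supp_in (mons r d) :: 'k::field mpoly set)"
  by (auto simp: homog_def polyring_def supp_in_def mons_def)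

lemma subspace_homog [simp]: "mp.subspace (homog r d :: 'k::field mpoly set)"
  by (simp add: homog_eq_supp_in subspace_supp_in)

lemma fin_dim_homog [simp]: "mp.fin_dim (homog r d :: 'k::field mpoly set)"
  by (simp add: homog_eq_supp_in)

lemma dim_homog: "mp.dim (homog r d :: 'k::field mpoly set) = card (mons r d)"
  by (simp add: homog_eq_supp_in dim_supp_in)

lemma span_homog [simp]: "mp.span (homog r d :: 'k::field mpoly set) = homog r d"
  by (simp add: mp.span_eq_iff)

lemma fin_dim_sub_homog: "W \<subseteq> homog r d \<Longrightarrow> mp.fin_dim (W :: 'k::field mpoly set)"
  using mp.fin_dim_subset[OF fin_dim_homog, of W r d] by simp

lemma homog_times:
  assumes "p \<in> homog r a" "q \<in> homog r b"
  shows "p * q \<in> (homog r (a + b) :: 'k::field mpoly set)"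
  using assms keys_mult[of p q] by (fastforce simp: homog_eq_supp_in supp_in_def mons_def keys_add_nat)

lemma one_homog [simp]: "1 \<in> (homog r 0 :: 'k::field mpoly set)"
  by (simp add: homog_eq_supp_in supp_in_def mons_def)

lemma homog_power: "p \<in> homog r a \<Longrightarrow> p ^ n \<in> (homog r (n * a) :: 'k::field mpoly set)"
  by (induction n) (auto intro: homog_times)

lemma linform_homog [simp]: "linform r c \<in> (homog r 1 :: 'k::field mpoly set)"
proof -
  have "const (c j) * var j \<in> (homog r 1 :: 'k mpoly set)" if "j < r" for j
    using that by (auto simp: var_def const_def mult_single homog_eq_supp_in supp_in_def mons_def)
  then show ?thesis unfolding linform_def
    by (intro mp.subspace_sum) auto
qed

lemma linform_power_homog [simp]: "linform r c ^ n \<in> (homog r n :: 'k::field mpoly set)"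
  using homog_power[OF linform_homog, of r c n] by simp

lemma linform_power_times_homog [simp]:
  "f \<in> homog r i \<Longrightarrow> linform r c ^ d * f \<in> (homog r (i + d) :: 'k::field mpoly set)"
  using homog_times[OF linform_power_homog, of f r i c d] by (simp add: add.commute)

lemma linform_unit: "j < r \<Longrightarrow> linform r (\<lambda>i. if i = j then 1 else 0) = (var j :: 'k::field mpoly)"
  by (simp add: linform_def if_distrib[of const] if_distrib[of "\<lambda>x. x * _"] cong: if_cong)

lemma homog_Suc_induct:
  fixes p :: "'k::field mpoly"
  assumes "p \<in> homog r (Suc d)" "mp.subspace P"
    and "\<And>j f. j < r \<Longrightarrow> f \<in> homog r d \<Longrightarrow> var j * f \<in> P"
  shows "p \<in> P"
proof (rule supp_in_induct)
  show "p \<in> supp_in (mons r (Suc d))" using assms by (simp add: homog_eq_supp_in)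
  fix m assume m: "m \<in> mons r (Suc d)"
  then obtain j where j: "j \<in> keys m" by (auto simp: mons_def) (metis ex_in_conv keys_eq_empty mon_deg_zero nat.distinct(1))
  obtain m' where m': "m = unit_mon j + m'" using remove_unit[OF j] by blast
  have "j < r" using m j by (auto simp: mons_def)
  moreover have "Poly_Mapping.single m' 1 \<in> (homog r d :: 'k mpoly set)"
    using m m' by (auto simp: homog_eq_supp_in supp_in_def mons_def keys_add_nat)
  ultimately have "var j * Poly_Mapping.single m' 1 \<in> P" using assms(3) by blast
  then show "Poly_Mapping.single m 1 \<in> P" by (simp add: var_def mult_single m')
qed (use assms in simp)

lemma dim_homog_image:
  assumes "W \<subseteq> homog r d" "mp.subspace W" "X \<subseteq> homog r i" "mp.subspace X"
  shows "mp.dim (W \<union> (*) F ` X) + mp.dim {f \<in> X. F * f \<in> W} = mp.dim W + mp.dim (X :: 'k::field mpoly set)"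
  using mp.dim_Un_image[OF linear_times] assms fin_dim_sub_homog by blast

section \<open>Semicontinuity of rank\<close>

text \<open>The nonvanishing locus of a member of F plays the role of an open set. The instances are
  the polynomial functions of the coefficients of a linear form and the polynomial functions of the
  parameter of a line.\<close>

locale function_ring =
  fixes F :: "('x \<Rightarrow> 'k::field) set"
  assumes const_in: "(\<lambda>x. a) \<in> F"
    and diff_in: "f \<in> F \<Longrightarrow> g \<in> F \<Longrightarrow> (\<lambda>x. f x - g x) \<in> F"
    and mult_in: "f \<in> F \<Longrightarrow> g \<in> F \<Longrightarrow> (\<lambda>x. f x * g x) \<in> F"
begin

lemma add_in: "f \<in> F \<Longrightarrow> g \<in> F \<Longrightarrow> (\<lambda>x. f x + g x) \<in> F"
  using diff_in[of f "\<lambda>x. 0 - g x"] diff_in[OF const_in[of 0], of g] by simp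

lemma sum_in: "(\<And>i. i \<in> I \<Longrightarrow> f i \<in> F) \<Longrightarrow> (\<lambda>x. \<Sum>i\<in>I. f i x) \<in> F"
  by (induction I rule: infinite_finite_induct) (auto simp: const_in add_in)

text \<open>Gaussian elimination over the ring F: the pivots are invertible where f does not vanish.\<close>

lemma independence_open:
  fixes v :: "'j \<Rightarrow> 'x \<Rightarrow> 'k mpoly"
  assumes "finite J" "\<And>j m. j \<in> J \<Longrightarrow> (\<lambda>x. lookup (v j x) m) \<in> F"
    and "\<And>a. (\<Sum>j\<in>J. kscale (a j) (v j x0)) = 0 \<Longrightarrow> \<forall>j\<in>J. a j = 0"
  shows "\<exists>f\<in>F. f x0 \<noteq> 0 \<and> (\<forall>x. f x \<noteq> 0 \<longrightarrow>
      (\<forall>a. (\<Sum>j\<in>J. kscale (a j) (v j x)) = 0 \<longrightarrow> (\<forall>j\<in>J. a j = 0)))"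
  using assms
proof (induction J arbitrary: v rule: finite_induct)
  case empty
  then show ?case using const_in[of 1] by (intro bexI[of _ "\<lambda>x. 1"]) auto
next
  case (insert i J)
  have "v i x0 \<noteq> 0"
  proof
    assume "v i x0 = 0"
    then have "(\<Sum>j\<in>insert i J. kscale (if j = i then 1 else 0) (v j x0)) = 0"
      by (intro sum.neutral) auto
    from insert.prems(2)[OF this] show False by simp
  qed
  then obtain m where m: "lookup (v i x0) m \<noteq> 0" by (metis poly_mapping_eqI lookup_zero)
  define p where "p x = lookup (v i x) m" for x
  \<comment> \<open>Elimination by cross-multiplication: the coordinate of \<open>w j\<close> at m
    is zero, and as nothing is divided the coordinates stay in F.\<close>
  define w where "w j x = kscale (p x) (v j x) - kscale (lookup (v j x) m) (v i x)" for j x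
  have wsum: "(\<Sum>j\<in>J. kscale (a j) (w j x)) =
     (\<Sum>j\<in>J. kscale (a j * p x) (v j x)) - kscale (\<Sum>j\<in>J. a j * lookup (v j x) m) (v i x)" for a x
    by (simp add: w_def mp.scale_right_diff_distrib sum_subtractf mp.scale_sum_left)
  have pF: "p \<in> F" using insert.prems(1)[of i m] by (simp add: p_def[abs_def])
  have "\<exists>f\<in>F. f x0 \<noteq> 0 \<and> (\<forall>x. f x \<noteq> 0 \<longrightarrow>
      (\<forall>a. (\<Sum>j\<in>J. kscale (a j) (w j x)) = 0 \<longrightarrow> (\<forall>j\<in>J. a j = 0)))"
  proof (rule insert.IH)
    fix j m' assume "j \<in> J"
    then show "(\<lambda>x. lookup (w j x) m') \<in> F"
      using insert.prems(1) pF by (auto simp: w_def lookup_minus intro!: diff_in mult_in)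
  next
    fix a assume "(\<Sum>j\<in>J. kscale (a j) (w j x0)) = 0"
    then have e: "(\<Sum>j\<in>J. kscale (a j * p x0) (v j x0)) - kscale (\<Sum>j\<in>J. a j * lookup (v j x0) m) (v i x0) = 0"
      by (simp add: wsum)
    define b where "b j = (if j = i then - (\<Sum>j\<in>J. a j * lookup (v j x0) m) else a j * p x0)" for j
    have "(\<Sum>j\<in>J. kscale (b j) (v j x0)) = (\<Sum>j\<in>J. kscale (a j * p x0) (v j x0))"
      using insert.hyps by (intro sum.cong) (auto simp: b_def)
    then have "(\<Sum>j\<in>insert i J. kscale (b j) (v j x0)) = 0"
      using insert.hyps e by (simp add: b_def mp.scale_minus_left)
    then have b0: "\<forall>j\<in>insert i J. b j = 0" by (rule insert.prems(2))
    show "\<forall>j\<in>J. a j = 0"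
    proof
      fix j assume j: "j \<in> J"
      then have "j \<noteq> i" using insert.hyps by auto
      then have "a j * p x0 = 0" using b0 j by (auto simp: b_def)
      then show "a j = 0" using m by (simp add: p_def)
    qed
  qed
  then obtain f where f: "f \<in> F" "f x0 \<noteq> 0"
    and fx: "\<And>x a. f x \<noteq> 0 \<Longrightarrow> (\<Sum>j\<in>J. kscale (a j) (w j x)) = 0 \<Longrightarrow> \<forall>j\<in>J. a j = 0"
    by blast
  show ?case
  proof (intro bexI[of _ "\<lambda>x. p x * f x"] conjI allI impI)
    show "(\<lambda>x. p x * f x) \<in> F" using pF f by (intro mult_in)
    show "p x0 * f x0 \<noteq> 0" using f m by (simp add: p_def)
    fix x a assume nz: "p x * f x \<noteq> 0" and s: "(\<Sum>j\<in>insert i J. kscale (a j) (v j x)) = 0"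
    have s': "kscale (a i) (v i x) + (\<Sum>j\<in>J. kscale (a j) (v j x)) = 0"
      using s insert.hyps by simp
    have "a i * p x + (\<Sum>j\<in>J. a j * lookup (v j x) m) = lookup (kscale (a i) (v i x) + (\<Sum>j\<in>J. kscale (a j) (v j x))) m"
      by (simp add: lookup_add lookup_sum p_def)
    then have c: "(\<Sum>j\<in>J. a j * lookup (v j x) m) = - (a i * p x)"
      using s' by (simp add: eq_neg_iff_add_eq_0 add.commute)
    have "(\<Sum>j\<in>J. kscale (a j) (w j x)) = kscale (p x) (kscale (a i) (v i x) + (\<Sum>j\<in>J. kscale (a j) (v j x)))"
      unfolding wsum c
      by (simp add: mp.scale_right_distrib mp.scale_sum_right mp.scale_minus_left mult.commute)
    then have "(\<Sum>j\<in>J. kscale (a j) (w j x)) = 0" by (simp add: s')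
    then have aJ: "\<forall>j\<in>J. a j = 0" using fx nz by auto
    then have "a i * p x = 0" using c by simp
    then show "\<forall>j\<in>insert i J. a j = 0" using aJ nz by auto
  qed
qed

text \<open>A basis at x0 lifts to members of V, and these stay independent on an open set. V is a
  set of families rather than a family of sets, so that a vector can be followed as x moves.\<close>

lemma dim_ge_open:
  fixes V :: "('x \<Rightarrow> 'k mpoly) set"
  assumes coord: "\<And>v m. v \<in> V \<Longrightarrow> (\<lambda>x. lookup (v x) m) \<in> F"
    and fin: "\<And>x. mp.fin_dim ((\<lambda>v. v x) ` V)"
  shows "\<exists>f\<in>F. f x0 \<noteq> 0 \<and> (\<forall>x. f x \<noteq> 0 \<longrightarrow> mp.dim ((\<lambda>v. v x0) ` V) \<le> mp.dim ((\<lambda>v. v x) ` V))"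
proof -
  obtain B where B: "finite B" "B \<subseteq> (\<lambda>v. v x0) ` V" "mp.independent B"
    "mp.span B = mp.span ((\<lambda>v. v x0) ` V)" "card B = mp.dim ((\<lambda>v. v x0) ` V)"
    by (rule mp.fin_dim_basis[OF fin])
  define s where "s b = (SOME v. v \<in> V \<and> v x0 = b)" for b
  have s: "s b \<in> V" "s b x0 = b" if "b \<in> B" for b
    using someI_ex[of "\<lambda>v. v \<in> V \<and> v x0 = b"] that B(2) unfolding s_def by blast+
  have ind0: "\<forall>b\<in>B. a b = 0" if "(\<Sum>b\<in>B. kscale (a b) (s b x0)) = 0" for a
  proof -
    have "(\<Sum>b\<in>B. kscale (a b) b) = 0" using that s by (simp cong: sum.cong)
    then show ?thesis using B(1,3) mp.dependent_finite by blast
  qed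
  obtain f where f: "f \<in> F" "f x0 \<noteq> 0"
    and fx: "\<And>x a. f x \<noteq> 0 \<Longrightarrow> (\<Sum>b\<in>B. kscale (a b) (s b x)) = 0 \<Longrightarrow> \<forall>b\<in>B. a b = 0"
    using independence_open[OF B(1), of s x0] coord s(1) ind0 by blast
  have "card B \<le> mp.dim ((\<lambda>v. v x) ` V)" if nz: "f x \<noteq> 0" for x
  proof -
    have inj: "inj_on (\<lambda>b. s b x) B"
    proof (rule inj_onI, rule ccontr)
      fix b b' assume b: "b \<in> B" "b' \<in> B" "s b x = s b' x" "b \<noteq> b'"
      define a where "a c = (if c = b then 1 else if c = b' then - 1 else (0::'k))" for c
      have "(\<Sum>c\<in>B. kscale (a c) (s c x)) = (\<Sum>c\<in>{b, b'}. kscale (a c) (s c x))"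
        using B(1) b by (intro sum.mono_neutral_right) (auto simp: a_def)
      also have "\<dots> = 0" using b by (simp add: a_def mp.scale_minus_left)
      finally have "\<forall>c\<in>B. a c = 0" using fx[OF nz] by blast
      then show False using b(1) by (auto simp: a_def)
    qed
    have "mp.independent ((\<lambda>b. s b x) ` B)"
    proof (rule mp.independent_if_scalars_zero)
      fix g y assume "(\<Sum>y\<in>(\<lambda>b. s b x) ` B. kscale (g y) y) = 0" and y: "y \<in> (\<lambda>b. s b x) ` B"
      then have "(\<Sum>b\<in>B. kscale (g (s b x)) (s b x)) = 0" by (simp add: sum.reindex[OF inj])
      from fx[OF nz this] show "g y = 0" using y by auto
    qed (use B in simp)
    moreover have "(\<lambda>b. s b x) ` B \<subseteq> mp.span ((\<lambda>v. v x) ` V)"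
      using s(1) by (auto intro: mp.span_base)
    ultimately have "card ((\<lambda>b. s b x) ` B) \<le> mp.dim ((\<lambda>v. v x) ` V)"
      using mp.independent_card_le_dim_fin(2)[OF fin] by blast
    then show ?thesis using inj by (simp add: card_image)
  qed
  then show ?thesis using f B(5) by auto
qed

lemma linform_times_coord:
  assumes c: "\<And>j. j < r \<Longrightarrow> (\<lambda>x. c x j) \<in> F" and p: "\<And>m. (\<lambda>x. lookup (p x) m) \<in> F"
  shows "(\<lambda>x. lookup (linform r (c x) * p x) m) \<in> F"
proof -
  have "(\<lambda>x. lookup (const (c x j) * (var j * p x)) m) \<in> F" if "j < r" for j
  proof (cases "\<exists>u. m = unit_mon j + u")
    case True
    then obtain u where u: "m = unit_mon j + u" by blast
    have "lookup (var j * p x) m = lookup (p x) u" for x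
      using lookup_single_times(1)[of "unit_mon j" 1 "p x" u] by (simp add: u var_def)
    then show ?thesis using c[OF that] p by (simp add: mult_in)
  next
    case False
    have "lookup (var j * p x) m = 0" for x
      using lookup_single_times(2)[OF False, of 1 "p x"] by (simp add: var_def)
    then show ?thesis using const_in[of 0] by simp
  qed
  then have "(\<lambda>x. \<Sum>j<r. lookup (const (c x j) * (var j * p x)) m) \<in> F"
    by (intro sum_in) simp
  then show ?thesis
    by (simp add: linform_def sum_distrib_right lookup_sum mult.assoc)
qed

lemma linform_power_times_coord:
  assumes c: "\<And>j. j < r \<Longrightarrow> (\<lambda>x. c x j) \<in> F" and p: "\<And>m. (\<lambda>x. lookup (p x) m) \<in> F"
  shows "(\<lambda>x. lookup (linform r (c x) ^ n * p x) m) \<in> F"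
proof (induction n arbitrary: m)
  case (Suc n)
  then show ?case
    using linform_times_coord[where p = "\<lambda>x. linform r (c x) ^ n * p x", OF c] by (simp add: mult.assoc)
qed (use p in simp)

end

section \<open>General linear forms\<close>

context function_ring
begin

lemma power_in: "f \<in> F \<Longrightarrow> (\<lambda>x. f x ^ n) \<in> F"
  by (induction n) (auto simp: const_in mult_in)

lemma prod_in: "(\<And>i. i \<in> I \<Longrightarrow> f i \<in> F) \<Longrightarrow> (\<lambda>x. \<Prod>i\<in>I. f i x) \<in> F"
  by (induction I rule: infinite_finite_induct) (auto simp: const_in mult_in)

lemma eval_in: "(\<And>j. (\<lambda>x. c x j) \<in> F) \<Longrightarrow> (\<lambda>x. eval p (c x)) \<in> F"
  unfolding eval_def by (intro sum_in mult_in const_in prod_in power_in)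

end

section \<open>Evaluation of polynomials at coefficient vectors\<close>

definition mon_eval :: "(nat \<Rightarrow> 'k::comm_semiring_1) \<Rightarrow> (nat \<Rightarrow>\<^sub>0 nat) \<Rightarrow> 'k" where
  "mon_eval c m = (\<Prod>j\<in>keys m. c j ^ lookup m j)"

lemma mon_eval_superset:
  assumes "finite A" "keys m \<subseteq> A"
  shows "mon_eval c m = (\<Prod>j\<in>A. c j ^ lookup m j)"
  unfolding mon_eval_def
  by (rule prod.mono_neutral_left) (use assms in \<open>auto simp: in_keys_iff\<close>)

lemma mon_eval_add: "mon_eval c (m + n) = mon_eval c m * mon_eval c n"
  using mon_eval_superset[of "keys m \<union> keys n" "m + n" c] mon_eval_superset[of "keys m \<union> keys n" m c]
    mon_eval_superset[of "keys m \<union> keys n" n c]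
  by (simp add: keys_add_nat lookup_add power_add prod.distrib)

lemma eval_superset:
  assumes "finite A" "keys p \<subseteq> A"
  shows "eval p c = (\<Sum>m\<in>A. lookup p m * mon_eval c m)"
  unfolding eval_def mon_eval_def
  by (rule sum.mono_neutral_left) (use assms in \<open>auto simp: in_keys_iff\<close>)

lemma eval_add: "eval (p + q) c = eval p c + eval q c"
  using eval_superset[of "keys p \<union> keys q" "p + q" c] eval_superset[of "keys p \<union> keys q" p c]
    eval_superset[of "keys p \<union> keys q" q c] Poly_Mapping.keys_add[of p q]
  by (simp add: lookup_add algebra_simps sum.distrib)

lemma eval_kscale: "eval (kscale a p) c = a * eval p c"
proof -
  have "keys (kscale a p) \<subseteq> keys p" by (auto simp: in_keys_iff)
  then show ?thesis
    using eval_superset[of "keys p" "kscale a p" c] eval_superset[of "keys p" p c]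
    by (simp add: sum_distrib_left mult.assoc)
qed

lemma eval_zero [simp]: "eval 0 c = 0"
  by (simp add: eval_def)

lemma eval_single: "eval (Poly_Mapping.single m a) c = a * mon_eval c m"
  using eval_superset[of "{m}" "Poly_Mapping.single m a" c] by simp

lemma eval_mult: "eval (p * q) c = eval p c * eval (q :: 'k::field mpoly) c"
proof -
  have 1: "eval (Poly_Mapping.single m 1 * q) c = mon_eval c m * eval q c" for m and q :: "'k mpoly"
  proof -
    have "q \<in> {q. eval (Poly_Mapping.single m 1 * q) c = mon_eval c m * eval q c}"
    proof (rule supp_in_induct[of q UNIV])
      show "mp.subspace {q. eval (Poly_Mapping.single m 1 * q) c = mon_eval c m * eval q c}"
      proof (rule mp.subspaceI)
        fix a x assume x: "x \<in> {q. eval (Poly_Mapping.single m 1 * q) c = mon_eval c m * eval q c}"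
        have "Poly_Mapping.single m 1 * kscale a x = kscale a (Poly_Mapping.single m 1 * x)"
          by (simp add: kscale_def mult.left_commute)
        then show "kscale a x \<in> {q. eval (Poly_Mapping.single m 1 * q) c = mon_eval c m * eval q c}"
          using x by (simp add: eval_kscale)
      qed (auto simp: distrib_left eval_add)
    qed (auto simp: mult_single eval_single mon_eval_add supp_in_def)
    then show ?thesis by simp
  qed
  have "p \<in> {p. eval (p * q) c = eval p c * eval q c}"
  proof (rule supp_in_induct[of p UNIV])
    show "mp.subspace {p. eval (p * q) c = eval p c * eval q c}"
    proof (rule mp.subspaceI)
      fix a x assume x: "x \<in> {p. eval (p * q) c = eval p c * eval q c}"
      have "kscale a x * q = kscale a (x * q)" by (simp add: kscale_def mult.assoc)
      then show "kscale a x \<in> {p. eval (p * q) c = eval p c * eval q c}"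
        using x by (simp add: eval_kscale mult.assoc)
    qed (auto simp: distrib_right eval_add)
  qed (auto simp: 1 eval_single supp_in_def)
  then show ?thesis by simp
qed

lemma polyring_eq_supp_in: "polyring r = (supp_in {m. keys m \<subseteq> {..<r}} :: 'k::field mpoly set)"
  by (auto simp: polyring_def supp_in_def)

lemma polyring_times: "p \<in> polyring r \<Longrightarrow> q \<in> polyring r \<Longrightarrow> p * q \<in> (polyring r :: 'k::field mpoly set)"
  using keys_mult[of p q] by (fastforce simp: polyring_def keys_add_nat)

lemma homog_polyring: "p \<in> homog r d \<Longrightarrow> p \<in> polyring r"
  by (simp add: homog_def)

interpretation eval_ring: function_ring "eval ` (polyring r :: 'k::field mpoly set)" for r
proof
  fix a :: 'k
  have "eval (const a) = (\<lambda>x. a)" by (simp add: fun_eq_iff const_def eval_single mon_eval_def)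
  moreover have "const a \<in> polyring r" by (simp add: polyring_def const_def)
  ultimately show "(\<lambda>x. a) \<in> eval ` polyring r" by (metis imageI)
next
  fix f g :: "(nat \<Rightarrow> 'k) \<Rightarrow> 'k" assume "f \<in> eval ` polyring r" "g \<in> eval ` polyring r"
  then obtain p q where pq: "p \<in> polyring r" "f = eval p" "q \<in> polyring r" "g = eval q" by blast
  have "eval (p - q) x + eval q x = eval p x" for x by (simp flip: eval_add)
  then have "eval (p - q) = (\<lambda>x. f x - g x)" by (auto simp: fun_eq_iff pq algebra_simps)
  moreover have "p - q \<in> polyring r"
    using pq mp.subspace_diff[OF subspace_supp_in] by (simp add: polyring_eq_supp_in)
  ultimately show "(\<lambda>x. f x - g x) \<in> eval ` polyring r" by (metis imageI)
  have "eval (p * q) = (\<lambda>x. f x * g x)" by (simp add: fun_eq_iff pq eval_mult)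
  moreover have "p * q \<in> polyring r" using pq by (simp add: polyring_times)
  ultimately show "(\<lambda>x. f x * g x) \<in> eval ` polyring r" by (metis imageI)
qed

lemma coord_in_eval_ring: "j < r \<Longrightarrow> (\<lambda>c. c j) \<in> eval ` (polyring r :: 'k::field mpoly set)"
proof -
  assume "j < r"
  have "eval (var j) = (\<lambda>c :: nat \<Rightarrow> 'k. c j)"
    by (simp add: fun_eq_iff var_def eval_single mon_eval_def)
  moreover have "var j \<in> (polyring r :: 'k mpoly set)" using \<open>j < r\<close> by (simp add: polyring_def var_def)
  ultimately show ?thesis by (metis imageI)
qed

interpretation poly_ring: function_ring "range (poly :: 'k::field poly \<Rightarrow> 'k \<Rightarrow> 'k)"
proof
  fix a :: 'k
  show "(\<lambda>x. a) \<in> range poly" by (rule range_eqI[of _ _ "[:a:]"]) (simp add: fun_eq_iff)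
next
  fix f g :: "'k \<Rightarrow> 'k" assume "f \<in> range poly" "g \<in> range poly"
  then obtain p q where pq: "f = poly p" "g = poly q" by blast
  show "(\<lambda>x. f x - g x) \<in> range poly" by (rule range_eqI[of _ _ "p - q"]) (simp add: fun_eq_iff pq)
  show "(\<lambda>x. f x * g x) \<in> range poly" by (rule range_eqI[of _ _ "p * q"]) (simp add: fun_eq_iff pq)
qed

definition line :: "(nat \<Rightarrow> 'k::field) \<Rightarrow> (nat \<Rightarrow> 'k) \<Rightarrow> 'k \<Rightarrow> nat \<Rightarrow> 'k" where
  "line a b t j = a j + t * (b j - a j)"

lemma line_0 [simp]: "line a b 0 = a" and line_1 [simp]: "line a b 1 = b"
  by (auto simp: line_def fun_eq_iff)

lemma line_coord: "(\<lambda>t. line a b t j) \<in> range poly"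
  by (rule range_eqI[of _ _ "[:a j, b j - a j:]"]) (simp add: fun_eq_iff line_def)

text \<open>Stands in for the irreducibility of affine space: on a line nonzero polynomial functions
  have finitely many zeros, and a field of characteristic zero is infinite.\<close>

lemma poly_functions_common_nonzero:
  fixes f g :: "'k::field_char_0 \<Rightarrow> 'k"
  assumes "f \<in> range poly" "f x \<noteq> 0" "g \<in> range poly" "g y \<noteq> 0"
  obtains t where "f t \<noteq> 0" "g t \<noteq> 0"
proof -
  obtain p q where pq: "f = poly p" "g = poly q" using assms by blast
  have "p \<noteq> 0" "q \<noteq> 0" using assms pq by auto
  then have "finite {t. poly (p * q) t = 0}" by (intro poly_roots_finite) simp
  then have "{t. poly (p * q) t = 0} \<noteq> UNIV" using infinite_UNIV_char_0[where 'a = 'k] by metis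
  then show ?thesis using that pq by auto
qed

section \<open>Calculus of general linear forms\<close>

lemma general_linformI:
  assumes "f \<in> eval ` polyring r" "f c \<noteq> 0" "\<And>c. f c \<noteq> 0 \<Longrightarrow> P (linform r c)"
  shows "general_linform r P"
proof -
  obtain p where "p \<in> polyring r" "f = eval p" using assms by blast
  then show ?thesis unfolding general_linform_def using assms by (intro exI[of _ "{p}"]) auto
qed

lemma general_linformE:
  assumes "general_linform r P"
  obtains f c where "f \<in> eval ` polyring r" "f c \<noteq> 0" "\<And>c. f c \<noteq> 0 \<Longrightarrow> P (linform r c)"
  using assms unfolding general_linform_def by blast

lemma general_linform_conj:
  assumes "general_linform r P" "general_linform r Q"
  shows "general_linform r (\<lambda>L :: 'k::field_char_0 mpoly. P L \<and> Q L)"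
proof -
  obtain f a where f: "f \<in> eval ` polyring r" "f a \<noteq> 0" "\<And>c. f c \<noteq> 0 \<Longrightarrow> P (linform r c)"
    using assms(1) by (rule general_linformE) blast
  obtain g b where g: "g \<in> eval ` polyring r" "g b \<noteq> 0" "\<And>c. g c \<noteq> 0 \<Longrightarrow> Q (linform r c)"
    using assms(2) by (rule general_linformE) blast
  have "(\<lambda>t. f (line a b t)) \<in> range poly" "(\<lambda>t. g (line a b t)) \<in> range poly"
    using f(1) g(1) poly_ring.eval_in[of "line a b"] line_coord by blast+
  then obtain t where t: "f (line a b t) \<noteq> 0" "g (line a b t) \<noteq> 0"
    using poly_functions_common_nonzero[of "\<lambda>t. f (line a b t)" 0 "\<lambda>t. g (line a b t)" 1] f(2) g(2) by auto
  show ?thesis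
  proof (rule general_linformI)
    show "(\<lambda>c. f c * g c) \<in> eval ` polyring r" by (rule eval_ring.mult_in[OF f(1) g(1)])
    show "f (line a b t) * g (line a b t) \<noteq> 0" using t by simp
  qed (use f g in auto)
qed

lemma general_linform_True: "general_linform r (\<lambda>L :: 'k::field mpoly. True)"
  by (rule general_linformI[OF eval_ring.const_in[of 1]]) auto

lemma general_linform_mono:
  assumes "general_linform r P" "\<And>c. P (linform r c) \<Longrightarrow> Q (linform r c)"
  shows "general_linform r Q"
  using assms unfolding general_linform_def by meson

lemma general_linform_ball:
  assumes "finite A" "\<And>i. i \<in> A \<Longrightarrow> general_linform r (P i)"
  shows "general_linform r (\<lambda>L :: 'k::field_char_0 mpoly. \<forall>i\<in>A. P i L)"
  using assms
proof (induction A rule: finite_induct)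
  case empty
  then show ?case using general_linform_True by simp
next
  case (insert a A)
  have "general_linform r (\<lambda>L. P a L \<and> (\<forall>i\<in>A. P i L))"
    using insert by (intro general_linform_conj) auto
  then show ?case by (rule general_linform_mono) auto
qed

text \<open>Reduces a lower bound for the rank of a general form to a single witness
  \<open>c0\<close>.\<close>

lemma general_linform_dim:
  fixes W :: "'k::field mpoly set"
  assumes W: "W \<subseteq> homog r (i + d)"
  shows "general_linform r (\<lambda>L. mp.dim (W \<union> (*) (linform r c0 ^ d) ` homog r i)
    \<le> mp.dim (W \<union> (*) (L ^ d) ` homog r i))"
proof -
  define V where "V = (\<lambda>w c. w) ` W \<union> (\<lambda>f c. linform r c ^ d * f) ` homog r i"
  have V: "(\<lambda>v. v c) ` V = W \<union> (*) (linform r c ^ d) ` homog r i" for c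
    by (auto simp: V_def image_Un image_image)
  have "\<exists>f\<in>eval ` (polyring r :: 'k mpoly set). f c0 \<noteq> 0 \<and> (\<forall>c. f c \<noteq> 0 \<longrightarrow>
      mp.dim ((\<lambda>v. v c0) ` V) \<le> mp.dim ((\<lambda>v. v c) ` V))"
  proof (rule eval_ring.dim_ge_open)
    fix v m assume "v \<in> V"
    then show "(\<lambda>c. lookup (v c) m) \<in> eval ` (polyring r :: 'k mpoly set)"
      unfolding V_def
      by (auto intro!: eval_ring.linform_power_times_coord coord_in_eval_ring eval_ring.const_in)
  next
    fix c show "mp.fin_dim ((\<lambda>v. v c) ` V)"
      unfolding V by (rule fin_dim_sub_homog[of _ r "i + d"]) (use W in auto)
  qed
  then obtain f where f: "f \<in> eval ` (polyring r :: 'k mpoly set)" "f c0 \<noteq> 0"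
    "\<And>c. f c \<noteq> 0 \<Longrightarrow> mp.dim ((\<lambda>v. v c0) ` V) \<le> mp.dim ((\<lambda>v. v c) ` V)"
    by auto
  show ?thesis
    by (rule general_linformI[OF f(1,2)]) (use f(3) in \<open>simp add: V\<close>)
qed

lemma times_kscale: "F * kscale c p = kscale c (F * p)"
  by (simp add: kscale_def mult.left_commute)

lemma subspace_colon:
  assumes "mp.subspace W" "mp.subspace X"
  shows "mp.subspace {f \<in> X. F * f \<in> (W :: 'k::field mpoly set)}"
  by (rule mp.subspaceI) (use assms in \<open>auto simp: distrib_left times_kscale mp.subspace_0 mp.subspace_add
    mp.subspace_scale\<close>)

section \<open>Green's hyperplane restriction theorem\<close>

lemma homog_not_subset_times:
  assumes "mp.subspace (W :: 'k::field mpoly set)" "\<not> homog r (Suc d) \<subseteq> W"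
  obtains c f where "f \<in> homog r d" "linform r c * f \<notin> W"
proof -
  obtain p where p: "p \<in> homog r (Suc d)" "p \<notin> W" using assms by blast
  then obtain j f where "j < r" "f \<in> homog r d" "var j * f \<notin> W"
    using homog_Suc_induct[OF p(1) assms(1)] by blast
  then show ?thesis using that linform_unit[of j r] by metis
qed

lemma div_count_1_le: "div_count (Suc 0) n \<le> 1"
proof -
  have "{m \<in> seg (Suc 0) n. lookup m 0 > 0} \<subseteq> {unit_mon 0}"
  proof clarify
    fix m assume m: "m \<in> seg (Suc 0) n" "lookup m 0 > 0"
    then have "0 \<in> keys m" by (simp add: in_keys_iff)
    then obtain m' where "m = unit_mon 0 + m'" by (rule remove_unit)
    then show "m = unit_mon 0" using m(1) by (simp add: seg_def)
  qed
  then have "card {m \<in> seg (Suc 0) n. lookup m 0 > 0} \<le> card {unit_mon 0}"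
    by (intro card_mono) auto
  then show ?thesis by (simp add: div_count_def)
qed

text \<open>Let x be the generic codimension of \<open>W + L R\<close>. For a general pair (H, L), submodularity applied to
  \<open>W + H R\<close> and \<open>W + L R\<close>, whose intersection contains \<open>W + L H R\<close>, bounds x by the generic
  codimensions for \<open>W + H R\<close> (induction on the codimension) and \<open>W : L\<close> (induction on the degree).\<close>

theorem green:
  fixes W :: "'k::field_char_0 mpoly set"
  assumes "W \<subseteq> homog r (Suc d)" "mp.subspace W"
  shows "\<exists>c. mp.dim (homog r (Suc d) :: 'k mpoly set) \<le> mp.dim (W \<union> (*) (linform r c) ` homog r d)
     + free_count (Suc d) (mp.dim (homog r (Suc d) :: 'k mpoly set) - mp.dim W)"
  using assms
proof (induction d arbitrary: W)
  case 0
  let ?R = "homog r (Suc 0) :: 'k mpoly set"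
  have le: "mp.dim W \<le> mp.dim ?R" using 0 by (intro mp.dim_mono_fin) auto
  show ?case
  proof (cases "?R \<subseteq> W")
    case True
    have "W \<union> (*) (linform r (\<lambda>_. 0)) ` homog r 0 \<subseteq> ?R"
      using 0(1) homog_times[OF linform_homog, of _ r 0] by auto
    then have "mp.dim ?R \<le> mp.dim (W \<union> (*) (linform r (\<lambda>_. 0)) ` homog r 0)"
      by (intro mp.dim_mono_fin fin_dim_sub_homog[of _ r "Suc 0"]) (use True in \<open>auto intro: mp.span_base\<close>)
    then show ?thesis by (intro exI) (rule trans_le_add1)
  next
    case False
    then obtain c f where cf: "f \<in> homog r 0" "linform r c * f \<notin> W"
      using homog_not_subset_times[OF 0(2)] by blast
    let ?U = "W \<union> (*) (linform r c) ` homog r 0"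
    have U: "?U \<subseteq> ?R" using 0(1) homog_times[OF linform_homog, of _ r 0] by auto
    have fW: "mp.fin_dim W" using 0(1) by (rule fin_dim_sub_homog)
    have "mp.dim (insert (linform r c * f) W) = Suc (mp.dim W)"
      using mp.dim_insert_fin[OF fW] cf(2) 0(2) by (simp add: mp.span_eq_iff[THEN iffD2, OF 0(2)])
    moreover have "mp.dim (insert (linform r c * f) W) \<le> mp.dim ?U"
      by (rule mp.dim_mono_fin[OF fin_dim_sub_homog[OF U]]) (use cf in \<open>auto intro: mp.span_base\<close>)
    ultimately have "Suc (mp.dim W) \<le> mp.dim ?U" by simp
    \<comment> \<open>In degree one \<open>div_count\<close> is at most 1, so a single additional
      dimension is all that is required.\<close>
    moreover have "mp.dim ?R - mp.dim W \<le> Suc (free_count (Suc 0) (mp.dim ?R - mp.dim W))"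
      using div_count_add_free_count[of "Suc 0" "mp.dim ?R - mp.dim W"] div_count_1_le[of "mp.dim ?R - mp.dim W"] by simp
    ultimately show ?thesis using le by (intro exI[of _ c]) simp
  qed
next
  case (Suc k)
  let ?R = "homog r (Suc (Suc k)) :: 'k mpoly set" and ?R1 = "homog r (Suc k) :: 'k mpoly set"
  define N where "N = mp.dim ?R"
  have timesR: "linform r c * f \<in> homog r (Suc d)" if "f \<in> homog r d" for c d and f :: "'k mpoly"
    using homog_times[OF linform_homog that, of c] by simp
  have "\<exists>c. N \<le> mp.dim (W \<union> (*) (linform r c) ` ?R1) + free_count (Suc (Suc k)) (N - mp.dim W)"
    using Suc.prems
  proof (induction "N - mp.dim W" arbitrary: W rule: less_induct)
    case less
    define n where "n = N - mp.dim W"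
    define M where "M c = W \<union> (*) (linform r c) ` ?R1" for c
    have MR: "M c \<subseteq> ?R" for c using less.prems(1) timesR by (auto simp: M_def)
    have fM: "mp.fin_dim (M c)" for c using MR by (rule fin_dim_sub_homog)
    have MN: "mp.dim (M c) \<le> N" for c unfolding N_def using MR by (intro mp.dim_mono_fin) auto
    have fW: "mp.fin_dim W" using less.prems(1) by (rule fin_dim_sub_homog)
    have WN: "mp.dim W \<le> N" unfolding N_def using less.prems by (intro mp.dim_mono_fin) auto
    show ?case
    proof (cases "?R \<subseteq> W")
      case True
      have "N \<le> mp.dim (M c)" for c
        unfolding N_def by (rule mp.dim_mono_fin[OF fM]) (use True in \<open>auto simp: M_def intro: mp.span_base\<close>)
      then show ?thesis by (auto simp: M_def intro: trans_le_add1)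
    next
      case False
      then obtain c f where cf: "f \<in> ?R1" "linform r c * f \<notin> W"
        using homog_not_subset_times[OF less.prems(2)] by blast
      \<comment> \<open>A form of maximal rank replaces the general one: its x is the generic
        codimension, and x bounds the codimension from below for every other form as well.\<close>
      obtain c1 where c1: "\<And>c. mp.dim (M c) \<le> mp.dim (M c1)"
        using ex_has_greatest_nat[of "\<lambda>c. True" undefined "\<lambda>c. mp.dim (M c)" "Suc N"] MN by (auto simp: less_Suc_eq_le)
      define x where "x = N - mp.dim (M c1)"
      have Nx: "mp.dim (M c1) = N - x" "x \<le> N" using MN by (auto simp: x_def)
      have "mp.dim (insert (linform r c * f) W) = Suc (mp.dim W)"
        using mp.dim_insert_fin[OF fW] cf(2) by (simp add: mp.span_eq_iff[THEN iffD2, OF less.prems(2)])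
      moreover have "mp.dim (insert (linform r c * f) W) \<le> mp.dim (M c)"
        by (rule mp.dim_mono_fin[OF fM]) (use cf in \<open>auto simp: M_def intro: mp.span_base\<close>)
      ultimately have "mp.dim W < mp.dim (M c1)" using c1[of c] by simp
      then have xn: "x < n" using MN[of c1] by (simp add: x_def n_def)
      define W1 where "W1 = mp.span (M c1)"
      have W1: "W1 \<subseteq> ?R" "mp.subspace W1"
        using mp.span_minimal[OF MR[of c1]] by (auto simp: W1_def)
      have W1x: "N - mp.dim W1 = x" by (simp add: W1_def x_def)
      have "\<exists>c. N \<le> mp.dim (W1 \<union> (*) (linform r c) ` ?R1) + free_count (Suc (Suc k)) (N - mp.dim W1)"
        using less.hyps[OF _ W1] W1x xn by (simp add: n_def)
      then obtain c2 where c2: "N \<le> mp.dim (W1 \<union> (*) (linform r c2) ` ?R1) + free_count (Suc (Suc k)) x"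
        using W1x by auto
      have "mp.span (W1 \<union> (*) (linform r c2) ` ?R1) = mp.span (M c1 \<union> M c2)"
        unfolding W1_def mp.span_Un[of "mp.span (M c1)"] mp.span_span
        unfolding mp.span_Un[symmetric] by (rule arg_cong[of _ _ mp.span]) (auto simp: M_def)
      then have c2': "N \<le> mp.dim (M c1 \<union> M c2) + free_count (Suc (Suc k)) x"
        using c2 by (metis mp.span_eq_dim)
      define W2 where "W2 = {f \<in> ?R1. linform r c1 * f \<in> W}"
      have W2: "W2 \<subseteq> ?R1" by (auto simp: W2_def)
      have subW2: "mp.subspace W2"
        unfolding W2_def using less.prems(2) by (intro subspace_colon) auto
      have dW2: "mp.dim (M c1) + mp.dim W2 = mp.dim W + mp.dim ?R1"
        unfolding M_def W2_def by (rule dim_homog_image) (use less.prems in auto)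
      have W2le: "mp.dim W2 \<le> mp.dim ?R1" using W2 by (intro mp.dim_mono_fin) auto
      have "mp.dim ?R1 - mp.dim W2 = n - x"
        using dW2 Nx WN by (simp add: n_def)
      then obtain c3 where c3: "mp.dim ?R1 \<le> mp.dim (W2 \<union> (*) (linform r c3) ` homog r k) + free_count (Suc k) (n - x)"
        using Suc.IH[OF W2 subW2] by auto
      define Q where "Q a b = W \<union> (\<lambda>f. linform r b * (linform r a * f)) ` homog r k" for a b
      have QR: "Q a b \<subseteq> ?R" for a b
        using less.prems(1) timesR by (auto simp: Q_def)
      \<comment> \<open>X contains \<open>W2 = W : L\<close> for the form L of c1. Multiplication by
        L maps X into the span of \<open>Q c3 c1\<close>, with kernel W2 modulo W, and thus carries
        the estimate for c3 up by one degree.\<close>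
      define X where "X = mp.span (W2 \<union> (*) (linform r c3) ` homog r k)"
      have XR: "X \<subseteq> ?R1"
        using mp.span_minimal[of "W2 \<union> (*) (linform r c3) ` homog r k" ?R1] W2 timesR by (auto simp: X_def)
      have dX: "mp.dim (W \<union> (*) (linform r c1) ` X) + mp.dim {f \<in> X. linform r c1 * f \<in> W} = mp.dim W + mp.dim X"
        by (rule dim_homog_image) (use less.prems XR in \<open>auto simp: X_def\<close>)
      have "{f \<in> X. linform r c1 * f \<in> W} = W2"
        using XR unfolding X_def by (auto simp: W2_def intro: mp.span_base)
      moreover have "W \<union> (*) (linform r c1) ` X \<subseteq> mp.span (Q c3 c1)"
      proof -
        interpret T: Vector_Spaces.linear kscale kscale "(*) (linform r c1 :: 'k mpoly)" by (rule linear_times)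
        have "(*) (linform r c1) ` X = mp.span ((*) (linform r c1) ` (W2 \<union> (*) (linform r c3) ` homog r k))"
          unfolding X_def by (rule T.span_image[symmetric])
        also have "\<dots> \<subseteq> mp.span (Q c3 c1)"
          by (rule mp.span_mono) (auto simp: Q_def W2_def)
        finally show ?thesis by (auto simp: Q_def intro: mp.span_base)
      qed
      then have "mp.dim (W \<union> (*) (linform r c1) ` X) \<le> mp.dim (Q c3 c1)"
        by (rule mp.dim_mono_fin[OF fin_dim_sub_homog[OF QR]])
      ultimately have c3': "N \<le> mp.dim (Q c3 c1) + x + free_count (Suc k) (n - x)"
        using dX c3 dW2 Nx by (simp add: X_def)
      \<comment> \<open>The two estimates hold at different pairs of forms, (c1, c2) and (c3, c1).
        The pair (H, L) moves from the first at t = 0 to the second at t = 1, and for a suitable t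
        both dimensions are at least as large as at the respective end.\<close>
      define H where "H = line c1 c3"
      define L where "L = line c2 c1"
      have "\<exists>f\<in>range poly. f 0 \<noteq> 0 \<and> (\<forall>t. f t \<noteq> 0 \<longrightarrow> mp.dim (M (H 0) \<union> M (L 0)) \<le> mp.dim (M (H t) \<union> M (L t)))"
      proof -
        define V where "V = (\<lambda>w t. w) ` W \<union> (\<lambda>f t. linform r (H t) * f) ` ?R1 \<union> (\<lambda>f t. linform r (L t) * f) ` ?R1"
        have V: "(\<lambda>v. v t) ` V = M (H t) \<union> M (L t)" for t
          by (auto simp: V_def M_def image_Un image_image)
        show ?thesis
          unfolding V[symmetric]
        proof (rule poly_ring.dim_ge_open)
          fix v m assume "v \<in> V"
          then show "(\<lambda>t. lookup (v t) m) \<in> range poly"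
            unfolding V_def H_def L_def
            by (auto intro!: poly_ring.linform_times_coord line_coord poly_ring.const_in)
        next
          fix t show "mp.fin_dim ((\<lambda>v. v t) ` V)"
            unfolding V by (rule fin_dim_sub_homog[of _ r "Suc (Suc k)"]) (use MR in blast)
        qed
      qed
      then obtain f where f: "f \<in> range poly" "f 0 \<noteq> 0"
        "\<And>t. f t \<noteq> 0 \<Longrightarrow> mp.dim (M c1 \<union> M c2) \<le> mp.dim (M (H t) \<union> M (L t))"
        by (auto simp: H_def L_def)
      have "\<exists>f\<in>range poly. f 1 \<noteq> 0 \<and> (\<forall>t. f t \<noteq> 0 \<longrightarrow> mp.dim (Q (H 1) (L 1)) \<le> mp.dim (Q (H t) (L t)))"
      proof -
        define V where "V = (\<lambda>w t. w) ` W \<union> (\<lambda>f t. linform r (L t) * (linform r (H t) * f)) ` homog r k"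
        have V: "(\<lambda>v. v t) ` V = Q (H t) (L t)" for t
          by (auto simp: V_def Q_def image_Un image_image)
        show ?thesis
          unfolding V[symmetric]
        proof (rule poly_ring.dim_ge_open)
          fix v m assume "v \<in> V"
          then show "(\<lambda>t. lookup (v t) m) \<in> range poly"
            unfolding V_def H_def L_def
            by (auto intro!: poly_ring.linform_times_coord line_coord poly_ring.const_in)
        next
          fix t show "mp.fin_dim ((\<lambda>v. v t) ` V)"
            unfolding V by (rule fin_dim_sub_homog[OF QR])
        qed
      qed
      then obtain g where g: "g \<in> range poly" "g 1 \<noteq> 0"
        "\<And>t. g t \<noteq> 0 \<Longrightarrow> mp.dim (Q c3 c1) \<le> mp.dim (Q (H t) (L t))"
        by (auto simp: H_def L_def)
      obtain t where t: "f t \<noteq> 0" "g t \<noteq> 0"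
        using poly_functions_common_nonzero[OF f(1,2) g(1,2)] by blast
      let ?U = "mp.span (M (H t))" and ?V = "mp.span (M (L t))"
      have UV: "?U \<subseteq> ?R" "?V \<subseteq> ?R" using mp.span_minimal[OF MR] by auto
      have "mp.dim (?U \<union> ?V) + mp.dim (?U \<inter> ?V) = mp.dim ?U + mp.dim ?V"
        by (rule mp.dim_Un_Int) (use UV fin_dim_sub_homog in auto)
      moreover have "mp.dim (M (H t) \<union> M (L t)) \<le> mp.dim (?U \<union> ?V)"
        by (rule mp.dim_mono_fin) (use UV in \<open>auto intro!: fin_dim_sub_homog[of _ r "Suc (Suc k)"] intro: mp.span_base\<close>)
      moreover have "mp.dim (Q (H t) (L t)) \<le> mp.dim (?U \<inter> ?V)"
      proof (rule mp.dim_mono_fin)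
        show "mp.fin_dim (?U \<inter> ?V)" using UV(1) by (intro fin_dim_sub_homog[of _ r "Suc (Suc k)"]) blast
        have "Q (H t) (L t) \<subseteq> M (H t) \<inter> M (L t)"
        proof
          fix y assume "y \<in> Q (H t) (L t)"
          then consider "y \<in> W" | f where "f \<in> homog r k" "y = linform r (L t) * (linform r (H t) * f)"
            by (auto simp: Q_def)
          then show "y \<in> M (H t) \<inter> M (L t)"
          proof cases
            case 2
            have "y = linform r (H t) * (linform r (L t) * f)" using 2 by (simp add: mult.left_commute)
            then show ?thesis using 2 timesR unfolding M_def by blast
          qed (simp add: M_def)
        qed
        also have "\<dots> \<subseteq> ?U \<inter> ?V" by (auto intro: mp.span_base)
        finally show "Q (H t) (L t) \<subseteq> mp.span (?U \<inter> ?V)" using mp.span_superset by blast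
      qed
      moreover have "mp.dim ?U \<le> N - x" "mp.dim ?V \<le> N - x" using c1 Nx by auto
      \<comment> \<open>With G for \<open>free_count\<close> in the respective degree, submodularity
        reads \<open>(N - G x) + (N - x - G (n - x)) \<le> 2 * (N - x)\<close>; maximality of c1
        bounds both summands on the right.\<close>
      ultimately have "x \<le> free_count (Suc (Suc k)) x + free_count (Suc k) (n - x)"
        using f(3)[OF t(1)] g(3)[OF t(2)] c2' c3' Nx(2) by linarith
      then have "div_count (Suc (Suc k)) x \<le> free_count (Suc k) (n - x)"
        using div_count_add_free_count[of "Suc (Suc k)" x] by simp
      then have "x \<le> free_count (Suc (Suc k)) (x + (n - x))"
        by (intro green_inequality) auto
      then have "N \<le> mp.dim (M c1) + free_count (Suc (Suc k)) n" using Nx xn by simp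
      then show ?thesis by (auto simp: M_def n_def)
    qed
  qed
  then show ?case by (simp add: N_def)
qed

section \<open>Homogeneous ideals\<close>

lemma homog_times':
  "F \<in> homog r d \<Longrightarrow> f \<in> homog r i \<Longrightarrow> F * f \<in> (homog r (i + d) :: 'k::field mpoly set)"
  using homog_times[of F r d f i] by (simp add: add.commute)

lemma homog_ideal_subspace:
  fixes I :: "'k::field mpoly set"
  assumes "homog_ideal r I"
  shows "mp.subspace I"
proof (rule mp.subspaceI)
  fix c :: 'k and x assume "x \<in> I"
  moreover have "const c \<in> polyring r" by (simp add: polyring_def const_def)
  ultimately show "kscale c x \<in> I" using assms by (simp add: homog_ideal_def kscale_def)
qed (use assms in \<open>auto simp: homog_ideal_def\<close>)

lemma subspace_ideal_homog:
  fixes I :: "'k::field mpoly set"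
  assumes "homog_ideal r I"
  shows "mp.subspace (I \<inter> homog r d)"
  using homog_ideal_subspace[OF assms] subspace_homog by (rule mp.subspace_inter)

lemma ideal_times:
  fixes I :: "'k::field mpoly set"
  assumes "homog_ideal r I" "f \<in> I" "F \<in> homog r d"
  shows "F * f \<in> I"
  using assms by (auto simp: homog_ideal_def homog_polyring)

lemma hilb_add_dim:
  fixes I :: "'k::field mpoly set"
  shows "hilb r I d + mp.dim (I \<inter> homog r d) = mp.dim (homog r d :: 'k mpoly set)"
proof -
  have "mp.dim (I \<inter> homog r d) \<le> mp.dim (homog r d :: 'k mpoly set)"
    by (rule mp.dim_mono_fin) auto
  then show ?thesis by (simp add: hilb_def)
qed

text \<open>The excess of the first dimension over that of \<open>I \<inter> homog r (i + d)\<close>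
  is the rank of multiplication by F on the quotient algebra. All ranks are expressed in this way,
  without quotient spaces.\<close>

lemma dim_ideal_Un_times:
  fixes I :: "'k::field mpoly set"
  assumes "homog_ideal r I" "F \<in> homog r d"
  shows "mp.dim (I \<inter> homog r (i + d) \<union> (*) F ` homog r i)
     + mp.dim {f \<in> homog r i. F * f \<in> I \<inter> homog r (i + d)}
     = mp.dim (I \<inter> homog r (i + d)) + mp.dim (homog r i :: 'k mpoly set)"
  by (rule dim_homog_image[of _ r "i + d" _ i]) (use subspace_ideal_homog[OF assms(1)] in auto)

lemma ideal_Un_times_subset:
  assumes "F \<in> homog r d"
  shows "I \<inter> homog r (i + d) \<union> (*) F ` homog r i \<subseteq> (homog r (i + d) :: 'k::field mpoly set)"
  using homog_times'[OF assms] by auto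

lemma dim_ideal_Un_times_le:
  fixes I :: "'k::field mpoly set"
  assumes I: "homog_ideal r I" and F: "F \<in> homog r d"
  shows "mp.dim (I \<inter> homog r (i + d) \<union> (*) F ` homog r i) \<le> mp.dim (I \<inter> homog r (i + d)) + hilb r I i"
    and "mp.dim (I \<inter> homog r (i + d)) + hilb r I i \<le> mp.dim (I \<inter> homog r (i + d) \<union> (*) F ` homog r i)
      \<Longrightarrow> mult_injective r I F i"
proof -
  let ?K = "{f \<in> homog r i. F * f \<in> I \<inter> homog r (i + d)}"
  have fK: "mp.fin_dim ?K" by (rule fin_dim_sub_homog[of _ r i]) auto
  have sub: "I \<inter> homog r i \<subseteq> ?K"
    using ideal_times[OF I _ F] homog_times'[OF F] by auto
  have le: "mp.dim (I \<inter> homog r i) \<le> mp.dim ?K"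
    by (rule mp.dim_mono_fin[OF fK]) (use sub mp.span_superset in blast)
  have eq: "mp.dim (I \<inter> homog r (i + d) \<union> (*) F ` homog r i) + mp.dim ?K
     = mp.dim (I \<inter> homog r (i + d)) + (hilb r I i + mp.dim (I \<inter> homog r i))"
    using dim_ideal_Un_times[OF I F, of i] hilb_add_dim[of r I i] by simp
  show "mp.dim (I \<inter> homog r (i + d) \<union> (*) F ` homog r i) \<le> mp.dim (I \<inter> homog r (i + d)) + hilb r I i"
    using eq le by simp
  assume "mp.dim (I \<inter> homog r (i + d)) + hilb r I i \<le> mp.dim (I \<inter> homog r (i + d) \<union> (*) F ` homog r i)"
  then have "mp.dim ?K \<le> mp.dim (I \<inter> homog r i)" using eq by simp
  then have "mp.span (I \<inter> homog r i) = mp.span ?K"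
    by (intro mp.span_eq_of_dim_le[OF fK]) (use sub mp.span_superset in blast)
  then have "?K \<subseteq> I \<inter> homog r i"
    using mp.span_superset[of ?K] mp.span_eq_iff[THEN iffD2, OF subspace_ideal_homog[OF I, of i]] by simp
  then show "mult_injective r I F i"
    unfolding mult_injective_def using homog_times'[OF F] by auto
qed

lemma mult_surjective_iff:
  fixes I :: "'k::field mpoly set"
  assumes I: "homog_ideal r I" and F: "F \<in> homog r d"
  shows "mult_surjective r I F d i \<longleftrightarrow>
    mp.dim (homog r (i + d) :: 'k mpoly set) \<le> mp.dim (I \<inter> homog r (i + d) \<union> (*) F ` homog r i)"
proof -
  let ?R = "homog r (i + d) :: 'k mpoly set" and ?U = "I \<inter> homog r (i + d) \<union> (*) F ` homog r i"
  have U: "?U \<subseteq> ?R" using ideal_Un_times_subset[OF F] .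
  interpret T: Vector_Spaces.linear kscale kscale "(*) F" by (rule linear_times)
  have FR: "mp.span ((*) F ` homog r i) = (*) F ` homog r i" by (simp add: T.span_image)
  have span: "mp.span ?U = {x + y |x y. x \<in> I \<inter> ?R \<and> y \<in> (*) F ` homog r i}"
    unfolding mp.span_Un FR mp.span_eq_iff[THEN iffD2, OF subspace_ideal_homog[OF I]] ..
  have "mp.dim ?R \<le> mp.dim ?U \<longleftrightarrow> mp.span ?U = ?R"
    using mp.span_eq_of_dim_le[of ?R ?U] U mp.span_eq_dim[of ?U ?R] by auto
  also have "\<dots> \<longleftrightarrow> ?R \<subseteq> mp.span ?U"
    using mp.span_minimal[OF U] by auto
  also have "\<dots> \<longleftrightarrow> mult_surjective r I F d i"
  proof
    assume *: "?R \<subseteq> mp.span ?U"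
    show "mult_surjective r I F d i" unfolding mult_surjective_def
    proof
      fix g assume "g \<in> ?R"
      then obtain x f where "x \<in> I" "f \<in> homog r i" "g = x + F * f" using * span by auto
      then show "\<exists>f\<in>homog r i. g - F * f \<in> I" by (intro bexI[of _ f]) auto
    qed
  next
    assume *: "mult_surjective r I F d i"
    show "?R \<subseteq> mp.span ?U"
    proof
      fix g assume g: "g \<in> ?R"
      then obtain f where f: "f \<in> homog r i" "g - F * f \<in> I" using * unfolding mult_surjective_def by blast
      have "F * f \<in> ?R" using homog_times'[OF F f(1)] .
      then have "g - F * f \<in> ?R" using g mp.subspace_diff[OF subspace_homog] by blast
      then have "g = (g - F * f) + F * f \<and> g - F * f \<in> I \<inter> ?R \<and> F * f \<in> (*) F ` homog r i"
        using f by auto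
      then show "g \<in> mp.span ?U" unfolding span by blast
    qed
  qed
  finally show ?thesis by simp
qed

lemma green_ideal:
  fixes I :: "'k::field_char_0 mpoly set"
  assumes I: "homog_ideal r I"
  obtains c where "mp.dim (I \<inter> homog r (Suc d)) + div_count (Suc d) (hilb r I (Suc d))
     \<le> mp.dim (I \<inter> homog r (Suc d) \<union> (*) (linform r c) ` homog r d)"
proof -
  have n: "mp.dim (homog r (Suc d) :: 'k mpoly set) - mp.dim (I \<inter> homog r (Suc d)) = hilb r I (Suc d)"
    by (simp add: hilb_def)
  obtain c where c: "mp.dim (homog r (Suc d) :: 'k mpoly set)
     \<le> mp.dim (I \<inter> homog r (Suc d) \<union> (*) (linform r c) ` homog r d) + free_count (Suc d) (hilb r I (Suc d))"
    using green[of "I \<inter> homog r (Suc d)" r d] subspace_ideal_homog[OF I] unfolding n by blast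
  show ?thesis
    by (rule that[of c]) (use c div_count_add_free_count[of "Suc d" "hilb r I (Suc d)"] hilb_add_dim[of r I "Suc d"] in simp)
qed

text \<open>The left-hand side bounds the rank of Green's linear form from below, and the dimension
  of its source bounds the rank from above.\<close>

lemma macaulay:
  fixes I :: "'k::field_char_0 mpoly set"
  assumes I: "homog_ideal r I"
  shows "div_count (Suc d) (hilb r I (Suc d)) \<le> hilb r I d"
proof -
  obtain c where c: "mp.dim (I \<inter> homog r (Suc d)) + div_count (Suc d) (hilb r I (Suc d))
     \<le> mp.dim (I \<inter> homog r (Suc d) \<union> (*) (linform r c) ` homog r d)"
    using green_ideal[OF I] .
  then show ?thesis
    using dim_ideal_Un_times_le(1)[OF I linform_homog[of r c], of d] by simp
qed

section \<open>Lexicographic ideals\<close>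

text \<open>The largest monomials in each degree; those left outside, which form a basis of the
  quotient, are the first \<open>h d\<close> ones when these fit into r variables.\<close>

definition lex_mons :: "nat \<Rightarrow> (nat \<Rightarrow> nat) \<Rightarrow> (nat \<Rightarrow>\<^sub>0 nat) set" where
  "lex_mons r h = {m. keys m \<subseteq> {..<r} \<and> h (mon_deg m) \<le> mrank m}"

text \<open>\<open>growth\<close> is Macaulay's condition read downwards, from degree
  \<open>Suc d\<close> to d; \<open>h_le\<close> keeps the first \<open>h d\<close> monomials within
  r variables.\<close>

locale macaulay_sequence =
  fixes r :: nat and h :: "nat \<Rightarrow> nat"
  assumes growth: "div_count (Suc d) (h (Suc d)) \<le> h d"
    and h_le: "h d \<le> card (mons r d)"
begin

text \<open>As \<open>x_0\<close> is the smallest variable, \<open>x_j m\<close> is at least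
  \<open>x_0 m\<close>, and only \<open>x_0\<close> has to be considered. The assumption on the
  position of m is weaker than membership in the ideal: it also covers monomials outside the ideal
  that every variable kills.\<close>

lemma unit_add_lex:
  assumes "keys m \<subseteq> {..<r}" "div_count (Suc (mon_deg m)) (h (Suc (mon_deg m))) \<le> mrank m" "j < r"
  shows "unit_mon j + m \<in> lex_mons r h"
proof -
  have "h (Suc (mon_deg m)) \<le> mrank (unit_mon 0 + m)"
    using div_count_gt_iff[of m "mon_deg m" "h (Suc (mon_deg m))"] assms(2) by auto
  also have "\<dots> \<le> mrank (unit_mon j + m)"
  proof (cases "j = 0")
    case False
    then have "mless (unit_mon 0 + m) (unit_mon j + m)"
      using mless_unit[of 0 j] mless_add_iff[of m "unit_mon 0" "unit_mon j"] by (simp add: add.commute)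
    then show ?thesis using mrank_less_iff[of "unit_mon 0 + m" "unit_mon j + m"] by simp
  qed simp
  finally show ?thesis using assms by (simp add: lex_mons_def keys_add_nat)
qed

lemma add_lex:
  assumes "keys a \<subseteq> {..<r}" "b \<in> lex_mons r h"
  shows "a + b \<in> lex_mons r h"
  using assms(1)
proof (induction "mon_deg a" arbitrary: a)
  case 0
  then show ?case using assms by simp
next
  case (Suc d)
  then have "a \<noteq> 0" by auto
  then obtain j where j: "j \<in> keys a" by (meson ex_in_conv keys_eq_empty)
  obtain a' where a': "a = unit_mon j + a'" using remove_unit[OF j] by blast
  then have "keys a' \<subseteq> {..<r}" "d = mon_deg a'" using Suc by (auto simp: keys_add_nat)
  then have *: "a' + b \<in> lex_mons r h" using Suc.hyps(1) by blast
  have "unit_mon j + (a' + b) \<in> lex_mons r h"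
    by (rule unit_add_lex) (use * growth[of "mon_deg (a' + b)"] Suc.prems j in \<open>auto simp: lex_mons_def simp del: mon_deg_add\<close>)
  then show ?case by (simp add: a' add.assoc)
qed

lemma homog_ideal_lex: "homog_ideal r (supp_in (lex_mons r h) :: 'k::field mpoly set)"
  unfolding homog_ideal_def
proof (intro conjI ballI allI)
  let ?J = "supp_in (lex_mons r h) :: 'k mpoly set"
  show "?J \<subseteq> polyring r" by (auto simp: supp_in_def polyring_def lex_mons_def)
  show "0 \<in> ?J" by (simp add: supp_in_def)
  show "p + q \<in> ?J" if "p \<in> ?J" "q \<in> ?J" for p q
    using mp.subspace_add[OF subspace_supp_in] that by blast
  show "q * p \<in> ?J" if p: "p \<in> ?J" and q: "q \<in> polyring r" for p q
  proof -
    have "keys (q * p) \<subseteq> lex_mons r h"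
    proof
      fix m assume "m \<in> keys (q * p)"
      then obtain a b where "a \<in> keys q" "b \<in> keys p" "m = a + b" using keys_mult[of q p] by blast
      then show "m \<in> lex_mons r h" using p q by (auto simp: supp_in_def polyring_def intro!: add_lex)
    qed
    then show ?thesis by (simp add: supp_in_def)
  qed
  show "hcomp d p \<in> ?J" if p: "p \<in> ?J" for p d
  proof -
    have "finite {m. (if mon_deg m = d then lookup p m else 0) \<noteq> 0}"
      by (rule finite_subset[OF _ finite_keys[of p]]) (auto simp: in_keys_iff)
    then have "lookup (hcomp d p) m = (if mon_deg m = d then lookup p m else 0)" for m
      by (simp add: hcomp_def)
    then have "keys (hcomp d p) \<subseteq> keys p" by (auto simp: in_keys_iff split: if_splits)
    then show ?thesis using p by (auto simp: supp_in_def)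
  qed
qed

lemma lex_inter_homog: "supp_in (lex_mons r h) \<inter> homog r d = (supp_in (mons r d - seg d (h d)) :: 'k::field mpoly set)"
  by (auto simp: homog_eq_supp_in supp_in_def lex_mons_def mons_def seg_def subset_iff not_less)

lemma card_mons_diff_seg:
  assumes "n \<le> card (mons r d)"
  shows "card (mons r d - seg d n) = card (mons r d) - n"
  using card_mons_inter_seg[OF assms] by (metis card_Diff_subset inf.orderI inf_commute)

lemma hilb_lex: "hilb r (supp_in (lex_mons r h) :: 'k::field mpoly set) d = h d"
  unfolding hilb_def lex_inter_homog
  using card_mons_diff_seg[OF h_le] h_le[of d] by (simp add: dim_supp_in dim_homog)

text \<open>Let \<open>D = div_count (Suc j) (h (Suc j))\<close>. Every variable sends the monomials
  from position D on into the ideal, so a linear form has rank at most D. This is less than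
  \<open>h j\<close> by assumption, and less than \<open>h (Suc j)\<close> because some of the first
  \<open>h (Suc j)\<close> monomials are free of \<open>x_0\<close>.\<close>

lemma not_SLP_lex_growth:
  assumes less: "div_count (Suc j) (h (Suc j)) < h j" and free: "free_count (Suc j) (h (Suc j)) > 0"
  shows "\<not> SLP r (supp_in (lex_mons r h) :: 'k::field mpoly set)"
proof
  let ?J = "supp_in (lex_mons r h) :: 'k mpoly set"
  assume "SLP r ?J"
  then obtain c where "\<forall>i. mult_injective r ?J (linform r c ^ 1) i \<or> mult_surjective r ?J (linform r c ^ 1) 1 i"
    unfolding SLP_def general_linform_def by (meson order_refl)
  then have L: "mult_injective r ?J (linform r c) j \<or> mult_surjective r ?J (linform r c) 1 j" by simp
  define D where "D = div_count (Suc j) (h (Suc j))"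
  have Dc: "D < card (mons r j)" using less h_le[of j] by (simp add: D_def)
  have kill: "linform r c * f \<in> ?J" if f: "f \<in> supp_in (mons r j - seg j D)" for f
  proof -
    have "f \<in> {f \<in> UNIV. linform r c * f \<in> ?J}"
    proof (rule supp_in_induct[OF f])
      show "mp.subspace {f \<in> UNIV. linform r c * f \<in> ?J}"
        by (intro subspace_colon subspace_supp_in) (simp add: mp.subspace_UNIV)
      fix m assume m: "m \<in> mons r j - seg j D"
      have "const (c i) * var i * Poly_Mapping.single m 1 \<in> ?J" if "i < r" for i
        using unit_add_lex[of m i] m that
        by (auto simp: const_def var_def mult_single supp_in_def mons_def seg_def D_def)
      then show "Poly_Mapping.single m 1 \<in> {f \<in> UNIV. linform r c * f \<in> ?J}"
        unfolding linform_def sum_distrib_right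
        by (auto intro!: mp.subspace_sum[OF subspace_supp_in])
    qed
    then show ?thesis by simp
  qed
  have "D \<in> mrank ` mons r j" using Dc by (simp add: mrank_image_mons)
  then obtain u where u: "u \<in> mons r j" "mrank u = D" by blast
  have su: "Poly_Mapping.single u 1 \<in> (supp_in (mons r j - seg j D) :: 'k mpoly set)"
    using u by (simp add: supp_in_def seg_def)
  have "Poly_Mapping.single u 1 \<notin> ?J"
    using u less by (simp add: supp_in_def lex_mons_def mons_def D_def)
  moreover have "Poly_Mapping.single u 1 \<in> (homog r j :: 'k mpoly set)"
    using u by (simp add: homog_eq_supp_in supp_in_def)
  ultimately have "\<not> mult_injective r ?J (linform r c) j"
    unfolding mult_injective_def using kill[OF su] by blast
  then have surj: "mult_surjective r ?J (linform r c) 1 j" using L by blast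
  have I: "homog_ideal r ?J" by (rule homog_ideal_lex)
  let ?K = "{f \<in> homog r j. linform r c * f \<in> ?J \<inter> homog r (j + 1)}"
  have "supp_in (mons r j - seg j D) \<subseteq> ?K"
    using kill homog_times'[OF linform_homog, of _ r j c] by (auto simp: homog_eq_supp_in[of r j] supp_in_def)
  then have "mp.dim (supp_in (mons r j - seg j D) :: 'k mpoly set) \<le> mp.dim ?K"
    by (intro mp.dim_mono_fin fin_dim_sub_homog[of ?K r j]) (use mp.span_superset in blast)+
  then have "card (mons r j) - D \<le> mp.dim ?K"
    using card_mons_diff_seg[of D j] Dc by (simp add: dim_supp_in)
  then have "mp.dim (?J \<inter> homog r (j + 1) \<union> (*) (linform r c) ` homog r j) \<le> mp.dim (?J \<inter> homog r (j + 1)) + D"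
    using dim_ideal_Un_times[OF I linform_homog[of r c], of j] Dc by (simp add: dim_homog)
  moreover have "D < h (Suc j)"
    using free div_count_add_free_count[of "Suc j" "h (Suc j)"] by (simp add: D_def)
  moreover have "h (Suc j) + mp.dim (?J \<inter> homog r (j + 1)) = mp.dim (homog r (j + 1) :: 'k mpoly set)"
    using hilb_add_dim[of r ?J "Suc j"] by (simp add: hilb_lex)
  ultimately show False
    using surj mult_surjective_iff[OF I linform_homog[of r c], of j] by simp
qed

text \<open>Since \<open>card (mons 2 t) = t + 1\<close> exceeds \<open>h t\<close>, the monomials
  of degree t outside the ideal involve \<open>x_0\<close> and \<open>x_1\<close> only. So
  \<open>x_2\<close> and all larger variables are killed, although \<open>x_2\<close> is nonzero by
  \<open>h 1 = r\<close>, and the rank is at most 2, less than \<open>h t\<close>.\<close>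

lemma not_SLP_lex_tail:
  assumes t: "h t \<le> t" "3 \<le> h t" and h1: "h 1 = r" and r: "3 \<le> r"
  shows "\<not> SLP r (supp_in (lex_mons r h) :: 'k::field mpoly set)"
proof
  let ?J = "supp_in (lex_mons r h) :: 'k mpoly set"
  assume "SLP r ?J"
  moreover have "t - 1 \<ge> 1" using t by simp
  ultimately obtain c where "\<forall>i. mult_injective r ?J (linform r c ^ (t - 1)) i \<or> mult_surjective r ?J (linform r c ^ (t - 1)) (t - 1) i"
    unfolding SLP_def general_linform_def by meson
  then have L: "mult_injective r ?J (linform r c ^ (t - 1)) 1 \<or> mult_surjective r ?J (linform r c ^ (t - 1)) (t - 1) 1"
    by blast
  let ?F = "linform r c ^ (t - 1) :: 'k mpoly"
  have F: "?F \<in> homog r (t - 1)" by simp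
  have tt: "1 + (t - 1) = t" using t by simp
  have kill: "?F * f \<in> ?J" if f: "f \<in> supp_in (mons r 1 - mons 2 1)" for f
  proof -
    have "keys (?F * f) \<subseteq> lex_mons r h"
    proof
      fix m assume "m \<in> keys (?F * f)"
      then obtain a b where ab: "a \<in> keys ?F" "b \<in> keys f" "m = a + b" using keys_mult[of ?F f] by blast
      have a: "a \<in> mons r (t - 1)" using ab(1) F unfolding homog_eq_supp_in supp_in_def by blast
      have b: "b \<in> mons r 1" "b \<notin> mons 2 1" using f ab(2) by (auto simp: supp_in_def)
      then have m: "mon_deg m = t" "m \<notin> mons 2 t" "keys m \<subseteq> {..<r}"
        using a tt by (auto simp: ab(3) mons_def keys_add_nat)
      then have "\<not> mrank m < card (mons 2 t)" using mrank_less_card_mons_iff by blast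
      then have "h (mon_deg m) \<le> mrank m" using t m(1) by (simp add: card_mons)
      then show "m \<in> lex_mons r h" using m by (simp add: lex_mons_def)
    qed
    then show ?thesis by (simp add: supp_in_def)
  qed
  have u: "unit_mon 2 \<in> mons r 1" "unit_mon 2 \<notin> mons 2 1" using r by (auto simp: mons_def)
  have "mrank (unit_mon 2) < card (mons r 1)"
    using u mrank_less_card_mons_iff[of "unit_mon 2" 1 r] by simp
  then have "mrank (unit_mon 2) < h 1" using r h1 by (simp add: card_mons)
  then have "Poly_Mapping.single (unit_mon 2) 1 \<notin> ?J" by (simp add: supp_in_def lex_mons_def)
  moreover have "Poly_Mapping.single (unit_mon 2) 1 \<in> (homog r 1 :: 'k mpoly set)"
    using u by (simp add: homog_eq_supp_in supp_in_def)
  moreover have "?F * Poly_Mapping.single (unit_mon 2) 1 \<in> ?J" using u by (intro kill) (simp add: supp_in_def)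
  ultimately have "\<not> mult_injective r ?J ?F 1" unfolding mult_injective_def by blast
  then have surj: "mult_surjective r ?J ?F (t - 1) 1" using L by blast
  have I: "homog_ideal r ?J" by (rule homog_ideal_lex)
  let ?K = "{f \<in> homog r 1. ?F * f \<in> ?J \<inter> homog r (1 + (t - 1))}"
  have "(supp_in (mons r 1 - mons 2 1) :: 'k mpoly set) \<subseteq> homog r 1"
    by (auto simp only: homog_eq_supp_in supp_in_def)
  then have "supp_in (mons r 1 - mons 2 1) \<subseteq> ?K"
    using kill homog_times'[OF F, of _ 1] by blast
  then have "mp.dim (supp_in (mons r 1 - mons 2 1) :: 'k mpoly set) \<le> mp.dim ?K"
    by (intro mp.dim_mono_fin fin_dim_sub_homog[of ?K r 1]) (use mp.span_superset in blast)+
  moreover have "mons 2 1 \<subseteq> mons r 1" using r by (auto simp: mons_def)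
  then have "card (mons r 1 - mons 2 1) = r - 2"
    using r by (simp add: card_Diff_subset card_mons)
  ultimately have "r - 2 \<le> mp.dim ?K" by (simp add: dim_supp_in)
  then have "mp.dim (?J \<inter> homog r t \<union> (*) ?F ` homog r 1) \<le> mp.dim (?J \<inter> homog r t) + 2"
    using dim_ideal_Un_times[OF I F, of 1] r unfolding tt by (simp add: dim_homog card_mons)
  moreover have "h t + mp.dim (?J \<inter> homog r t) = mp.dim (homog r t :: 'k mpoly set)"
    using hilb_add_dim[of r ?J t] by (simp add: hilb_lex)
  ultimately show False
    using surj mult_surjective_iff[OF I F, of 1] t unfolding tt by simp
qed

end

section \<open>A criterion for the strong Lefschetz property\<close>

lemma mult_injective_iff:
  fixes I :: "'k::field mpoly set"
  assumes I: "homog_ideal r I" and F: "F \<in> homog r d"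
  shows "mult_injective r I F i \<longleftrightarrow>
    mp.dim (I \<inter> homog r (i + d)) + hilb r I i \<le> mp.dim (I \<inter> homog r (i + d) \<union> (*) F ` homog r i)"
proof
  assume "mult_injective r I F i"
  then have "{f \<in> homog r i. F * f \<in> I \<inter> homog r (i + d)} \<subseteq> I \<inter> homog r i"
    by (auto simp: mult_injective_def)
  then have "mp.dim {f \<in> homog r i. F * f \<in> I \<inter> homog r (i + d)} \<le> mp.dim (I \<inter> homog r i)"
    by (intro mp.dim_mono_fin fin_dim_sub_homog[of "I \<inter> homog r i" r i]) (use mp.span_superset in blast)+
  then show "mp.dim (I \<inter> homog r (i + d)) + hilb r I i \<le> mp.dim (I \<inter> homog r (i + d) \<union> (*) F ` homog r i)"
    using dim_ideal_Un_times[OF I F, of i] hilb_add_dim[of r I i] by simp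
qed (rule dim_ideal_Un_times_le(2)[OF assms])

text \<open>Injectivity and surjectivity are lower bounds for the same dimension, so whichever holds
  for the witness holds wherever the rank is no smaller. From degree D on the target vanishes, which
  leaves finitely many i.\<close>

lemma SLP_I:
  fixes I :: "'k::field_char_0 mpoly set"
  assumes I: "homog_ideal r I" and art: "artinian r I"
    and ex: "\<And>d i. d \<ge> 1 \<Longrightarrow> \<exists>c. mult_injective r I (linform r c ^ d) i \<or> mult_surjective r I (linform r c ^ d) d i"
  shows "SLP r I"
  unfolding SLP_def
proof (intro allI impI)
  fix d :: nat assume d: "d \<ge> 1"
  let ?P = "\<lambda>i L. mult_injective r I (L ^ d) i \<or> mult_surjective r I (L ^ d) d i"
  obtain D where D: "\<And>e. e \<ge> D \<Longrightarrow> hilb r I e = 0" using art by (auto simp: artinian_def)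
  have gen: "general_linform r (?P i)" for i
  proof -
    obtain c where c: "?P i (linform r c)" using ex[OF d] by blast
    have "general_linform r (\<lambda>L. mp.dim (I \<inter> homog r (i + d) \<union> (*) (linform r c ^ d) ` homog r i)
      \<le> mp.dim (I \<inter> homog r (i + d) \<union> (*) (L ^ d) ` homog r i))"
      by (rule general_linform_dim) auto
    then show ?thesis
    proof (rule general_linform_mono)
      fix c' assume "mp.dim (I \<inter> homog r (i + d) \<union> (*) (linform r c ^ d) ` homog r i)
        \<le> mp.dim (I \<inter> homog r (i + d) \<union> (*) (linform r c' ^ d) ` homog r i)"
      then show "?P i (linform r c')"
        using c unfolding mult_injective_iff[OF I linform_power_homog] mult_surjective_iff[OF I linform_power_homog]
        by linarith
    qed
  qed
  have "general_linform r (\<lambda>L. \<forall>i\<in>{..<D}. ?P i L)"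
    by (rule general_linform_ball) (use gen in auto)
  then show "general_linform r (\<lambda>L. \<forall>i. ?P i L)"
  proof (rule general_linform_mono)
    fix c assume small: "\<forall>i\<in>{..<D}. ?P i (linform r c)"
    have "mult_surjective r I (linform r c ^ d) d i" if "i \<ge> D" for i
    proof -
      have "mp.dim (I \<inter> homog r (i + d)) = mp.dim (homog r (i + d) :: 'k mpoly set)"
        using hilb_add_dim[of r I "i + d"] D[of "i + d"] that by simp
      moreover have "mp.dim (I \<inter> homog r (i + d)) \<le> mp.dim (I \<inter> homog r (i + d) \<union> (*) (linform r c ^ d) ` homog r i)"
        by (rule mp.dim_mono_fin[OF fin_dim_sub_homog[OF ideal_Un_times_subset[OF linform_power_homog]]])
          (auto intro: mp.span_base)
      ultimately show ?thesis by (simp add: mult_surjective_iff[OF I linform_power_homog])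
    qed
    then show "\<forall>i. ?P i (linform r c)" using small by (meson lessThan_iff not_le)
  qed
qed

section \<open>Two variables\<close>

text \<open>The top coefficients of the two products are the product of the leading coefficients
  times \<open>degree f\<close> and times \<open>degree g\<close>. Characteristic zero turns
  equality in the field into equality of degrees.\<close>

lemma pderiv_ratio_degree:
  fixes f g :: "'k::field_char_0 poly"
  assumes eq: "pderiv f * g = f * pderiv g" and nz: "f \<noteq> 0" "g \<noteq> 0"
  shows "degree f = degree g"
proof (cases "degree f = 0 \<or> degree g = 0")
  case True
  then show ?thesis
    using eq nz by (metis mult_eq_0_iff pderiv_eq_0_iff)
next
  case False
  have *: "coeff (pderiv p * q) (degree p + degree q - 1) = of_nat (degree p) * (lead_coeff p * lead_coeff q)"
    if "degree p \<noteq> 0" for p q :: "'k poly"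
  proof -
    have "coeff (pderiv p * q) (degree (pderiv p) + degree q) = lead_coeff (pderiv p) * lead_coeff q"
      by (rule coeff_mult_degree_sum)
    moreover have "lead_coeff (pderiv p) = of_nat (degree p) * lead_coeff p"
      using that by (simp add: degree_pderiv coeff_pderiv)
    ultimately show ?thesis using that by (simp add: degree_pderiv mult.assoc)
  qed
  have "coeff (pderiv f * g) (degree f + degree g - 1) = coeff (pderiv g * f) (degree g + degree f - 1)"
    using eq by (simp add: add.commute mult.commute)
  then have "of_nat (degree f) * (lead_coeff f * lead_coeff g) = of_nat (degree g) * (lead_coeff g * lead_coeff f)"
    using *[of f g] *[of g f] False by metis
  then have "of_nat (degree f) = (of_nat (degree g) :: 'k)" using nz by (simp add: mult.commute)
  then show ?thesis by simp
qed

text \<open>A vanishing Wronskian survives subtracting a multiple of g. The difference h that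
  cancels the leading term has coefficient zero at \<open>degree g\<close>, so it cannot have the
  degree of g and must be zero.\<close>

lemma pderiv_ratio:
  fixes f g :: "'k::field_char_0 poly"
  assumes eq: "pderiv f * g = f * pderiv g" and g: "g \<noteq> 0"
  obtains a where "f = smult a g"
proof (cases "f = 0")
  case True
  then show ?thesis using that[of 0] by simp
next
  case False
  define a where "a = lead_coeff f / lead_coeff g"
  define h where "h = f - smult a g"
  have df: "degree f = degree g" using pderiv_ratio_degree[OF eq False g] .
  have "pderiv h * g = h * pderiv g"
    using eq by (simp add: h_def pderiv_diff pderiv_smult algebra_simps)
  moreover have "coeff h (degree g) = 0"
    using g df by (simp add: h_def a_def)
  ultimately have "h = 0"
    using pderiv_ratio_degree[of h g] g leading_coeff_0_iff[of h] by metis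
  then show ?thesis using that[of a] by (simp add: h_def)
qed

interpretation up: fd_subspaces "smult :: 'k::field \<Rightarrow> 'k poly \<Rightarrow> 'k poly"
  by unfold_locales (auto simp: smult_add_left smult_add_right)

lemma pderiv_dvd:
  fixes f :: "'k::field_char_0 poly"
  assumes "p ^ Suc m dvd f"
  shows "p ^ m dvd pderiv f"
proof -
  obtain q where "f = p ^ Suc m * q" using assms by (elim dvdE)
  then have "pderiv f = p ^ m * (p * pderiv q + smult (of_nat (Suc m)) (pderiv p) * q)"
    by (simp only: pderiv_mult pderiv_power_Suc) (simp add: algebra_simps del: of_nat_Suc)
  then show ?thesis by simp
qed

text \<open>Dividing by a fixed element g and differentiating lowers both the dimension and the order of
  vanishing by one.\<close>

lemma finite_inflection_points:
  fixes V :: "'k::field_char_0 poly set"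
  assumes "up.subspace V" "up.fin_dim V" "up.dim V \<le> m"
  shows "finite {c. \<exists>f\<in>V. f \<noteq> 0 \<and> [:- c, 1:] ^ m dvd f}"
  using assms
proof (induction m arbitrary: V)
  case 0
  have "f = 0" if "f \<in> V" for f
  proof (rule ccontr)
    assume "f \<noteq> 0"
    then have "up.dim {f} = 1" using up.dim_eq_card_independent[of "{f}"] by simp
    moreover have "up.dim {f} \<le> up.dim V" using 0(2) that by (intro up.dim_mono_fin) (auto intro: up.span_base)
    ultimately show False using 0(3) by simp
  qed
  then have "{c. \<exists>f\<in>V. f \<noteq> 0 \<and> [:- c, 1:] ^ 0 dvd f} = {}" by auto
  then show ?case by simp
next
  case (Suc m)
  show ?case
  proof (cases "V \<subseteq> {0}")
    case True
    then have "{c. \<exists>f\<in>V. f \<noteq> 0 \<and> [:- c, 1:] ^ Suc m dvd f} = {}" by auto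
    then show ?thesis by (simp only: finite.emptyI)
  next
    case False
    then obtain g where g: "g \<in> V" "g \<noteq> 0" by blast
    \<comment> \<open>The Wronskian with g, that is \<open>g ^ 2\<close> times the derivative of f /
      g, which avoids fractions. It kills g, so the dimension drops.\<close>
    define T where "T f = pderiv f * g - f * pderiv g" for f
    have lin: "Vector_Spaces.linear smult smult T"
      by unfold_locales (auto simp: T_def pderiv_add pderiv_smult algebra_simps)
    interpret T: Vector_Spaces.linear smult smult T by (rule lin)
    have subW: "up.subspace (T ` V)" using T.subspace_image[OF Suc.prems(1)] .
    have finW: "up.fin_dim (T ` V)"
    proof -
      obtain B where "finite B" "V \<subseteq> up.span B" using Suc.prems(2) unfolding up.fin_dim_def by blast
      then have "T ` V \<subseteq> up.span (T ` B)" by (auto simp: T.span_image)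
      then show ?thesis unfolding up.fin_dim_def using \<open>finite B\<close> by blast
    qed
    have z: "up.subspace {0 :: 'k poly}" "up.fin_dim {0 :: 'k poly}"
      by (auto simp: up.fin_dim_def up.subspace_single_0 intro!: exI[of _ "{}"])
    have d0: "up.dim {0 :: 'k poly} = 0"
      using up.dim_span[of "{} :: 'k poly set"] up.dim_eq_card_independent[of "{} :: 'k poly set"]
        up.independent_empty by simp
    have "up.dim ({0} \<union> T ` V) + up.dim {f \<in> V. T f \<in> {0}} = up.dim {0 :: 'k poly} + up.dim V"
      by (rule up.dim_Un_image[OF lin z Suc.prems(1,2)])
    moreover have "{0} \<union> T ` V = T ` V" using up.subspace_0[OF subW] by auto
    moreover have "1 \<le> up.dim {f \<in> V. T f \<in> {0}}"
    proof -
      have "up.dim {g} = 1" using up.dim_eq_card_independent[of "{g}"] g by simp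
      moreover have "up.dim {g} \<le> up.dim {f \<in> V. T f \<in> {0}}"
      proof (rule up.dim_mono_fin)
        show "up.fin_dim {f \<in> V. T f \<in> {0}}"
          by (rule up.fin_dim_subset[OF Suc.prems(2)]) (auto intro: up.span_base)
        show "{g} \<subseteq> up.span {f \<in> V. T f \<in> {0}}" using g by (auto simp: T_def intro!: up.span_base)
      qed
      ultimately show ?thesis by simp
    qed
    ultimately have "up.dim (T ` V) \<le> m" using Suc.prems(3) d0 by simp
    then have fin: "finite {c. \<exists>f\<in>T ` V. f \<noteq> 0 \<and> [:- c, 1:] ^ m dvd f}"
      using Suc.IH[OF subW finW] by blast
    have "{c. \<exists>f\<in>V. f \<noteq> 0 \<and> [:- c, 1:] ^ Suc m dvd f}
      \<subseteq> {c. poly g c = 0} \<union> {c. \<exists>f\<in>T ` V. f \<noteq> 0 \<and> [:- c, 1:] ^ m dvd f}"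
    proof
      fix c assume "c \<in> {c. \<exists>f\<in>V. f \<noteq> 0 \<and> [:- c, 1:] ^ Suc m dvd f}"
      then obtain f where f: "f \<in> V" "f \<noteq> 0" "[:- c, 1:] ^ Suc m dvd f" by blast
      have "[:- c, 1:] dvd f" using f(3) unfolding power_Suc by (rule dvd_mult_left)
      then have fc: "poly f c = 0" by (simp add: poly_eq_0_iff_dvd)
      show "c \<in> {c. poly g c = 0} \<union> {c. \<exists>f\<in>T ` V. f \<noteq> 0 \<and> [:- c, 1:] ^ m dvd f}"
      proof (cases "T f = 0")
        case True
        \<comment> \<open>Here c is one of the finitely many roots of the fixed polynomial
          g.\<close>
        then obtain a where a: "f = smult a g" using pderiv_ratio[of f g] g by (auto simp: T_def)
        then have "a \<noteq> 0" using f by auto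
        then show ?thesis using fc a by simp
      next
        case False
        have "[:- c, 1:] ^ m dvd f" using f(3) by (rule dvd_trans[rotated]) (rule le_imp_power_dvd, simp)
        then have "[:- c, 1:] ^ m dvd T f"
          unfolding T_def using pderiv_dvd[OF f(3)] by (intro dvd_diff dvd_mult2)
        then show ?thesis using False f(1) by blast
      qed
    qed
    moreover have "finite ({c. poly g c = 0} \<union> {c. \<exists>f\<in>T ` V. f \<noteq> 0 \<and> [:- c, 1:] ^ m dvd f})"
      using fin poly_roots_finite[OF g(2)] by simp
    ultimately show ?thesis by (rule finite_subset)
  qed
qed

section \<open>Binary forms as univariate polynomials\<close>

definition dehomog :: "'k::field mpoly \<Rightarrow> 'k poly" where
  "dehomog p = (\<Sum>m\<in>keys p. monom (lookup p m) (lookup m 0))"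

lemma poly_dehomog: "poly (dehomog p) t = eval p (\<lambda>j. if j = 0 then t else 1)"
proof -
  have "(\<Prod>j\<in>keys m. (if j = 0 then t else 1) ^ lookup m j) = t ^ lookup m 0" for m :: "nat \<Rightarrow>\<^sub>0 nat"
  proof -
    have "(\<Prod>j\<in>keys m. (if j = 0 then t else 1) ^ lookup m j) = (\<Prod>j\<in>keys m. if j = 0 then t ^ lookup m 0 else 1)"
      by (intro prod.cong) auto
    also have "\<dots> = t ^ lookup m 0"
      by (cases "0 \<in> keys m") (auto simp: in_keys_iff)
    finally show ?thesis .
  qed
  then show ?thesis
    unfolding eval_def by (simp add: dehomog_def poly_sum poly_monom)
qed

lemma dehomog_mult: "dehomog (p * q) = dehomog p * dehomog (q :: 'k::field_char_0 mpoly)"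
  by (rule poly_eq_poly_eq_iff[THEN iffD1]) (simp add: fun_eq_iff poly_dehomog eval_mult)

lemma dehomog_power: "dehomog (p ^ n) = dehomog (p :: 'k::field_char_0 mpoly) ^ n"
proof (induction n)
  case 0
  show ?case
    by (simp add: dehomog_def flip: one_pCons)
next
  case (Suc n)
  then show ?case by (simp add: dehomog_mult)
qed

lemma linear_dehomog: "Vector_Spaces.linear kscale smult (dehomog :: 'k::field_char_0 mpoly \<Rightarrow> 'k poly)"
proof -
  have "dehomog (p + q) = dehomog p + dehomog q" "dehomog (kscale a p) = smult a (dehomog p)" for p q :: "'k mpoly" and a
    by (rule poly_eq_poly_eq_iff[THEN iffD1], simp add: fun_eq_iff poly_dehomog eval_add eval_kscale)+
  then show ?thesis by unfold_locales auto
qed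

lemma dehomog_linform: "dehomog (linform 2 (\<lambda>j. if j = 0 then 1 else - a)) = [:- a, 1:: 'k::field_char_0:]"
proof (rule poly_eq_poly_eq_iff[THEN iffD1], rule ext)
  fix t
  have "eval (var j) c = c j" for j and c :: "nat \<Rightarrow> 'k"
    by (simp add: var_def eval_single mon_eval_def)
  moreover have "eval (const b * p) c = b * eval p c" for b :: 'k and p c
    using eval_kscale[of b p c] by (simp add: kscale_def)
  ultimately show "poly (dehomog (linform 2 (\<lambda>j. if j = 0 then 1 else - a))) t = poly [:- a, 1:] t"
    unfolding poly_dehomog linform_def numeral_2_eq_2 lessThan_Suc by (simp add: eval_add)
qed

text \<open>In two variables and fixed degree, the exponent of \<open>x_0\<close> determines the
  monomial, so no coefficients are merged.\<close>

lemma dehomog_eq_0: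
  assumes p: "p \<in> homog 2 s" and z: "dehomog p = 0"
  shows "p = 0"
proof (rule poly_mapping_eqI)
  fix m
  show "lookup p m = lookup 0 m"
  proof (cases "m \<in> keys p")
    case True
    have deg: "lookup m' 0 + lookup m' 1 = s" "keys m' \<subseteq> {0, 1}" if "m' \<in> keys p" for m'
    proof -
      have m': "m' \<in> mons 2 s" using p that by (auto simp: homog_eq_supp_in supp_in_def)
      then show k: "keys m' \<subseteq> {0, 1}" by (auto simp: mons_def)
      show "lookup m' 0 + lookup m' 1 = s"
        using mon_deg_superset[of "{0,1}" m'] k m' by (simp add: mons_def)
    qed
    have inj: "m' = m" if "m' \<in> keys p" "lookup m' 0 = lookup m 0" for m'
    proof (rule poly_mapping_eqI)
      fix k
      show "lookup m' k = lookup m k"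
      proof (cases "k \<in> {0, 1}")
        case True
        then show ?thesis using deg(1)[OF that(1)] deg(1)[OF \<open>m \<in> keys p\<close>] that(2) by auto
      next
        case False
        then have "k \<notin> keys m'" "k \<notin> keys m" using deg(2)[OF that(1)] deg(2)[OF \<open>m \<in> keys p\<close>] by auto
        then show ?thesis by (simp add: in_keys_iff)
      qed
    qed
    have "coeff (dehomog p) (lookup m 0) = (\<Sum>m'\<in>keys p. if m' = m then lookup p m' else 0)"
      unfolding dehomog_def coeff_sum by (intro sum.cong) (use inj in auto)
    also have "\<dots> = lookup p m" using True by simp
    finally show ?thesis using z by simp
  qed (simp add: in_keys_iff)
qed

lemma binary_forms_transversal:
  fixes V :: "'k::field_char_0 mpoly set"
  assumes V: "V \<subseteq> homog 2 (i + d)" "mp.subspace V" "mp.dim V \<le> d"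
  obtains c where "mp.dim V + mp.dim (homog 2 i :: 'k mpoly set) \<le> mp.dim (V \<union> (*) (linform 2 c ^ d) ` homog 2 i)"
proof -
  interpret \<delta>: Vector_Spaces.linear kscale smult "dehomog :: 'k mpoly \<Rightarrow> 'k poly" by (rule linear_dehomog)
  obtain B where B: "finite B" "B \<subseteq> V" "mp.independent B" "mp.span B = mp.span V" "card B = mp.dim V"
    by (rule mp.fin_dim_basis[OF fin_dim_sub_homog[OF V(1)]])
  have sp: "dehomog ` V \<subseteq> up.span (dehomog ` B)"
    using B(4) mp.span_superset[of V] by (auto simp: \<delta>.span_image)
  have "up.dim (dehomog ` V) \<le> card (dehomog ` B)"
    by (rule up.dim_le_card[OF sp]) (use B in simp)
  then have "up.dim (dehomog ` V) \<le> d" using card_image_le[OF B(1), of dehomog] B(5) V(3) by simp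
  moreover have "up.subspace (dehomog ` V)" using \<delta>.subspace_image[OF V(2)] .
  moreover have "up.fin_dim (dehomog ` V)" unfolding up.fin_dim_def using sp B(1) by blast
  ultimately have fin: "finite {a. \<exists>f\<in>dehomog ` V. f \<noteq> 0 \<and> [:- a, 1:] ^ d dvd f}"
    by (intro finite_inflection_points)
  then have "{a. \<exists>f\<in>dehomog ` V. f \<noteq> 0 \<and> [:- a, 1:] ^ d dvd f} \<noteq> UNIV"
    using infinite_UNIV_char_0[where 'a = 'k] by metis
  then obtain a where a: "\<And>f. f \<in> V \<Longrightarrow> [:- a, 1:] ^ d dvd dehomog f \<Longrightarrow> dehomog f = 0" by blast
  define c where "c = (\<lambda>j::nat. if j = 0 then 1 else - a)"
  have "{f \<in> homog 2 i. linform 2 c ^ d * f \<in> V} \<subseteq> {0}"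
  proof clarify
    fix f :: "'k mpoly" assume f: "f \<in> homog 2 i" "linform 2 c ^ d * f \<in> V"
    have e: "dehomog (linform 2 c ^ d * f) = [:- a, 1:] ^ d * dehomog f"
      by (simp add: dehomog_mult dehomog_power c_def dehomog_linform)
    then have "[:- a, 1:] ^ d * dehomog f = 0" using a[OF f(2)] by simp
    then have "dehomog f = 0" by simp
    then show "f = 0" using dehomog_eq_0[OF f(1)] by simp
  qed
  then have "mp.dim {f \<in> homog 2 i. linform 2 c ^ d * f \<in> V} \<le> card ({} :: 'k mpoly set)"
    by (intro mp.dim_le_card) auto
  moreover have "mp.dim (V \<union> (*) (linform 2 c ^ d) ` homog 2 i) + mp.dim {f \<in> homog 2 i. linform 2 c ^ d * f \<in> V}
      = mp.dim V + mp.dim (homog 2 i :: 'k mpoly set)"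
    by (rule dim_homog_image) (use V in auto)
  ultimately show ?thesis by (intro that[of c]) simp
qed

text \<open>In two variables \<open>d + dim R_i = dim R_(i + d)\<close>, so d is the dividing line
  for the dimension of the ideal in degree i + d. Up to d, transversality to the ideal gives
  injectivity; beyond d, transversality to a subspace of dimension exactly d already fills the whole
  degree.\<close>

theorem SLP_two_variables:
  fixes I :: "'k::field_char_0 mpoly set"
  assumes I: "homog_ideal 2 I" and art: "artinian 2 I"
  shows "SLP 2 I"
proof (rule SLP_I[OF assms])
  fix d i :: nat
  let ?W = "I \<inter> homog 2 (i + d)"
  show "\<exists>c. mult_injective 2 I (linform 2 c ^ d) i \<or> mult_surjective 2 I (linform 2 c ^ d) d i"
  proof (cases "mp.dim ?W \<le> d")
    case True
    obtain c where "mp.dim ?W + mp.dim (homog 2 i :: 'k mpoly set) \<le> mp.dim (?W \<union> (*) (linform 2 c ^ d) ` homog 2 i)"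
      using binary_forms_transversal[OF _ subspace_ideal_homog[OF I] True] by blast
    then have "mult_injective 2 I (linform 2 c ^ d) i"
      unfolding mult_injective_iff[OF I linform_power_homog] using hilb_add_dim[of 2 I i] by simp
    then show ?thesis by blast
  next
    case False
    obtain B where B: "finite B" "B \<subseteq> ?W" "mp.independent B" "mp.span B = mp.span ?W" "card B = mp.dim ?W"
      by (rule mp.fin_dim_basis[OF fin_dim_sub_homog[of ?W 2 "i + d"]]) auto
    obtain C where C: "C \<subseteq> B" "card C = d" using False B(5) obtain_subset_with_card_n[of d B] by auto
    define V where "V = mp.span C"
    have VW: "V \<subseteq> ?W"
      unfolding V_def by (rule mp.span_minimal) (use C(1) B(2) subspace_ideal_homog[OF I] in blast)+
    have "mp.dim V = d"
      using mp.dim_eq_card_independent[of C] mp.independent_mono[OF B(3) C(1)] C(2) by (simp add: V_def)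
    then obtain c where c: "d + mp.dim (homog 2 i :: 'k mpoly set) \<le> mp.dim (V \<union> (*) (linform 2 c ^ d) ` homog 2 i)"
      using binary_forms_transversal[of V i d] VW by (auto simp: V_def)
    also have "\<dots> \<le> mp.dim (?W \<union> (*) (linform 2 c ^ d) ` homog 2 i)"
      by (rule mp.dim_mono_fin[OF fin_dim_sub_homog[OF ideal_Un_times_subset[OF linform_power_homog]]])
        (use VW in \<open>auto intro: mp.span_base\<close>)
    finally have "mult_surjective 2 I (linform 2 c ^ d) d i"
      unfolding mult_surjective_iff[OF I linform_power_homog] by (simp add: dim_homog card_mons)
    then show ?thesis by blast
  qed
qed

section \<open>Powers of linear forms\<close>

text \<open>A functional vanishing on P turns the sums into a univariate polynomial that is zero for
  every t, so all its coefficients vanish. If \<open>v k\<close> were outside P, some functional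
  would give it the coefficient 1.\<close>

lemma coefficients_in_subspace:
  fixes P :: "'k::field_char_0 mpoly set"
  assumes P: "mp.subspace P" and all: "\<And>t. (\<Sum>k\<le>n. kscale (t ^ k) (v k)) \<in> P" and k: "k \<le> n"
  shows "v k \<in> P"
proof (rule ccontr)
  assume "v k \<notin> P"
  then obtain \<phi> where \<phi>: "Vector_Spaces.linear kscale (*) \<phi>" "\<And>x. x \<in> P \<Longrightarrow> \<phi> x = 0" "\<phi> (v k) = 1"
    using mp.separating_functional[OF P] by blast
  interpret \<phi>: Vector_Spaces.linear kscale "(*)" \<phi> by (rule \<phi>(1))
  define p where "p = (\<Sum>k\<le>n. monom (\<phi> (v k)) k)"
  have "poly p t = 0" for t
  proof -
    have "poly p t = \<phi> (\<Sum>k\<le>n. kscale (t ^ k) (v k))"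
      by (simp add: p_def poly_sum poly_monom \<phi>.sum \<phi>.scale mult.commute)
    then show ?thesis using \<phi>(2)[OF all] by simp
  qed
  then have "p = 0" using poly_all_0_iff_0 by blast
  moreover have "coeff p k = \<phi> (v k)" using k by (simp add: p_def coeff_sum)
  ultimately show False using \<phi>(3) by simp
qed

lemma linform_add_scale: "linform r (\<lambda>j. a j + t * b j) = linform r a + const t * linform r (b :: nat \<Rightarrow> 'k::field)"
  by (simp add: linform_def const_add const_mult distrib_right sum.distrib sum_distrib_left mult.assoc)

lemma const_power: "const (a ^ n) = (const a :: 'k::field mpoly) ^ n"
  by (induction n) (simp_all add: const_mult)

lemma linform_line_power:
  fixes f :: "'k::field mpoly"
  shows "linform r (\<lambda>j. a j + t * b j) ^ n * f
    = (\<Sum>k\<le>n. kscale (t ^ k) (kscale (of_nat (n choose k)) (linform r b ^ k * linform r a ^ (n - k) * f)))"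
proof -
  have of_nat: "const (of_nat m) = (of_nat m :: 'k mpoly)" for m
    by (induction m) (simp_all add: const_add)
  have "linform r (\<lambda>j. a j + t * b j) ^ n = (\<Sum>k\<le>n. of_nat (n choose k) * (const t * linform r b) ^ k * linform r a ^ (n - k))"
    unfolding linform_add_scale by (subst add.commute) (rule binomial_ring)
  then have "linform r (\<lambda>j. a j + t * b j) ^ n * f
    = (\<Sum>k\<le>n. of_nat (n choose k) * (const t * linform r b) ^ k * linform r a ^ (n - k) * f)"
    by (simp only: sum_distrib_right)
  also have "\<dots> = (\<Sum>k\<le>n. kscale (t ^ k) (kscale (of_nat (n choose k)) (linform r b ^ k * linform r a ^ (n - k) * f)))"
    by (intro sum.cong refl) (simp only: kscale_def of_nat const_power power_mult_distrib mult_ac)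
  finally show ?thesis .
qed

text \<open>Polarization: the coefficient of t in \<open>(L + t * x_i) ^ n * g\<close> is
  \<open>n * x_i * L ^ (n - 1) * g\<close>, and n is invertible. Factors L are traded for variables
  one at a time, which is why the induction runs over products
  \<open>L ^ (s - j) * f\<close>.\<close>

lemma powers_span:
  fixes P :: "'k::field_char_0 mpoly set"
  assumes P: "mp.subspace P" and pow: "\<And>c. linform r c ^ s \<in> P"
  shows "homog r s \<subseteq> P"
proof -
  have "linform r c ^ (s - j) * f \<in> P" if "j \<le> s" "f \<in> homog r j" for j c f
    using that
  proof (induction j arbitrary: c f)
    case 0
    show ?case
    proof -
      have "f \<in> {f \<in> UNIV. linform r c ^ s * f \<in> P}"
      proof (rule supp_in_induct)
        show "f \<in> supp_in (mons r 0)" using 0 by (simp add: homog_eq_supp_in)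
        show "mp.subspace {f \<in> UNIV. linform r c ^ s * f \<in> P}"
          by (rule subspace_colon[OF P mp.subspace_UNIV])
      qed (use pow in \<open>simp add: mons_0\<close>)
      then show ?thesis by simp
    qed
  next
    case (Suc j)
    have "f \<in> {f \<in> UNIV. linform r c ^ (s - Suc j) * f \<in> P}"
    proof (rule homog_Suc_induct[OF Suc.prems(2)])
      show "mp.subspace {f \<in> UNIV. linform r c ^ (s - Suc j) * f \<in> P}"
        by (rule subspace_colon[OF P mp.subspace_UNIV])
      fix i and g :: "'k mpoly" assume i: "i < r" and g: "g \<in> homog r j"
      define n where "n = s - j"
      have n: "n \<ge> 1" "s - Suc j = n - 1" using Suc.prems(1) by (auto simp: n_def)
      define b where "b = (\<lambda>l. if l = i then 1 else 0 :: 'k)"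
      have lb: "linform r b = var i" unfolding b_def using i by (rule linform_unit)
      have "kscale (of_nat (n choose 1)) (linform r b ^ 1 * linform r c ^ (n - 1) * g) \<in> P"
      proof (rule coefficients_in_subspace[where n = n and k = 1 and
            v = "\<lambda>k. kscale (of_nat (n choose k)) (linform r b ^ k * linform r c ^ (n - k) * g)", OF P])
        fix t
        have "linform r (\<lambda>l. c l + t * b l) ^ n * g \<in> P"
          using Suc.IH[OF _ g] Suc.prems(1) by (simp add: n_def)
        then show "(\<Sum>k\<le>n. kscale (t ^ k) (kscale (of_nat (n choose k)) (linform r b ^ k * linform r c ^ (n - k) * g))) \<in> P"
          by (simp only: linform_line_power)
      qed (use n in simp)
      then have "kscale (of_nat n) (var i * linform r c ^ (n - 1) * g) \<in> P" by (simp add: lb)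
      then have "kscale (inverse (of_nat n)) (kscale (of_nat n) (var i * linform r c ^ (n - 1) * g)) \<in> P"
        by (rule mp.subspace_scale[OF P])
      then have "var i * linform r c ^ (n - 1) * g \<in> P" using n by simp
      then show "var i * g \<in> {f \<in> UNIV. linform r c ^ (s - Suc j) * f \<in> P}"
        by (simp add: n(2) mult.assoc mult.left_commute)
    qed
    then show ?case by simp
  qed
  from this[of s] show ?thesis by auto
qed

lemma linform_power_notin:
  fixes I :: "'k::field_char_0 mpoly set"
  assumes I: "homog_ideal r I" and h: "hilb r I s > 0"
  obtains c where "linform r c ^ s \<notin> I"
proof (rule ccontr)
  assume "\<not> thesis"
  then have "\<And>c. linform r c ^ s \<in> I" using that by blast
  then have "homog r s \<subseteq> I" using powers_span[OF homog_ideal_subspace[OF I]] by blast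
  then have "I \<inter> homog r s = homog r s" by blast
  then show False using h by (simp add: hilb_def)
qed

text \<open>With c k the value of a functional at \<open>B ^ k * A ^ (Suc n - k)\<close>, the left-hand side
  differentiates its value at \<open>(A + t * B) ^ Suc n\<close>, as a polynomial in t.\<close>

lemma pderiv_line_power:
  fixes c :: "nat \<Rightarrow> 'k::field_char_0"
  shows "pderiv (\<Sum>k\<le>Suc n. monom (of_nat (Suc n choose k) * c k) k)
    = smult (of_nat (Suc n)) (\<Sum>k\<le>n. monom (of_nat (n choose k) * c (Suc k)) k)"
proof (rule poly_eqI)
  fix j
  have co: "coeff (\<Sum>k\<le>m. monom (d k) k) i = (if i \<le> m then d i else 0)" for m i and d :: "nat \<Rightarrow> 'k"
    by (simp add: coeff_sum)
  have "of_nat (Suc j) * of_nat (Suc n choose Suc j) = (of_nat (Suc n) * of_nat (n choose j) :: 'k)"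
    using Suc_times_binomial_eq[of n j] by (metis mult.commute of_nat_mult)
  then show "coeff (pderiv (\<Sum>k\<le>Suc n. monom (of_nat (Suc n choose k) * c k) k)) j
     = coeff (smult (of_nat (Suc n)) (\<Sum>k\<le>n. monom (of_nat (n choose k) * c (Suc k)) k)) j"
    by (simp add: coeff_pderiv co mult.assoc[symmetric] del: of_nat_Suc binomial_Suc_Suc sum.atMost_Suc)
qed

text \<open>If the map is never onto, then two functionals cutting out the ideal in degree Suc n, evaluated at
  \<open>linform r c ^ Suc n\<close>, are two forms in c with proportional gradients, hence proportional by
  Euler's formula.\<close>

lemma mult_surjective_codim_2:
  fixes I :: "'k::field_char_0 mpoly set"
  assumes I: "homog_ideal r I" and h: "hilb r I (Suc n) = 2"
  obtains c where "mult_surjective r I (linform r c ^ n) n 1"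
proof (rule ccontr)
  assume no: "\<not> thesis"
  let ?s = "Suc n"
  let ?R = "homog r ?s :: 'k mpoly set" and ?W = "I \<inter> homog r ?s"
  have W: "mp.subspace ?W" by (rule subspace_ideal_homog[OF I])
  have spW: "mp.span ?W = ?W" using W by (simp only: mp.span_eq_iff)
  have fW: "mp.fin_dim ?W" by (rule fin_dim_sub_homog[of _ r ?s]) blast
  have dR: "mp.dim ?R = mp.dim ?W + 2" using hilb_add_dim[of r I ?s] h by simp
  have small: "mp.dim (?W \<union> (*) (linform r c ^ n) ` homog r 1) \<le> Suc (mp.dim ?W)" for c
  proof -
    have "\<not> mult_surjective r I (linform r c ^ n) n 1" using no that by blast
    then show ?thesis
      unfolding mult_surjective_iff[OF I linform_power_homog] using dR by simp
  qed
  have "\<not> ?R \<subseteq> ?W"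
  proof
    assume "?R \<subseteq> ?W"
    then have "mp.dim ?R \<le> mp.dim ?W" using mp.dim_mono_fin[OF fW] mp.span_superset[of ?W] by blast
    then show False using dR by simp
  qed
  then obtain u where u: "u \<in> ?R" "u \<notin> ?W" by blast
  have fU: "mp.fin_dim (insert u ?W)" by (rule fin_dim_sub_homog[of _ r ?s]) (use u in blast)
  have dU: "mp.dim (insert u ?W) = Suc (mp.dim ?W)" using mp.dim_insert_fin[OF fW, of u] u spW by simp
  have "\<not> ?R \<subseteq> mp.span (insert u ?W)"
  proof
    assume "?R \<subseteq> mp.span (insert u ?W)"
    then have "mp.dim ?R \<le> mp.dim (insert u ?W)" by (rule mp.dim_mono_fin[OF fU])
    then show False using dR dU by simp
  qed
  then obtain v where v: "v \<in> ?R" "v \<notin> mp.span (insert u ?W)" by blast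
  \<comment> \<open>By exchange u and v can be separated in both directions, so \<phi> and \<psi>
    form the basis dual to u, v modulo \<open>?W\<close>.\<close>
  have "u \<notin> mp.span (insert v ?W)"
    using mp.in_span_insert[of u v ?W] u v spW by auto
  then obtain \<phi> where \<phi>: "Vector_Spaces.linear kscale (*) \<phi>" "\<And>x. x \<in> mp.span (insert v ?W) \<Longrightarrow> \<phi> x = 0" "\<phi> u = 1"
    using mp.separating_functional[OF mp.subspace_span] by blast
  obtain \<psi> where \<psi>: "Vector_Spaces.linear kscale (*) \<psi>" "\<And>x. x \<in> mp.span (insert u ?W) \<Longrightarrow> \<psi> x = 0" "\<psi> v = 1"
    using mp.separating_functional[OF mp.subspace_span v(2)] by blast
  interpret \<phi>: Vector_Spaces.linear kscale "(*)" \<phi> by (rule \<phi>(1))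
  interpret \<psi>: Vector_Spaces.linear kscale "(*)" \<psi> by (rule \<psi>(1))
  have W0: "\<phi> x = 0" "\<psi> x = 0" if "x \<in> ?W" for x
    using that \<phi>(2) \<psi>(2) by (auto intro: mp.span_base)
  have "\<psi> u = 0" using \<psi>(2) by (auto intro: mp.span_base)
  \<comment> \<open>By \<open>small\<close> the image of multiplication by \<open>L ^ n\<close> has
    dimension at most one modulo \<open>?W\<close>, hence the two-by-two minors of (\<phi>, \<psi>)
    vanish on it.\<close>
  have minor: "\<phi> p * \<psi> q = \<psi> p * \<phi> q"
    if p: "p \<in> (*) (linform r c ^ n) ` homog r 1" and q: "q \<in> (*) (linform r c ^ n) ` homog r 1" for c p q
  proof (rule ccontr)
    assume ne: "\<phi> p * \<psi> q \<noteq> \<psi> p * \<phi> q"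
    let ?U = "?W \<union> (*) (linform r c ^ n) ` homog r 1"
    have UR: "?U \<subseteq> ?R" using ideal_Un_times_subset[OF linform_power_homog, of I r 1 n c] by simp
    have pR: "p \<in> ?R" "q \<in> ?R" using p q UR by auto
    have "p \<notin> ?W" using ne W0 by auto
    then have d1: "mp.dim (insert p ?W) = Suc (mp.dim ?W)" using mp.dim_insert_fin[OF fW, of p] spW by simp
    have "q \<notin> mp.span (insert p ?W)"
    proof
      assume "q \<in> mp.span (insert p ?W)"
      then obtain k where k: "q - kscale k p \<in> ?W" using spW by (auto simp: mp.span_breakdown_eq)
      have "\<phi> q = k * \<phi> p" "\<psi> q = k * \<psi> p"
        using W0[OF k] by (simp_all add: \<phi>.diff \<psi>.diff \<phi>.scale \<psi>.scale)
      then show False using ne by simp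
    qed
    moreover have "mp.fin_dim (insert p ?W)" by (rule fin_dim_sub_homog[of _ r ?s]) (use pR in blast)
    ultimately have "mp.dim (insert q (insert p ?W)) = Suc (Suc (mp.dim ?W))"
      using mp.dim_insert_fin[of "insert p ?W" q] d1 by simp
    moreover have "mp.dim (insert q (insert p ?W)) \<le> mp.dim ?U"
      by (rule mp.dim_mono_fin[OF fin_dim_sub_homog[OF UR]]) (use p q in \<open>auto intro: mp.span_base\<close>)
    ultimately show False using small[of c] by simp
  qed
  have proportional: "\<phi> (linform r b ^ ?s) * \<psi> (linform r a ^ ?s) = \<psi> (linform r b ^ ?s) * \<phi> (linform r a ^ ?s)" for a b
  proof -
    \<comment> \<open>The polynomial whose value at t is \<chi> applied to the power of
      \<open>a + t * b\<close>. It and its derivative take, up to the factor \<open>Suc n\<close>,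
      values of \<chi> on multiples of the same \<open>L ^ n\<close>, so \<open>minor\<close> makes
      the Wronskian of \<open>D \<phi>\<close> and \<open>D \<psi>\<close> vanish.\<close>
    define D where "D \<chi> = (\<Sum>k\<le>?s. monom (of_nat (?s choose k) * \<chi> (linform r b ^ k * linform r a ^ (?s - k))) k)"
      for \<chi> :: "'k mpoly \<Rightarrow> 'k"
    define l where "l t = (\<lambda>j. a j + t * b j)" for t
    have D: "poly (D \<chi>) t = \<chi> (linform r (l t) ^ n * linform r (l t))"
      "poly (pderiv (D \<chi>)) t = of_nat ?s * \<chi> (linform r (l t) ^ n * linform r b)"
      if \<chi>: "Vector_Spaces.linear kscale (*) \<chi>" for \<chi> t
    proof -
      interpret \<chi>: Vector_Spaces.linear kscale "(*)" \<chi> by (rule \<chi>)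
      have "linform r (l t) ^ n * linform r (l t) = linform r (l t) ^ ?s * 1" by (simp add: mult.commute)
      also have "\<dots> = (\<Sum>k\<le>?s. kscale (t ^ k) (kscale (of_nat (?s choose k)) (linform r b ^ k * linform r a ^ (?s - k) * 1)))"
        unfolding l_def by (rule linform_line_power)
      finally have e: "linform r (l t) ^ n * linform r (l t)
        = (\<Sum>k\<le>?s. kscale (t ^ k) (kscale (of_nat (?s choose k)) (linform r b ^ k * linform r a ^ (?s - k) * 1)))" .
      show "poly (D \<chi>) t = \<chi> (linform r (l t) ^ n * linform r (l t))"
        unfolding e D_def poly_sum poly_monom \<chi>.sum \<chi>.scale
        by (intro sum.cong refl) (simp only: mult_ac mult_1_right mult_1_left)
      have e': "linform r (l t) ^ n * linform r b
        = (\<Sum>k\<le>n. kscale (t ^ k) (kscale (of_nat (n choose k)) (linform r b ^ k * linform r a ^ (n - k) * linform r b)))"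
        unfolding l_def by (rule linform_line_power)
      have "pderiv (D \<chi>) = smult (of_nat ?s) (\<Sum>k\<le>n. monom (of_nat (n choose k) * \<chi> (linform r b ^ Suc k * linform r a ^ (?s - Suc k))) k)"
        unfolding D_def by (rule pderiv_line_power)
      then have "poly (pderiv (D \<chi>)) t
        = of_nat ?s * (\<Sum>k\<le>n. of_nat (n choose k) * \<chi> (linform r b ^ Suc k * linform r a ^ (?s - Suc k)) * t ^ k)"
        by (simp only: poly_smult poly_sum poly_monom)
      also have "(\<Sum>k\<le>n. of_nat (n choose k) * \<chi> (linform r b ^ Suc k * linform r a ^ (?s - Suc k)) * t ^ k)
        = \<chi> (linform r (l t) ^ n * linform r b)"
        unfolding e' \<chi>.sum \<chi>.scale by (intro sum.cong refl) (simp only: mult_ac power_Suc diff_Suc_Suc)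
      finally show "poly (pderiv (D \<chi>)) t = of_nat ?s * \<chi> (linform r (l t) ^ n * linform r b)" .
    qed
    have "pderiv (D \<phi>) * D \<psi> = D \<phi> * pderiv (D \<psi>)"
    proof (rule poly_eq_poly_eq_iff[THEN iffD1], rule ext)
      fix t
      have "\<phi> (linform r (l t) ^ n * linform r b) * \<psi> (linform r (l t) ^ n * linform r (l t))
        = \<psi> (linform r (l t) ^ n * linform r b) * \<phi> (linform r (l t) ^ n * linform r (l t))"
        by (rule minor[of _ "l t"]) (rule imageI, rule linform_homog)+
      then show "poly (pderiv (D \<phi>) * D \<psi>) t = poly (D \<phi> * pderiv (D \<psi>)) t"
        by (simp add: D[OF \<phi>(1)] D[OF \<psi>(1)] del: of_nat_Suc)
    qed
    \<comment> \<open>The lowest coefficient is the value at a, the one at \<open>Suc n\<close> the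
      value at b, so proportional polynomials give proportional values at both forms.\<close>
    moreover have co: "coeff (D \<chi>) 0 = \<chi> (linform r a ^ ?s)" "coeff (D \<chi>) ?s = \<chi> (linform r b ^ ?s)" for \<chi>
      unfolding D_def by (simp_all add: coeff_sum del: sum.atMost_Suc binomial_Suc_Suc power_Suc)
    ultimately show ?thesis
    proof (cases "D \<psi> = 0")
      case True
      then show ?thesis using co[of \<psi>] by simp
    next
      case False
      then obtain x where "D \<phi> = smult x (D \<psi>)"
        using pderiv_ratio[of "D \<phi>" "D \<psi>"] \<open>pderiv (D \<phi>) * D \<psi> = D \<phi> * pderiv (D \<psi>)\<close> by blast
      then have "coeff (D \<phi>) 0 = x * coeff (D \<psi>) 0" "coeff (D \<phi>) ?s = x * coeff (D \<psi>) ?s" by simp_all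
      then show ?thesis by (simp only: co) simp
    qed
  qed
  have "\<exists>a. \<psi> (linform r a ^ ?s) \<noteq> 0"
  proof (rule ccontr)
    assume "\<nexists>a. \<psi> (linform r a ^ ?s) \<noteq> 0"
    then have "?R \<subseteq> {x. \<psi> x = 0}"
      by (intro powers_span mp.subspaceI) (auto simp: \<psi>.zero \<psi>.add \<psi>.scale)
    then show False using v \<psi>(3) by auto
  qed
  then obtain a where a: "\<psi> (linform r a ^ ?s) \<noteq> 0" by blast
  have sub: "mp.subspace {x. \<phi> x * A = \<psi> x * B}" for A B
  proof (rule mp.subspaceI; unfold mem_Collect_eq)
    show "\<phi> 0 * A = \<psi> 0 * B" by (simp add: \<phi>.zero \<psi>.zero)
    show "\<phi> (x + y) * A = \<psi> (x + y) * B" if "\<phi> x * A = \<psi> x * B" "\<phi> y * A = \<psi> y * B" for x y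
      by (simp only: \<phi>.add \<psi>.add distrib_right that)
    show "\<phi> (kscale k x) * A = \<psi> (kscale k x) * B" if "\<phi> x * A = \<psi> x * B" for k x
      by (simp only: \<phi>.scale \<psi>.scale mult.assoc that)
  qed
  \<comment> \<open>With a fixed, the relation is linear in x and holds on all powers, which span
    the degree. At u it says that \<psi> vanishes on the power of a.\<close>
  have "?R \<subseteq> {x. \<phi> x * \<psi> (linform r a ^ ?s) = \<psi> x * \<phi> (linform r a ^ ?s)}"
    by (rule powers_span[OF sub], rule CollectI, rule proportional)
  then show False using u(1) \<phi>(3) \<open>\<psi> u = 0\<close> a by auto
qed

section \<open>Sufficiency in several variables\<close>

text \<open>If h s grew beyond s \<ge> t, then \<open>n = h s + 1 \<le> s + 1\<close> would have
  \<open>free_count (Suc s) n = 0\<close>, so \<open>div_count\<close> would be all of n and exceed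
  h s, against Macaulay's bound. The inequality \<open>h s \<le> s\<close> propagates because h has
  not grown so far.\<close>

lemma hilb_nonincreasing:
  fixes I :: "'k::field_char_0 mpoly set"
  assumes I: "homog_ideal r I" and t: "hilb r I t \<le> t" and "t \<le> s"
  shows "hilb r I s \<le> hilb r I t"
  using \<open>t \<le> s\<close>
proof (induction s rule: dec_induct)
  case (step s)
  have "hilb r I (Suc s) \<le> hilb r I s"
  proof (rule ccontr)
    let ?n = "Suc (hilb r I s)"
    assume "\<not> hilb r I (Suc s) \<le> hilb r I s"
    then have "div_count (Suc s) ?n \<le> div_count (Suc s) (hilb r I (Suc s))" by (intro div_count_mono) simp
    moreover have "free_count (Suc s) ?n = 0" using step t by (intro free_count_eq_0) simp
    then have "div_count (Suc s) ?n = ?n" using div_count_add_free_count[of "Suc s" ?n] by simp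
    ultimately show False using macaulay[OF I, of s] by simp
  qed
  then show ?case using step by simp
qed simp

lemma mult_injective_steps:
  fixes I :: "'k::field_char_0 mpoly set"
  assumes "\<And>j. i \<le> j \<Longrightarrow> j < i + d \<Longrightarrow> mult_injective r I (linform r c) j"
  shows "mult_injective r I (linform r c ^ d) i"
  using assms
proof (induction d)
  case 0
  then show ?case by (simp add: mult_injective_def)
next
  case (Suc d)
  show ?case unfolding mult_injective_def
  proof (intro ballI impI)
    fix f assume f: "f \<in> homog r i" "linform r c ^ Suc d * f \<in> I"
    have "linform r c ^ d * f \<in> homog r (i + d)" using f by simp
    moreover have "linform r c * (linform r c ^ d * f) \<in> I" using f by (simp add: mult.assoc)
    ultimately have "linform r c ^ d * f \<in> I"
      using Suc.prems[of "i + d"] unfolding mult_injective_def by simp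
    moreover have "mult_injective r I (linform r c ^ d) i" by (rule Suc.IH) (rule Suc.prems; simp)
    ultimately show "f \<in> I" using f(1) unfolding mult_injective_def by blast
  qed
qed

text \<open>The power \<open>L ^ (i + d)\<close> is the image of \<open>L ^ i\<close>, so the rank
  is at least one. This suffices when the source or the target has dimension one.\<close>

lemma dim_ideal_Un_power:
  fixes I :: "'k::field mpoly set"
  assumes I: "homog_ideal r I" and c: "linform r c ^ (i + d) \<notin> I"
  shows "Suc (mp.dim (I \<inter> homog r (i + d))) \<le> mp.dim (I \<inter> homog r (i + d) \<union> (*) (linform r c ^ d) ` homog r i)"
proof -
  let ?W = "I \<inter> homog r (i + d)" and ?U = "I \<inter> homog r (i + d) \<union> (*) (linform r c ^ d) ` homog r i"
  have U: "?U \<subseteq> homog r (i + d)" by (rule ideal_Un_times_subset) simp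
  have fW: "mp.fin_dim ?W" by (rule fin_dim_sub_homog[of _ r "i + d"]) blast
  have "mp.span ?W = ?W" using subspace_ideal_homog[OF I] by (simp only: mp.span_eq_iff)
  then have "linform r c ^ (i + d) \<notin> mp.span ?W" using c by blast
  then have "mp.dim (insert (linform r c ^ (i + d)) ?W) = Suc (mp.dim ?W)"
    using mp.dim_insert_fin[OF fW] by simp
  moreover have "linform r c ^ (i + d) \<in> (*) (linform r c ^ d) ` homog r i"
    by (rule image_eqI[of _ _ "linform r c ^ i"]) (auto simp: power_add mult.commute)
  then have "mp.dim (insert (linform r c ^ (i + d)) ?W) \<le> mp.dim ?U"
    by (intro mp.dim_mono_fin[OF fin_dim_sub_homog[OF U]]) (auto intro: mp.span_base)
  ultimately show ?thesis by simp
qed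

theorem SLP_sufficient:
  fixes I :: "'k::field_char_0 mpoly set"
  assumes I: "homog_ideal r I" and art: "artinian r I" and h0: "hilb r I 0 = 1"
    and t: "hilb r I t \<le> t" "hilb r I t \<le> 2"
    and step: "\<And>j. Suc j < t \<Longrightarrow> hilb r I j = div_count (Suc j) (hilb r I (Suc j))"
  shows "SLP r I"
proof (rule SLP_I[OF I art])
  fix d i :: nat assume "d \<ge> 1"
  define s where "s = i + d"
  show "\<exists>c. mult_injective r I (linform r c ^ d) i \<or> mult_surjective r I (linform r c ^ d) d i"
  proof (cases "s < t")
    case True
    have gen: "general_linform r (\<lambda>L. mult_injective r I L j)" if "j \<in> {i..<s}" for j
    proof -
      have Ij: "I \<inter> homog r (j + 1) \<subseteq> homog r (j + 1)" by blast
      obtain c where c: "mp.dim (I \<inter> homog r (Suc j)) + div_count (Suc j) (hilb r I (Suc j))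
        \<le> mp.dim (I \<inter> homog r (Suc j) \<union> (*) (linform r c) ` homog r j)"
        using green_ideal[OF I] .
      have j: "hilb r I j = div_count (Suc j) (hilb r I (Suc j))"
        using step that True by simp
      show ?thesis
      proof (rule general_linform_mono[OF general_linform_dim[OF Ij, of c]])
        fix c' assume "mp.dim (I \<inter> homog r (j + 1) \<union> (*) (linform r c ^ 1) ` homog r j)
          \<le> mp.dim (I \<inter> homog r (j + 1) \<union> (*) (linform r c' ^ 1) ` homog r j)"
        then show "mult_injective r I (linform r c') j"
          unfolding mult_injective_iff[OF I linform_homog] using c j by simp
      qed
    qed
    \<comment> \<open>One form must serve every step from i to s, because the injections are
      composed for the same L.\<close>
    have "general_linform r (\<lambda>L. \<forall>j\<in>{i..<s}. mult_injective r I L j)"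
      by (rule general_linform_ball) (use gen in auto)
    then obtain c where "\<forall>j\<in>{i..<s}. mult_injective r I (linform r c) j"
      unfolding general_linform_def by blast
    then have "mult_injective r I (linform r c ^ d) i"
      by (intro mult_injective_steps) (auto simp: s_def)
    then show ?thesis by blast
  next
    case False
    then have "hilb r I s \<le> 2" using hilb_nonincreasing[OF I t(1), of s] t(2) by simp
    then consider "hilb r I s = 0" | "hilb r I s = 1" | "hilb r I s = 2" by linarith
    then show ?thesis
    proof cases
      case 1
      have "mp.dim (I \<inter> homog r (i + d)) \<le> mp.dim (I \<inter> homog r (i + d) \<union> (*) (linform r c ^ d) ` homog r i)" for c
        by (rule mp.dim_mono_fin[OF fin_dim_sub_homog[OF ideal_Un_times_subset[OF linform_power_homog]]])
          (auto intro: mp.span_base)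
      then show ?thesis
        unfolding mult_surjective_iff[OF I linform_power_homog]
        using hilb_add_dim[of r I s] 1 by (simp add: s_def)
    next
      case 2
      obtain c where c: "linform r c ^ s \<notin> I" using linform_power_notin[OF I, of s] 2 by auto
      then have "mult_surjective r I (linform r c ^ d) d i"
        unfolding mult_surjective_iff[OF I linform_power_homog]
        using hilb_add_dim[of r I s] 2 dim_ideal_Un_power[OF I, of c i d] by (simp add: s_def)
      then show ?thesis by blast
    next
      case 3
      show ?thesis
      proof (cases "i = 0")
        case True
        \<comment> \<open>The source is one-dimensional, so injectivity only asks for some
          \<open>L ^ s\<close> outside the ideal.\<close>
        obtain c where c: "linform r c ^ s \<notin> I" using linform_power_notin[OF I, of s] 3 by auto
        then have "mult_injective r I (linform r c ^ d) i"
          unfolding mult_injective_iff[OF I linform_power_homog]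
          using h0 True dim_ideal_Un_power[OF I, of c i d] by (simp add: s_def)
        then show ?thesis by blast
      next
        case False
        then obtain n where n: "s = Suc n" by (cases s) (auto simp: s_def)
        \<comment> \<open>Source degree 1 is enough: from
          \<open>L ^ n = L ^ d * L ^ (i - 1)\<close>, surjectivity of \<open>L ^ n\<close> out of
          degree 1 yields that of \<open>L ^ d\<close> out of degree i.\<close>
        obtain c where c: "mult_surjective r I (linform r c ^ n) n 1"
          using mult_surjective_codim_2[OF I, of n] 3 n by blast
        have "mult_surjective r I (linform r c ^ d) d i"
          unfolding mult_surjective_def
        proof
          fix g :: "'k mpoly" assume "g \<in> homog r (i + d)"
          then have "g \<in> homog r (1 + n)" using n by (simp add: s_def)
          then obtain f where f: "f \<in> homog r 1" "g - linform r c ^ n * f \<in> I"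
            using c unfolding mult_surjective_def by blast
          have "linform r c ^ (i - 1) * f \<in> homog r i" using linform_power_times_homog[OF f(1), of c "i - 1"] False by simp
          moreover have "n = d + (i - 1)" using n False by (simp add: s_def)
          then have "g - linform r c ^ d * (linform r c ^ (i - 1) * f) \<in> I" using f(2) by (simp add: power_add mult.assoc)
          ultimately show "\<exists>f\<in>homog r i. g - linform r c ^ d * f \<in> I" by blast
        qed
        then show ?thesis by blast
      qed
    qed
  qed
qed

theorem theorem3p2:
  fixes h :: "nat \<Rightarrow> nat" and r e :: nat
  assumes r2: "r \<ge> 2"
    and Oseq: "O_sequence TYPE('k::field_char_0) r h"
    and h0: "h 0 = 1" and h1: "h 1 = r"
    and he: "h (Suc e) = 0"
  shows "(\<forall>I :: 'k mpoly set. homog_ideal r I \<and> artinian r I \<and> hilb r I = h \<longrightarrow> SLP r I)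
     \<longleftrightarrow> (r = 2 \<or>
          (r > 2 \<and> h (LEAST t. h t \<le> t) \<le> 2 \<and>
           (\<forall>i\<in>{1..<(LEAST t. h t \<le> t)}. h (i - 1) = binom_down i (h i))))"
proof -
  define t where "t = (LEAST t. h t \<le> t)"
  have "h (Suc e) \<le> Suc e" using he by simp
  then have ht: "h t \<le> t" unfolding t_def by (rule LeastI)
  have below: "i < h i" if "i < t" for i
    using not_less_Least[of i "\<lambda>t. h t \<le> t"] that by (simp add: t_def)
  have down: "binom_down (Suc j) (h (Suc j)) = div_count (Suc j) (h (Suc j))" if "Suc j < t" for j
    using below[OF that] by (intro binom_down_eq_div_count) auto
  obtain I0 :: "'k mpoly set" where I0: "homog_ideal r I0" "hilb r I0 = h"
    using Oseq unfolding O_sequence_def by blast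
  have growth: "div_count (Suc d) (h (Suc d)) \<le> h d" for d
    using macaulay[OF I0(1), of d] I0(2) by simp
  interpret macaulay_sequence r h
  proof
    show "h d \<le> card (mons r d)" for d
      using hilb_add_dim[of r I0 d] I0(2) by (simp add: dim_homog)
  qed (rule growth)
  let ?J = "supp_in (lex_mons r h) :: 'k mpoly set"
  have J: "hilb r ?J = h" by (rule ext) (rule hilb_lex)
  \<comment> \<open>Only the value at \<open>Suc e\<close> is given; h stays zero because it is
    nonincreasing from there on.\<close>
  have "h d = 0" if "d \<ge> Suc e" for d
    using hilb_nonincreasing[OF I0(1), of "Suc e" d] I0(2) he that by simp
  then have artJ: "artinian r ?J" unfolding artinian_def J by blast
  show ?thesis
    unfolding t_def[symmetric]
  proof
    assume all: "\<forall>I :: 'k mpoly set. homog_ideal r I \<and> artinian r I \<and> hilb r I = h \<longrightarrow> SLP r I"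
    then have slp: "SLP r ?J" using homog_ideal_lex artJ J by blast
    show "r = 2 \<or> (r > 2 \<and> h t \<le> 2 \<and> (\<forall>i\<in>{1..<t}. h (i - 1) = binom_down i (h i)))"
    proof (cases "r = 2")
      case False
      then have r3: "3 \<le> r" using r2 by simp
      have "h t \<le> 2"
        using not_SLP_lex_tail[OF ht _ h1 r3, where 'k = 'k] slp by fastforce
      moreover have "h (i - 1) = binom_down i (h i)" if i: "i \<in> {1..<t}" for i
      proof -
        obtain j where j: "i = Suc j" using i by (cases i) auto
        \<comment> \<open>Minimality of t gives h i > i, so some of the first h i monomials are free
          of \<open>x_0\<close>. A strict inequality would then make the lexicographic ideal
          fail.\<close>
        have "free_count (Suc j) (h (Suc j)) > 0" using below[of i] i j by (intro free_count_pos) auto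
        then have "\<not> div_count (Suc j) (h (Suc j)) < h j" using not_SLP_lex_growth[of j, where 'k = 'k] slp by blast
        then show ?thesis using growth[of j] down[of j] i j by simp
      qed
      ultimately show ?thesis using r3 by simp
    qed simp
  next
    assume cond: "r = 2 \<or> (r > 2 \<and> h t \<le> 2 \<and> (\<forall>i\<in>{1..<t}. h (i - 1) = binom_down i (h i)))"
    show "\<forall>I :: 'k mpoly set. homog_ideal r I \<and> artinian r I \<and> hilb r I = h \<longrightarrow> SLP r I"
    proof (intro allI impI)
      fix I :: "'k mpoly set" assume I: "homog_ideal r I \<and> artinian r I \<and> hilb r I = h"
      show "SLP r I"
      proof (cases "r = 2")
        case True
        then show ?thesis using SLP_two_variables I by blast
      next
        case False
        then have c: "h t \<le> 2" "\<forall>i\<in>{1..<t}. h (i - 1) = binom_down i (h i)" using cond by auto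
        have "h j = div_count (Suc j) (h (Suc j))" if "Suc j < t" for j
          using bspec[OF c(2), of "Suc j"] down[OF that] that by simp
        then show ?thesis using SLP_sufficient[of r I t] I h0 ht c(1) by simp
      qed
    qed
  qed
qed

end
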